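(* The class of autostackable groups includes groups with nonelementary Dehn functions; that is, there exists an autostackable group whose Dehn function is not bounded above by any iterated exponential function $n\mapsto 2^{2^{\cdot^{\cdot^{2^n}}}}$ of fixed height (equivalently, by any Kalmár elementary function).
   Context: Let $G$ be a group with a finite inverse-closed generating set $X$, no element of which represents the identity. Let $\Gamma=\Gamma(G,X)$ be the Cayley graph, $\vec E$ its set of directed edges and $\vec P$ its set of directed edge paths. For $g\in G$, $a\in X$, $e_{g,a}$ is the directed edge from $g$ to $ga$ labeled $a$; $e_{g,a}$ and $e_{ga,a^{-1}}$ have the same underlying undirected edge. A flow function associated to a maximal tree $\mathcal T$ in $\Gamma$ is a function $\Phi:\vec E\to\vec P$ such that: (F1) $\Phi(e)$ has the same initial and terminal vertices as $e$; (F2d) if the undirected edge underlying $e$ lies in $\mathcal T$, then $\Phi(e)=e$; (F2r) the transitive closure of the relation $<$ on $\vec E$, where $e'<e$ whenever $e'$ lies on $\Phi(e)$ and the undirected edges underlying both $e$ and $e'$ do not lie in $\mathcal T$, is a well-founded strict partial ordering. It is bounded if there is a constant $k$ such that every path $\Phi(e)$ has length at most $k$. For $g\in G$, $\mathsf{nf}(g)\in X^*$ is the label of the unique path without backtracking in $\mathcal T$ from the identity to $g$, and $\mathcal N_{\mathcal T}=\{\mathsf{nf}(g)\mid g\in G\}$. The stacking map $\phi:\mathcal N_{\mathcal T}\times X\to X^*$ sends $(\mathsf{nf}(g),a)$ to the label of $\Phi(e_{g,a})$, and $\mathsf{graph}(\phi)=\{(\mathsf{nf}(g),a,\phi(\mathsf{nf}(g),a))\mid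 g\in G,a\in X\}\subseteq (X^* )^3$. A subset $L\subseteq (X^* )^n$ is synchronously regular if the set of padded words $\{\mathsf{pad}(w)\mid w\in L\}$ is a regular language over the alphabet $(X\cup\{\$\})^n$, where $\$\notin X$ and $\mathsf{pad}(w_1,\dots,w_n)$ is obtained by appending letters $\$$ to the ends of the shorter $w_i$ so that all have the same length $N=\max_i l(w_i)$, and reading the result as a word of length $N$ of $n$-tuples. $G$ is autostackable over $X$ if there is a bounded flow function on a maximal tree of $\Gamma(G,X)$ for which $\mathsf{graph}(\phi)$ is synchronously regular; $G$ is autostackable if this holds for some finite inverse-closed generating set. Such groups are finitely presented. The Dehn function of a finite presentation of a group sends $n$ to the maximum, over words $w$ of length at most $n$ representing the identity, of the minimal number of 2-cells in a van Kampen diagram with boundary label $w$; whether it is elementary-bounded does not depend on the choice of finite presentation. *)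

theory Defs
  imports "HOL-Algebra.Generated_Groups" "HOL-Combinatorics.Orbits" "HOL-Library.Extended_Nat"
begin

section \<open>Cayley graphs, maximal trees and flow functions\<close>

definition fin_gen_set :: "('a, 'b) monoid_scheme \<Rightarrow> 'a set \<Rightarrow> bool" where
  "fin_gen_set G X \<longleftrightarrow> finite X \<and> X \<subseteq> carrier G \<and> generate G X = carrier G \<and>
     (\<forall>a\<in>X. inv\<^bsub>G\<^esub> a \<in> X) \<and> \<one>\<^bsub>G\<^esub> \<notin> X"

text \<open>The pair \<open>(g, a)\<close> is the directed edge from \<open>g\<close> to \<open>g a\<close> labelled \<open>a\<close>.\<close>

type_synonym 'a edge = "'a \<times> 'a"

definition edges :: "('a, 'b) monoid_scheme \<Rightarrow> 'a set \<Rightarrow> 'a edge set" where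
  "edges G X = carrier G \<times> X"

definition init_vertex :: "'a edge \<Rightarrow> 'a" where
  "init_vertex e = fst e"

definition label :: "'a edge \<Rightarrow> 'a" where
  "label e = snd e"

definition term_vertex :: "('a, 'b) monoid_scheme \<Rightarrow> 'a edge \<Rightarrow> 'a" where
  "term_vertex G e = init_vertex e \<otimes>\<^bsub>G\<^esub> label e"

definition rev_edge :: "('a, 'b) monoid_scheme \<Rightarrow> 'a edge \<Rightarrow> 'a edge" where
  "rev_edge G e = (term_vertex G e, inv\<^bsub>G\<^esub> (label e))"

text \<open>The undirected edge underlying \<open>e\<close> is the set of its two orientations.\<close>

definition undirected :: "('a, 'b) monoid_scheme \<Rightarrow> 'a edge \<Rightarrow> 'a edge set" where
  "undirected G e = {e, rev_edge G e}"

text \<open>\<open>is_path G X g p h\<close>: the list \<open>p\<close> is a directed edge path from \<open>g\<close> to \<open>h\<close>;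
  the list alone determines the path unless it is empty.\<close>

fun is_path :: "('a, 'b) monoid_scheme \<Rightarrow> 'a set \<Rightarrow> 'a \<Rightarrow> 'a edge list \<Rightarrow> 'a \<Rightarrow> bool" where
  "is_path G X g [] h \<longleftrightarrow> g \<in> carrier G \<and> h = g"
| "is_path G X g (e # p) h \<longleftrightarrow> e \<in> edges G X \<and> init_vertex e = g \<and> is_path G X (term_vertex G e) p h"

definition path_label :: "'a edge list \<Rightarrow> 'a list" where
  "path_label p = map label p"

definition no_backtrack :: "('a, 'b) monoid_scheme \<Rightarrow> 'a edge list \<Rightarrow> bool" where
  "no_backtrack G p \<longleftrightarrow> (\<forall>i. Suc i < length p \<longrightarrow> p ! Suc i \<noteq> rev_edge G (p ! i))"

definition reduced_path_in ::
    "('a, 'b) monoid_scheme \<Rightarrow> 'a set \<Rightarrow> 'a edge set set \<Rightarrow> 'a \<Rightarrow> 'a edge list \<Rightarrow> 'a \<Rightarrow> bool" where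
  "reduced_path_in G X T g p h \<longleftrightarrow>
     is_path G X g p h \<and> no_backtrack G p \<and> undirected G ` set p \<subseteq> T"

text \<open>A maximal tree contains every vertex, so it is given by its set \<open>T\<close> of undirected edges.\<close>

definition maximal_tree :: "('a, 'b) monoid_scheme \<Rightarrow> 'a set \<Rightarrow> 'a edge set set \<Rightarrow> bool" where
  "maximal_tree G X T \<longleftrightarrow> T \<subseteq> undirected G ` edges G X \<and>
     (\<forall>g\<in>carrier G. \<forall>h\<in>carrier G. \<exists>!p. reduced_path_in G X T g p h)"

definition flow_rel ::
    "('a, 'b) monoid_scheme \<Rightarrow> 'a set \<Rightarrow> 'a edge set set \<Rightarrow> ('a edge \<Rightarrow> 'a edge list) \<Rightarrow> 'a edge rel" where
  "flow_rel G X T \<Phi> = {(e', e). e \<in> edges G X \<and> e' \<in> set (\<Phi> e) \<and>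
     undirected G e \<notin> T \<and> undirected G e' \<notin> T}"

definition flow_function ::
    "('a, 'b) monoid_scheme \<Rightarrow> 'a set \<Rightarrow> 'a edge set set \<Rightarrow> ('a edge \<Rightarrow> 'a edge list) \<Rightarrow> bool" where
  "flow_function G X T \<Phi> \<longleftrightarrow>
     (\<forall>e\<in>edges G X. is_path G X (init_vertex e) (\<Phi> e) (term_vertex G e)) \<and>
     (\<forall>e\<in>edges G X. undirected G e \<in> T \<longrightarrow> \<Phi> e = [e]) \<and>
     irrefl ((flow_rel G X T \<Phi>)\<^sup>+) \<and> trans ((flow_rel G X T \<Phi>)\<^sup>+) \<and> wf ((flow_rel G X T \<Phi>)\<^sup>+)"

definition bounded_flow_function ::
    "('a, 'b) monoid_scheme \<Rightarrow> 'a set \<Rightarrow> 'a edge set set \<Rightarrow> ('a edge \<Rightarrow> 'a edge list) \<Rightarrow> bool" where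
  "bounded_flow_function G X T \<Phi> \<longleftrightarrow> flow_function G X T \<Phi> \<and>
     (\<exists>k. \<forall>e\<in>edges G X. length (\<Phi> e) \<le> k)"

definition nf :: "('a, 'b) monoid_scheme \<Rightarrow> 'a set \<Rightarrow> 'a edge set set \<Rightarrow> 'a \<Rightarrow> 'a list" where
  "nf G X T g = path_label (THE p. reduced_path_in G X T \<one>\<^bsub>G\<^esub> p g)"

text \<open>Only the values at \<open>w\<close> in the image of \<open>nf\<close> and \<open>a\<close> in \<open>X\<close> are meaningful.\<close>

definition stacking_map :: "('a, 'b) monoid_scheme \<Rightarrow> 'a set \<Rightarrow> 'a edge set set \<Rightarrow>
    ('a edge \<Rightarrow> 'a edge list) \<Rightarrow> 'a list \<Rightarrow> 'a \<Rightarrow> 'a list" where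
  "stacking_map G X T \<Phi> w a = path_label (\<Phi> (inv_into (carrier G) (nf G X T) w, a))"

text \<open>An \<open>n\<close>-tuple of words is a list of \<open>n\<close> words; the letter \<open>a\<close> is identified with
  the word \<open>[a]\<close>.\<close>

definition stacking_graph :: "('a, 'b) monoid_scheme \<Rightarrow> 'a set \<Rightarrow> 'a edge set set \<Rightarrow>
    ('a edge \<Rightarrow> 'a edge list) \<Rightarrow> 'a list list set" where
  "stacking_graph G X T \<Phi> =
     {[nf G X T g, [a], stacking_map G X T \<Phi> (nf G X T g) a] | g a. g \<in> carrier G \<and> a \<in> X}"


section \<open>Synchronously regular sets and autostackable groups\<close>

text \<open>Acceptance by a deterministic finite automaton; up to renaming, the states are
  natural numbers.\<close>

definition regular_language :: "'c set \<Rightarrow> 'c list set \<Rightarrow> bool" where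
  "regular_language \<Sigma> L \<longleftrightarrow>
     (\<exists>(Q::nat set) \<delta> q0 F. finite Q \<and> q0 \<in> Q \<and> F \<subseteq> Q \<and> (\<forall>q\<in>Q. \<forall>c\<in>\<Sigma>. \<delta> q c \<in> Q) \<and>
        L = {w \<in> lists \<Sigma>. foldl \<delta> q0 w \<in> F})"

text \<open>The padding letter is \<open>None\<close>.\<close>

definition pad :: "'c list list \<Rightarrow> 'c option list list" where
  "pad ws = map (\<lambda>i. map (\<lambda>w. if i < length w then Some (w ! i) else None) ws)
     [0..<Max (length ` set ws)]"

definition pad_alphabet :: "nat \<Rightarrow> 'c set \<Rightarrow> 'c option list set" where
  "pad_alphabet n X = {c. length c = n \<and> set c \<subseteq> insert None (Some ` X)}"

definition synchronously_regular :: "nat \<Rightarrow> 'c set \<Rightarrow> 'c list list set \<Rightarrow> bool" where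
  "synchronously_regular n X L \<longleftrightarrow>
     L \<subseteq> {ws. length ws = n \<and> set ws \<subseteq> lists X} \<and> regular_language (pad_alphabet n X) (pad ` L)"

definition autostackable_over :: "('a, 'b) monoid_scheme \<Rightarrow> 'a set \<Rightarrow> bool" where
  "autostackable_over G X \<longleftrightarrow> (\<exists>T \<Phi>. maximal_tree G X T \<and> bounded_flow_function G X T \<Phi> \<and>
     synchronously_regular 3 X (stacking_graph G X T \<Phi>))"

definition autostackable :: "('a, 'b) monoid_scheme \<Rightarrow> bool" where
  "autostackable G \<longleftrightarrow> group G \<and> (\<exists>X. fin_gen_set G X \<and> autostackable_over G X)"


section \<open>Finite presentations\<close>

text \<open>The letter \<open>(s, True)\<close> stands for the generator \<open>s\<close> and \<open>(s, False)\<close> for its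
  formal inverse.\<close>

type_synonym 's word = "('s \<times> bool) list"

definition inv_letter :: "'s \<times> bool \<Rightarrow> 's \<times> bool" where
  "inv_letter x = (fst x, \<not> snd x)"

definition inv_word :: "'s word \<Rightarrow> 's word" where
  "inv_word w = rev (map inv_letter w)"

definition words :: "'s set \<Rightarrow> 's word set" where
  "words S = lists (S \<times> UNIV)"

text \<open>Equality of words in the group presented by generators \<open>S\<close> and relators \<open>R\<close>.\<close>

inductive pres_eq :: "'s set \<Rightarrow> 's word set \<Rightarrow> 's word \<Rightarrow> 's word \<Rightarrow> bool"
  for S R where
  refl: "w \<in> words S \<Longrightarrow> pres_eq S R w w"
| sym: "pres_eq S R v w \<Longrightarrow> pres_eq S R w v"
| trans: "pres_eq S R u v \<Longrightarrow> pres_eq S R v w \<Longrightarrow> pres_eq S R u w"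
| cancel: "u \<in> words S \<Longrightarrow> v \<in> words S \<Longrightarrow> x \<in> S \<times> UNIV \<Longrightarrow>
    pres_eq S R (u @ [x, inv_letter x] @ v) (u @ v)"
| relator: "u \<in> words S \<Longrightarrow> v \<in> words S \<Longrightarrow> r \<in> R \<Longrightarrow> pres_eq S R (u @ r @ v) (u @ v)"

definition eval_letter :: "('a, 'b) monoid_scheme \<Rightarrow> ('s \<Rightarrow> 'a) \<Rightarrow> 's \<times> bool \<Rightarrow> 'a" where
  "eval_letter G \<pi> x = (if snd x then \<pi> (fst x) else inv\<^bsub>G\<^esub> (\<pi> (fst x)))"

definition eval_word :: "('a, 'b) monoid_scheme \<Rightarrow> ('s \<Rightarrow> 'a) \<Rightarrow> 's word \<Rightarrow> 'a" where
  "eval_word G \<pi> w = foldr (\<lambda>x g. eval_letter G \<pi> x \<otimes>\<^bsub>G\<^esub> g) w \<one>\<^bsub>G\<^esub>"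

definition finite_presentation_of :: "('a, 'b) monoid_scheme \<Rightarrow> 's set \<Rightarrow> 's word set \<Rightarrow> bool" where
  "finite_presentation_of G S R \<longleftrightarrow> finite S \<and> finite R \<and> R \<subseteq> words S \<and>
     (\<exists>\<pi>. \<pi> ` S \<subseteq> carrier G \<and> generate G (\<pi> ` S) = carrier G \<and>
        (\<forall>w\<in>words S. eval_word G \<pi> w = \<one>\<^bsub>G\<^esub> \<longleftrightarrow> pres_eq S R w []))"


section \<open>Van Kampen diagrams and Dehn functions\<close>

text \<open>A van Kampen diagram is a finite, connected, simply connected planar 2-complex with
  labelled edges. Together with the outer region it is a cell decomposition of the sphere,
  encoded here as a combinatorial map. The darts are the directed edges of the 1-skeleton,
  \<open>opp\<close> reverses a dart, and \<open>nxt d\<close> is the dart following \<open>d\<close> on the boundary of the region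
  to the left of \<open>d\<close>. Thus regions are the orbits of \<open>nxt\<close>, undirected edges are the orbits
  of \<open>opp\<close>, and vertices are the orbits of \<open>nxt \<circ> opp\<close>, which rotates the darts around their
  common initial vertex. A connected map is spherical iff its Euler characteristic is 2.\<close>

record ('d, 's) diagram =
  darts :: "'d set"
  opp :: "'d \<Rightarrow> 'd"
  nxt :: "'d \<Rightarrow> 'd"
  lab :: "'d \<Rightarrow> 's \<times> bool"

definition vertices_of :: "('d, 's) diagram \<Rightarrow> 'd set set" where
  "vertices_of M = orbit (nxt M \<circ> opp M) ` darts M"

definition edges_of :: "('d, 's) diagram \<Rightarrow> 'd set set" where
  "edges_of M = orbit (opp M) ` darts M"

definition regions_of :: "('d, 's) diagram \<Rightarrow> 'd set set" where
  "regions_of M = orbit (nxt M) ` darts M"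

definition spherical_map :: "('d, 's) diagram \<Rightarrow> bool" where
  "spherical_map M \<longleftrightarrow> finite (darts M) \<and> darts M \<noteq> {} \<and>
     opp M permutes darts M \<and> nxt M permutes darts M \<and>
     (\<forall>d\<in>darts M. opp M d \<noteq> d \<and> opp M (opp M d) = d) \<and>
     (\<forall>d\<in>darts M. \<forall>e\<in>darts M.
        (d, e) \<in> ({(x, opp M x) | x. x \<in> darts M} \<union> {(x, nxt M x) | x. x \<in> darts M})\<^sup>*) \<and>
     card (vertices_of M) + card (regions_of M) = card (edges_of M) + 2"

text \<open>The label of the boundary of the region left of \<open>d\<close>, read once around starting with \<open>d\<close>.\<close>

definition boundary_label :: "('d, 's) diagram \<Rightarrow> 'd \<Rightarrow> 's word" where
  "boundary_label M d = map (\<lambda>i. lab M ((nxt M ^^ i) d)) [0..<card (orbit (nxt M) d)]"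

text \<open>The dart \<open>d0\<close> marks the outer region and the base point. Reading the outer boundary
  in the opposite direction amounts to replacing the diagram by its mirror image, which has the
  same 2-cells up to orientation, so the choice of direction is immaterial.\<close>

definition van_kampen_diagram ::
    "'s set \<Rightarrow> 's word set \<Rightarrow> ('d, 's) diagram \<Rightarrow> 'd \<Rightarrow> 's word \<Rightarrow> bool" where
  "van_kampen_diagram S R M d0 w \<longleftrightarrow> spherical_map M \<and> d0 \<in> darts M \<and>
     (\<forall>d\<in>darts M. lab M d \<in> S \<times> UNIV \<and> lab M (opp M d) = inv_letter (lab M d)) \<and>
     boundary_label M d0 = w \<and>
     (\<forall>f\<in>regions_of M - {orbit (nxt M) d0}. \<exists>d\<in>f.
        boundary_label M d \<in> R \<or> inv_word (boundary_label M d) \<in> R)"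

definition two_cells :: "('d, 's) diagram \<Rightarrow> 'd \<Rightarrow> nat" where
  "two_cells M d0 = card (regions_of M - {orbit (nxt M) d0})"

text \<open>The numbers of 2-cells of the diagrams with boundary label \<open>w\<close>. Up to renaming, darts are
  natural numbers. The first set accounts for the diagram consisting of a single vertex, which
  has no darts.\<close>

definition diagram_areas :: "'s set \<Rightarrow> 's word set \<Rightarrow> 's word \<Rightarrow> nat set" where
  "diagram_areas S R w = {k. w = [] \<and> k = 0} \<union>
     {two_cells M d0 | (M :: (nat, 's) diagram) d0. van_kampen_diagram S R M d0 w}"

text \<open>For a word representing the identity the infimum is a minimum: by van Kampen's lemma there
  is at least one diagram.\<close>

definition area :: "'s set \<Rightarrow> 's word set \<Rightarrow> 's word \<Rightarrow> enat" where
  "area S R w = (INF k\<in>diagram_areas S R w. enat k)"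

text \<open>For finite \<open>S\<close> the supremum is over a finite set, hence a maximum.\<close>

definition dehn_function :: "'s set \<Rightarrow> 's word set \<Rightarrow> nat \<Rightarrow> enat" where
  "dehn_function S R n = (SUP w\<in>{w \<in> words S. length w \<le> n \<and> pres_eq S R w []}. area S R w)"

definition iterated_exp :: "nat \<Rightarrow> nat \<Rightarrow> nat" where
  "iterated_exp k n = ((\<lambda>m. 2 ^ m) ^^ k) n"

definition elementary_bounded :: "(nat \<Rightarrow> enat) \<Rightarrow> bool" where
  "elementary_bounded f \<longleftrightarrow> (\<exists>k. \<forall>n. f n \<le> enat (iterated_exp k n))"

text \<open>Since elementary boundedness does not depend on the finite presentation, the condition is
  imposed on all of them. Up to renaming, generating symbols are natural numbers.\<close>

definition nonelementary_dehn_function :: "('a, 'b) monoid_scheme \<Rightarrow> bool" where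
  "nonelementary_dehn_function G \<longleftrightarrow>
     (\<exists>(S :: nat set) R. finite_presentation_of G S R) \<and>
     (\<forall>(S :: nat set) R. finite_presentation_of G S R \<longrightarrow> \<not> elementary_bounded (dehn_function S R))"

end

theory Submission
  imports Defs "HOL-Library.Countable"
begin

text \<open>The witness is the Baumslag--Gersten group \<open>\<langle>a, s, t | s a s\<^sup>-\<^sup>1 = a\<^sup>2, t s t\<^sup>-\<^sup>1 = a\<rangle>\<close>, an HNN
  extension with stable letter \<open>t\<close> of the affine group \<open>\<langle>a, s\<rangle>\<close>.

  In the HNN normal form, a coset of \<open>\<langle>s\<rangle>\<close> is a dyadic rational, written in signed binary notation as a word
  in \<open>a\<^sup>\<plusminus>\<^sup>1\<close> and \<open>s\<^sup>\<plusminus>\<^sup>1\<close>, where \<open>s\<^sup>-\<^sup>1\<close> doubles; a coset of \<open>\<langle>a\<rangle>\<close> is treated in the same way. These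
  words form a prefix-closed regular set, hence a maximal tree. Every edge outside the tree can be replaced by
  the other side of one defining relator, which one depending only on the state of the automaton, and the
  recursion terminates: it lowers the number of occurrences of \<open>t\<close>, then the number of trailing \<open>s\<close>, then the length.

  For the Dehn function, consider a cochain on the edges of the Cayley graph whose value on each relator is at
  most 1 in absolute value. Summed over the darts of a van Kampen diagram it gives 0, so up to a constant its
  value on the boundary word bounds the area from below. Replacing the generators by words changes such a
  cochain by a bounded amount per letter, so this applies to every finite presentation. One cochain of this
  kind is exponential in the tower function \<open>2^2^\<dots>^2\<close> of height \<open>n\<close> on words \<open>[u, a]\<close> of length \<open>O(2^n)\<close>, where
  \<open>u\<close> represents a power of \<open>a\<close> with tower exponent.\<close>


section \<open>Regular languages and stacking automata\<close>

text \<open>The group is built as a set of normal forms on which the letters act from the right, not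
  as a quotient of words. That the two relators present it then comes out of the flow: recursion
  along it rewrites every word to its normal form. Summing over a diagram requires its darts to be
  mapped to the Cayley graph. A diagram is given only by permutations and an Euler characteristic,
  so simple connectedness is not directly at hand; the map is obtained by deleting edges until a
  tree remains and restoring them. The cochain has weight 2^(k-2) on the \<open>a\<close>-edges at
  a^n s^k. An edge at level k+1 lies opposite two edges at level k, so on most relators the weights
  cancel. If the weight were the same for all n, it would be invariant under left multiplication by
  a, and the contributions of u and of its inverse to [u, a] would cancel. Restricting it to even n
  breaks this symmetry, and the restriction is harmless because at level k an \<open>a\<close>-edge
  changes n by 2^k, which is even.\<close>

definition deriv :: "'c \<Rightarrow> 'c list set \<Rightarrow> 'c list set" where
  "deriv c L = {z. c # z \<in> L}"

text \<open>A Myhill-Nerode condition. Asking for some closed family instead of the exact set of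
  iterated derivatives lets closure proofs exhibit a convenient superset. The letter ranges over the
  whole type, so no alphabet has to be carried along.\<close>

definition fin_deriv :: "'c list set \<Rightarrow> bool" where
  "fin_deriv L \<longleftrightarrow> (\<exists>\<F>. finite \<F> \<and> L \<in> \<F> \<and> (\<forall>M\<in>\<F>. \<forall>c. deriv c M \<in> \<F>))"

text \<open>The languages of the family, numbered injectively by \<open>f\<close>, are the states; a
  state accepts if it contains the empty word.\<close>

lemma fin_deriv_regular:
  assumes "fin_deriv L" "L \<subseteq> lists \<Sigma>" shows "regular_language \<Sigma> L"
proof -
  obtain \<F> where F: "finite \<F>" "L \<in> \<F>" "\<And>M c. M \<in> \<F> \<Longrightarrow> deriv c M \<in> \<F>"
    using assms(1) unfolding fin_deriv_def by blast
  obtain f :: "'a list set \<Rightarrow> nat" where inj: "inj_on f \<F>" using finite_imp_inj_to_nat_seg[OF F(1)] by blast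
  define g where "g = inv_into \<F> f"
  have g: "g (f M) = M" if "M \<in> \<F>" for M using that inj by (simp add: g_def)
  define \<delta> where "\<delta> q c = f (deriv c (g q))" for q c
  have fold: "foldl \<delta> (f M) w \<in> f ` {M \<in> \<F>. [] \<in> M} \<longleftrightarrow> w \<in> M" if "M \<in> \<F>" for M w
    using that
  proof (induction w arbitrary: M)
    case Nil
    then show ?case using inj by (auto dest: inj_onD)
  next
    case (Cons c w)
    then show ?case using g F(3) by (simp add: \<delta>_def) (simp add: deriv_def)
  qed
  show ?thesis unfolding regular_language_def
  proof (rule exI[of _ "f ` \<F>"], rule exI[of _ \<delta>], rule exI[of _ "f L"], rule exI[of _ "f ` {M \<in> \<F>. [] \<in> M}"], intro conjI)
    show "L = {w \<in> lists \<Sigma>. foldl \<delta> (f L) w \<in> f ` {M \<in> \<F>. [] \<in> M}}" using fold F(2) assms(2) by blast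
  qed (use F g in \<open>auto simp: \<delta>_def\<close>)
qed

lemma fin_deriv_Un: assumes "fin_deriv L" "fin_deriv L'" shows "fin_deriv (L \<union> L')"
proof -
  obtain \<F> \<F>' where F: "finite \<F>" "L \<in> \<F>" "\<And>M c. M \<in> \<F> \<Longrightarrow> deriv c M \<in> \<F>"
    "finite \<F>'" "L' \<in> \<F>'" "\<And>M c. M \<in> \<F>' \<Longrightarrow> deriv c M \<in> \<F>'"
    using assms unfolding fin_deriv_def by blast
  let ?F = "(\<lambda>(M, M'). M \<union> M') ` (\<F> \<times> \<F>')"
  have "deriv c N \<in> ?F" if "N \<in> ?F" for c N
  proof -
    obtain M M' where M: "N = M \<union> M'" "M \<in> \<F>" "M' \<in> \<F>'" using \<open>N \<in> ?F\<close> by auto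
    have "deriv c N = deriv c M \<union> deriv c M'" by (auto simp: deriv_def M)
    then show ?thesis using F(3,6) M by (intro image_eqI[of _ _ "(deriv c M, deriv c M')"]) auto
  qed
  moreover have "L \<union> L' \<in> ?F" using F by (intro image_eqI[of _ _ "(L, L')"]) auto
  moreover have "finite ?F" by (intro finite_imageI finite_cartesian_product F)
  ultimately show ?thesis unfolding fin_deriv_def by (intro exI[of _ ?F] conjI ballI allI)
qed

lemma fin_deriv_empty [simp]: "fin_deriv {}"
  unfolding fin_deriv_def by (intro exI[of _ "{{}}"]) (auto simp: deriv_def)

lemma fin_deriv_UN: "finite I \<Longrightarrow> (\<And>i. i \<in> I \<Longrightarrow> fin_deriv (L i)) \<Longrightarrow> fin_deriv (\<Union>i\<in>I. L i)"
  by (induction I rule: finite_induct) (auto intro: fin_deriv_Un)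

definition hd_opt :: "'c list \<Rightarrow> 'c option" where
  "hd_opt w = (if w = [] then None else Some (hd w))"

lemma pad_Cons:
  assumes "u \<noteq> [] \<or> v \<noteq> [] \<or> w \<noteq> []"
  shows "pad [u, v, w] = [hd_opt u, hd_opt v, hd_opt w] # pad [tl u, tl v, tl w]"
proof -
  define N where "N = max (length u) (max (length v) (length w)) - 1"
  have 1: "Max (length ` set [u, v, w]) = Suc N" using assms unfolding N_def by (cases u; cases v; cases w) (simp_all add: max_def)
  have 2: "Max (length ` set [tl u, tl v, tl w]) = N" unfolding N_def by (simp add: max_def)
  have 3: "[0..<Suc N] = 0 # map Suc [0..<N]" by (simp only: upt_conv_Cons map_Suc_upt zero_less_Suc)
  have 4: "(if i < length w then Some (w ! i) else None) = (if w = [] then None else Some (hd w))" if "i = 0" for i and w :: "'a list"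
    using that by (simp add: hd_conv_nth)
  have 5: "(if Suc i < length w then Some (w ! Suc i) else None) = (if i < length (tl w) then Some (tl w ! i) else None)" for i and w :: "'a list"
    by (cases w) auto
  show ?thesis unfolding pad_def 1 2 3 list.map map_map comp_def 5 hd_opt_def
    unfolding 4[OF HOL.refl] ..
qed

lemma pad_Nil [simp]: "pad [[], [], []] = []"
  by (simp add: pad_def)

definition pad_lang :: "'c list set \<Rightarrow> 'c list \<Rightarrow> 'c list \<Rightarrow> 'c option list list set" where
  "pad_lang M v w = (\<lambda>u. pad [u, v, w]) ` M"

text \<open>Only the first track varies. Reading a column shortens the two fixed words by one
  letter, and padding in the first track leaves only the empty word there, so the derivative has the
  same shape again. The side condition on \<open>v\<close> and \<open>w\<close> excludes the column
  of three padding letters, which \<open>pad\<close> never produces.\<close>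

lemma deriv_pad_lang:
  "deriv c (pad_lang M v w) =
    (if \<exists>a. c = [Some a, hd_opt v, hd_opt w] then pad_lang (deriv (the (hd c)) M) (tl v) (tl w)
     else if c = [None, hd_opt v, hd_opt w] \<and> (v \<noteq> [] \<or> w \<noteq> []) then pad_lang (M \<inter> {[]}) (tl v) (tl w) else {})"
proof -
  have 1: "z \<in> deriv c (pad_lang M v w) \<longleftrightarrow>
      (\<exists>a u. c = [Some a, hd_opt v, hd_opt w] \<and> a # u \<in> M \<and> z = pad [u, tl v, tl w]) \<or>
      (c = [None, hd_opt v, hd_opt w] \<and> (v \<noteq> [] \<or> w \<noteq> []) \<and> [] \<in> M \<and> z = pad [[], tl v, tl w])" for z
  proof -
    have "z \<in> deriv c (pad_lang M v w) \<longleftrightarrow> (\<exists>u\<in>M. c # z = pad [u, v, w])"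
      by (auto simp: deriv_def pad_lang_def)
    also have "\<dots> \<longleftrightarrow> (\<exists>a u. a # u \<in> M \<and> c # z = pad [a # u, v, w]) \<or> ([] \<in> M \<and> c # z = pad [[], v, w])"
      (is "?A \<longleftrightarrow> ?B")
    proof
      assume ?A then obtain u where u: "u \<in> M" "c # z = pad [u, v, w]" by auto
      then show ?B by (cases u) auto
    qed auto
    also have "\<dots> \<longleftrightarrow> (\<exists>a u. c = [Some a, hd_opt v, hd_opt w] \<and> a # u \<in> M \<and> z = pad [u, tl v, tl w]) \<or>
      (c = [None, hd_opt v, hd_opt w] \<and> (v \<noteq> [] \<or> w \<noteq> []) \<and> [] \<in> M \<and> z = pad [[], tl v, tl w])"
      by (cases "v = [] \<and> w = []") (auto simp: pad_Cons hd_opt_def)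
    finally show ?thesis .
  qed
  show ?thesis
  proof (rule Set.set_eqI)
    fix z
    show "z \<in> deriv c (pad_lang M v w) \<longleftrightarrow> z \<in> (if \<exists>a. c = [Some a, hd_opt v, hd_opt w] then pad_lang (deriv (the (hd c)) M) (tl v) (tl w)
     else if c = [None, hd_opt v, hd_opt w] \<and> (v \<noteq> [] \<or> w \<noteq> []) then pad_lang (M \<inter> {[]}) (tl v) (tl w) else {})"
      unfolding 1 by (auto simp: pad_lang_def deriv_def)
  qed
qed

text \<open>The closed family combines the derivatives of \<open>M\<close> with the suffixes of
  \<open>v\<close> and \<open>w\<close>. The languages \<open>{}\<close> and \<open>{[]}\<close>
  join because padding in the first track intersects with \<open>{[]}\<close>.\<close>

lemma fin_deriv_pad_lang: assumes "fin_deriv M" shows "fin_deriv (pad_lang M v w)"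
proof -
  obtain \<F> where F: "finite \<F>" "M \<in> \<F>" "\<And>N c. N \<in> \<F> \<Longrightarrow> deriv c N \<in> \<F>"
    using assms unfolding fin_deriv_def by blast
  define \<G> where "\<G> = \<F> \<union> {{}, {[]}}"
  define D where "D l = range (\<lambda>i. drop i l)" for l :: "'a list"
  define H where "H = (\<lambda>(N, v', w'). pad_lang N v' w') ` (\<G> \<times> D v \<times> D w)"
  have d: "deriv c {} = {}" "deriv c {[]} = {}" for c :: 'a by (auto simp: deriv_def)
  have G: "finite \<G>" "M \<in> \<G>" "{} \<in> \<G>" "\<And>N. N \<inter> {[]} \<in> \<G>"
    using F by (auto simp: \<G>_def)
  have G': "deriv c N \<in> \<G>" if "N \<in> \<G>" for N c
    using that F(3)[of N c] unfolding \<G>_def by (elim UnE insertE) (simp_all add: d)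
  have fin: "finite (D l)" for l
  proof -
    have "drop i l = drop (min i (length l)) l" for i by (simp add: min_def)
    then have "D l \<subseteq> (\<lambda>i. drop i l) ` {..length l}"
      unfolding D_def by (metis (no_types, lifting) atMost_iff image_eqI image_subsetI min.cobounded2)
    then show ?thesis by (rule finite_subset) simp
  qed
  have D: "l \<in> D l" "l' \<in> D l \<Longrightarrow> tl l' \<in> D l" for l l'
  proof -
    have "drop 0 l \<in> D l" unfolding D_def by (rule rangeI)
    then show "l \<in> D l" by simp
    assume "l' \<in> D l"
    then obtain i where "l' = drop i l" by (auto simp: D_def)
    then have "tl l' = drop (Suc i) l" by (simp add: drop_Suc tl_drop)
    then show "tl l' \<in> D l" unfolding D_def by simp
  qed
  have mem: "pad_lang N v' w' \<in> H" if "N \<in> \<G>" "v' \<in> D v" "w' \<in> D w" for N v' w'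
    unfolding H_def by (rule image_eqI[of _ _ "(N, v', w')"]) (use that in simp_all)
  have "{} = pad_lang {} v w" by (simp add: pad_lang_def)
  then have e: "{} \<in> H" using mem[OF G(3) D(1) D(1)] by simp
  have "deriv c L \<in> H" if LH: "L \<in> H" for L c
  proof -
    obtain N v' w' where L: "L = pad_lang N v' w'" "N \<in> \<G>" "v' \<in> D v" "w' \<in> D w"
      using LH unfolding H_def by (elim imageE) (auto simp only: mem_Sigma_iff split: prod.splits)
    note 1 = mem[OF G'[OF L(2)] D(2)[OF L(3)] D(2)[OF L(4)]] and 2 = mem[OF G(4) D(2)[OF L(3)] D(2)[OF L(4)]]
    show ?thesis unfolding L(1) deriv_pad_lang using 1 2 e by presburger
  qed
  moreover have "finite H" unfolding H_def by (intro finite_imageI finite_cartesian_product G(1) fin)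
  moreover have "pad_lang M v w \<in> H" using mem[OF G(2) D(1) D(1)] .
  ultimately show ?thesis unfolding fin_deriv_def by (intro exI[of _ H] conjI ballI allI)
qed

lemma pad_in_lists:
  assumes "set ws \<subseteq> lists X" "length ws = n" shows "pad ws \<in> lists (pad_alphabet n X)"
  using assms unfolding pad_def pad_alphabet_def by (fastforce simp: in_lists_conv_set)


section \<open>Maximal trees and bounded flow functions from a finite automaton\<close>

fun walk :: "('a, 'b) monoid_scheme \<Rightarrow> 'a \<Rightarrow> 'a list \<Rightarrow> 'a edge list" where
  "walk G g [] = []"
| "walk G g (x # w) = (g, x) # walk G (g \<otimes>\<^bsub>G\<^esub> x) w"

lemma path_label_walk [simp]: "path_label (walk G g w) = w"
  by (induction w arbitrary: g) (auto simp: path_label_def label_def)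

lemma length_walk [simp]: "length (walk G g w) = length w"
  by (induction w arbitrary: g) auto

lemma is_path_walk:
  assumes "group G" "X \<subseteq> carrier G" "g \<in> carrier G" "w \<in> lists X"
  shows "is_path G X g (walk G g w) (foldl (\<otimes>\<^bsub>G\<^esub>) g w)"
  using assms(3,4)
proof (induction w arbitrary: g)
  case (Cons x w)
  interpret group G by (rule assms(1))
  show ?case using Cons assms(2) by (auto simp: edges_def init_vertex_def term_vertex_def label_def)
qed auto

lemma is_path_eq_walk: "is_path G X g p h \<Longrightarrow> p = walk G g (path_label p)"
  by (induction p arbitrary: g)
    (auto simp: init_vertex_def term_vertex_def label_def path_label_def)

lemma is_path_append:
  "is_path G X g (p @ q) h \<longleftrightarrow> (\<exists>k. is_path G X g p k \<and> is_path G X k q h)" if "group G" "X \<subseteq> carrier G"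
proof (induction p arbitrary: g)
  case Nil
  have "is_path G X g q h \<Longrightarrow> g \<in> carrier G" using that
    by (cases q) (auto simp: edges_def init_vertex_def)
  then show ?case by auto
qed auto

text \<open>Isolates what autostackability needs: \<open>st g\<close> is the state reached by the
  normal form of \<open>g\<close>, \<open>push\<close> and \<open>dl\<close> form the partial
  automaton of normal forms, and the flow is read off a table \<open>tab\<close> of states and
  letters. Finiteness of the state type yields both boundedness and regularity; \<open>r\<close>
  yields termination.\<close>

locale stacking = group G for G (structure) +
  fixes X :: "'a set" and nf_word :: "'a \<Rightarrow> 'a list" and st :: "'a \<Rightarrow> 'q :: finite"
    and push :: "'q \<Rightarrow> 'a \<Rightarrow> bool" and dl :: "'q \<Rightarrow> 'a \<Rightarrow> 'q" and tab :: "'q \<Rightarrow> 'a \<Rightarrow> 'a list"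
    and r :: "'a edge rel"
  assumes gen_set: "fin_gen_set G X"
    and nf_word_one: "nf_word \<one> = []"
    and nf_word_push: "g \<in> carrier G \<Longrightarrow> x \<in> X \<Longrightarrow> push (st g) x \<Longrightarrow> nf_word (g \<otimes> x) = nf_word g @ [x]"
    and st_push: "g \<in> carrier G \<Longrightarrow> x \<in> X \<Longrightarrow> push (st g) x \<Longrightarrow> st (g \<otimes> x) = dl (st g) x"
    and parent: "g \<in> carrier G \<Longrightarrow> g \<noteq> \<one> \<Longrightarrow> \<exists>h\<in>carrier G. \<exists>x\<in>X. push (st h) x \<and> g = h \<otimes> x"
    and tab_X: "g \<in> carrier G \<Longrightarrow> x \<in> X \<Longrightarrow> tab (st g) x \<in> lists X"
    and tab_end: "g \<in> carrier G \<Longrightarrow> x \<in> X \<Longrightarrow> foldl (\<otimes>) g (tab (st g) x) = g \<otimes> x"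
    and tab_tree: "g \<in> carrier G \<Longrightarrow> x \<in> X \<Longrightarrow> push (st g) x \<or> push (st (g \<otimes> x)) (inv x) \<Longrightarrow> tab (st g) x = [x]"
    and wf_r: "wf r"
    and tab_r: "g \<in> carrier G \<Longrightarrow> x \<in> X \<Longrightarrow> \<not> (push (st g) x \<or> push (st (g \<otimes> x)) (inv x)) \<Longrightarrow>
       (h, y) \<in> set (walk G g (tab (st g) x)) \<Longrightarrow> \<not> (push (st h) y \<or> push (st (h \<otimes> y)) (inv y)) \<Longrightarrow>
       ((h, y), (g, x)) \<in> r"
begin

lemma X_carrier: "X \<subseteq> carrier G" and finite_X: "finite X" and X_inv: "x \<in> X \<Longrightarrow> inv x \<in> X"
  using gen_set by (auto simp: fin_gen_set_def)

lemma X_closed [simp]: "x \<in> X \<Longrightarrow> x \<in> carrier G"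
  using X_carrier by auto

definition is_tree :: "'a edge \<Rightarrow> bool" where
  "is_tree e \<longleftrightarrow> push (st (fst e)) (snd e) \<or> push (st (fst e \<otimes> snd e)) (inv (snd e))"

definition T :: "'a edge set set" where
  "T = undirected G ` {(g, x). g \<in> carrier G \<and> x \<in> X \<and> push (st g) x}"

definition \<Phi> :: "'a edge \<Rightarrow> 'a edge list" where
  "\<Phi> e = walk G (fst e) (tab (st (fst e)) (snd e))"

lemma edges_iff [simp]: "(g, x) \<in> edges G X \<longleftrightarrow> g \<in> carrier G \<and> x \<in> X"
  by (simp add: edges_def)

lemma rev_edge_pair [simp]: "rev_edge G (g, x) = (g \<otimes> x, inv x)"
  by (simp add: rev_edge_def term_vertex_def init_vertex_def label_def)

lemma cancel_right [simp]: "g \<in> carrier G \<Longrightarrow> x \<in> X \<Longrightarrow> g \<otimes> x \<otimes> inv x = g"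
  by (simp add: m_assoc)

lemma rev_rev [simp]: "e \<in> edges G X \<Longrightarrow> rev_edge G (rev_edge G e) = e"
  by (cases e) auto

lemma undirected_in_T: assumes "e \<in> edges G X" shows "undirected G e \<in> T \<longleftrightarrow> is_tree e"
proof
  assume "undirected G e \<in> T"
  then obtain z where z: "z \<in> {(g, x). g \<in> carrier G \<and> x \<in> X \<and> push (st g) x}" "undirected G e = undirected G z"
    unfolding T_def by (rule imageE)
  obtain g x where "z = (g, x)" by (cases z)
  then have gx: "g \<in> carrier G" "x \<in> X" "push (st g) x" "undirected G e = undirected G (g, x)"
    using z by simp_all
  have "e \<in> undirected G e" by (simp add: undirected_def)
  then have "e \<in> {(g, x), (g \<otimes> x, inv x)}" unfolding gx(4) by (simp add: undirected_def)
  then show "is_tree e" using gx(1-3) unfolding is_tree_def by (elim insertE) auto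
next
  assume t: "is_tree e"
  obtain g x where e: "e = (g, x)" "g \<in> carrier G" "x \<in> X" using assms by (cases e) auto
  have u: "undirected G e = undirected G (rev_edge G e)"
    unfolding undirected_def rev_rev[OF assms] by (rule insert_commute)
  from t show "undirected G e \<in> T" unfolding is_tree_def e(1) fst_conv snd_conv
  proof
    assume "push (st g) x"
    then show "undirected G (g, x) \<in> T" using e(2,3) unfolding T_def by (intro imageI) simp
  next
    assume "push (st (g \<otimes> x)) (inv x)"
    then have "undirected G (g \<otimes> x, inv x) \<in> T" using e(2,3) X_inv unfolding T_def by (intro imageI) simp
    then show "undirected G (g, x) \<in> T" using u unfolding e(1) rev_edge_pair by simp
  qed
qed

lemma tree_cases:
  assumes "(g, x) \<in> edges G X" "is_tree (g, x)"
  shows "nf_word (g \<otimes> x) = nf_word g @ [x] \<or> nf_word g = nf_word (g \<otimes> x) @ [inv x]"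
  using assms nf_word_push[of g x] nf_word_push[of "g \<otimes> x" "inv x"] X_inv by (auto simp: is_tree_def)

definition tree_path :: "'a \<Rightarrow> 'a edge list \<Rightarrow> 'a \<Rightarrow> bool" where
  "tree_path g p h \<longleftrightarrow> is_path G X g p h \<and> (\<forall>e\<in>set p. is_tree e)"

lemma is_path_edges: "is_path G X g p h \<Longrightarrow> set p \<subseteq> edges G X"
  by (induction p arbitrary: g) auto

lemma reduced_path_iff: "reduced_path_in G X T g p h \<longleftrightarrow> tree_path g p h \<and> no_backtrack G p"
proof (cases "is_path G X g p h")
  case True
  have "undirected G e \<in> T \<longleftrightarrow> is_tree e" if "e \<in> set p" for e
    using is_path_edges[OF True] that by (intro undirected_in_T) (rule subsetD)
  then have "undirected G ` set p \<subseteq> T \<longleftrightarrow> (\<forall>e\<in>set p. is_tree e)" by (simp add: image_subset_iff)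
  then show ?thesis unfolding reduced_path_in_def tree_path_def using True by (simp add: conj_commute)
next
  case False
  then show ?thesis unfolding reduced_path_in_def tree_path_def by simp
qed

lemma tree_path_append: "tree_path g (p @ q) h \<longleftrightarrow> (\<exists>k. tree_path g p k \<and> tree_path k q h)"
  unfolding tree_path_def is_path_append[OF is_group X_carrier] set_append ball_Un by (rule iffI) (elim exE conjE, intro exI conjI; assumption)+

lemma tree_path_Cons:
  "tree_path g (e # p) h \<longleftrightarrow> (\<exists>x. e = (g, x) \<and> g \<in> carrier G \<and> x \<in> X \<and> is_tree (g, x) \<and> tree_path (g \<otimes> x) p h)"
  by (cases e) (auto simp: tree_path_def init_vertex_def term_vertex_def label_def)

lemma no_backtrack_Cons:
  "no_backtrack G (e # p) \<longleftrightarrow> no_backtrack G p \<and> (p \<noteq> [] \<longrightarrow> hd p \<noteq> rev_edge G e)"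
proof
  assume *: "no_backtrack G (e # p)"
  have "no_backtrack G p" unfolding no_backtrack_def
  proof (intro allI impI)
    fix i assume "Suc i < length p"
    then show "p ! Suc i \<noteq> rev_edge G (p ! i)" using * unfolding no_backtrack_def by (auto dest: spec[of _ "Suc i"])
  qed
  moreover have "hd p \<noteq> rev_edge G e" if "p \<noteq> []"
    using * that unfolding no_backtrack_def by (auto simp: hd_conv_nth dest: spec[of _ 0])
  ultimately show "no_backtrack G p \<and> (p \<noteq> [] \<longrightarrow> hd p \<noteq> rev_edge G e)" by simp
next
  assume *: "no_backtrack G p \<and> (p \<noteq> [] \<longrightarrow> hd p \<noteq> rev_edge G e)"
  show "no_backtrack G (e # p)" unfolding no_backtrack_def
  proof (intro allI impI)
    fix i assume "Suc i < length (e # p)"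
    then show "(e # p) ! Suc i \<noteq> rev_edge G ((e # p) ! i)"
      using * unfolding no_backtrack_def by (cases i) (auto simp: hd_conv_nth)
  qed
qed

text \<open>A tree edge appends or deletes the last letter of the normal form. Without backtracking
  no deletion can follow an append, so the path deletes \<open>v\<close> and then appends
  \<open>v'\<close>, where \<open>u\<close> is the longest common prefix of the two normal forms.
  Hence the ends determine the label.\<close>

lemma reduced_shape:
  assumes "tree_path g p h" "no_backtrack G p"
  shows "\<exists>u v v'. nf_word g = u @ v \<and> nf_word h = u @ v' \<and> path_label p = map (\<lambda>x. inv x) (rev v) @ v' \<and>
    (v = [] \<or> v' = [] \<or> hd v \<noteq> hd v') \<and> set v \<subseteq> X"
  using assms
proof (induction p arbitrary: g)
  case Nil
  then show ?case by (intro exI[of _ "nf_word g"] exI[of _ "[]"]) (auto simp: tree_path_def path_label_def)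
next
  case (Cons e p)
  obtain x where e: "e = (g, x)" "g \<in> carrier G" "x \<in> X" "is_tree (g, x)" and p: "tree_path (g \<otimes> x) p h"
    using Cons.prems by (auto simp: tree_path_Cons)
  have nb: "no_backtrack G p" "p \<noteq> [] \<Longrightarrow> hd p \<noteq> (g \<otimes> x, inv x)" using Cons.prems e by (auto simp: no_backtrack_Cons)
  have hd: "hd (path_label p) \<noteq> inv x" if "p \<noteq> []"
    using nb(2) that p by (cases p) (auto simp: tree_path_Cons path_label_def label_def)
  obtain u v v' where IH: "nf_word (g \<otimes> x) = u @ v" "nf_word h = u @ v'" "path_label p = map (\<lambda>x. inv x) (rev v) @ v'"
      "v = [] \<or> v' = [] \<or> hd v \<noteq> hd v'" "set v \<subseteq> X"
    using Cons.IH[OF p nb(1)] by blast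
  have lab: "path_label (e # p) = x # path_label p" by (simp add: path_label_def label_def e)
  have ne: "p \<noteq> [] \<longleftrightarrow> path_label p \<noteq> []" by (simp add: path_label_def)
  have "nf_word (g \<otimes> x) = nf_word g @ [x] \<or> nf_word g = nf_word (g \<otimes> x) @ [inv x]" using tree_cases[of g x] e by simp
  then show ?case
  proof (elim disjE, goal_cases)
    case 1
    then have uv: "u @ v = nf_word g @ [x]" using IH by simp
    \<comment> \<open>Deleting anything after this first edge would start by deleting the
      \<open>x\<close> just appended, that is, by backtracking.\<close>
    have "v = []"
    proof (rule ccontr)
      assume "v \<noteq> []"
      then obtain v0 where v: "v = v0 @ [x]" using uv by (cases v rule: rev_cases) auto
      then have "path_label p \<noteq> []" "hd (path_label p) = inv x" using IH(3) by simp_all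
      then show False using hd ne by simp
    qed
    then show ?case using IH uv lab by (intro exI[of _ "nf_word g"] exI[of _ "[]"] exI[of _ "x # v'"]) auto
  next
    case 2
    have "v @ [inv x] = [] \<or> v' = [] \<or> hd (v @ [inv x]) \<noteq> hd v'"
    proof (cases "v = []")
      case True then show ?thesis using IH(3) hd ne by auto
    qed (use IH(4) in auto)
    then show ?case using IH 2 lab e X_inv
      by (intro exI[of _ u] exI[of _ "v @ [inv x]"] exI[of _ v']) auto
  qed
qed

text \<open>The disjunctions say that \<open>u\<close> and \<open>u2\<close> are both the longest
  common prefix of the same two words.\<close>

lemma prefix_split_unique:
  assumes "u @ v = u2 @ v2" "u @ v' = u2 @ v2'"
    "v = [] \<or> v' = [] \<or> hd v \<noteq> hd v'" "v2 = [] \<or> v2' = [] \<or> hd v2 \<noteq> hd v2'"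
  shows "u = u2"
proof -
  from assms(1) obtain w where "u = u2 @ w \<and> w @ v = v2 \<or> u @ w = u2 \<and> v = w @ v2"
    by (auto simp: append_eq_append_conv2)
  then show ?thesis
  proof
    assume *: "u = u2 @ w \<and> w @ v = v2"
    then have "w @ v' = v2'" using assms(2) by simp
    then show ?thesis using * assms(4) by (cases w) auto
  next
    assume *: "u @ w = u2 \<and> v = w @ v2"
    then have "v' = w @ v2'" using assms(2) by auto
    then show ?thesis using * assms(3) by (cases w) auto
  qed
qed

lemma reduced_unique:
  assumes "reduced_path_in G X T g p h" "reduced_path_in G X T g q h" shows "p = q"
proof -
  obtain u v v' where 1: "nf_word g = u @ v" "nf_word h = u @ v'" "path_label p = map (\<lambda>x. inv x) (rev v) @ v'"
      "v = [] \<or> v' = [] \<or> hd v \<noteq> hd v'"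
    using reduced_shape assms(1) unfolding reduced_path_iff by metis
  obtain u2 v2 v2' where 2: "nf_word g = u2 @ v2" "nf_word h = u2 @ v2'" "path_label q = map (\<lambda>x. inv x) (rev v2) @ v2'"
      "v2 = [] \<or> v2' = [] \<or> hd v2 \<noteq> hd v2'"
    using reduced_shape assms(2) unfolding reduced_path_iff by metis
  have "u = u2" using prefix_split_unique 1 2 by metis
  then have "path_label p = path_label q" using 1 2 by auto
  then show ?thesis using assms is_path_eq_walk unfolding reduced_path_in_def by metis
qed

lemma tree_path_rev: "tree_path g p h \<Longrightarrow> \<exists>q. tree_path h q g"
proof (induction p arbitrary: g)
  case Nil
  then show ?case by (intro exI[of _ "[]"]) (auto simp: tree_path_def)
next
  case (Cons e p)
  then obtain x where e: "g \<in> carrier G" "x \<in> X" "is_tree (g, x)" "tree_path (g \<otimes> x) p h"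
    by (auto simp: tree_path_Cons)
  from Cons.IH[OF e(4)] obtain q where q: "tree_path h q (g \<otimes> x)" by blast
  have "is_tree (g \<otimes> x, inv x)" using e(1-3) unfolding is_tree_def by auto
  then have "tree_path (g \<otimes> x) [(g \<otimes> x, inv x)] g"
    using e X_inv by (auto simp: tree_path_Cons) (simp add: tree_path_def)
  then show ?case using q tree_path_append by blast
qed

lemma tree_path_nf_word: "g \<in> carrier G \<Longrightarrow> tree_path \<one> (walk G \<one> (nf_word g)) g \<and> foldl (\<otimes>) \<one> (nf_word g) = g \<and> nf_word g \<in> lists X"
proof (induction "length (nf_word g)" arbitrary: g rule: less_induct)
  case less
  show ?case
  proof (cases "g = \<one>")
    case True then show ?thesis by (simp add: nf_word_one tree_path_def)
  next
    case False
    then obtain h x where h: "h \<in> carrier G" "x \<in> X" "push (st h) x" "g = h \<otimes> x" using parent less by blast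
    then have n: "nf_word g = nf_word h @ [x]" using nf_word_push by simp
    then have IH: "tree_path \<one> (walk G \<one> (nf_word h)) h" "foldl (\<otimes>) \<one> (nf_word h) = h" "nf_word h \<in> lists X" using less h by auto
    have w: "walk G k (u @ [x]) = walk G k u @ [(foldl (\<otimes>) k u, x)]" for k u by (induction u arbitrary: k) auto
    have "tree_path h [(h, x)] g" using h by (auto simp: tree_path_Cons is_tree_def) (simp add: tree_path_def)
    then show ?thesis using IH h unfolding n w tree_path_append by auto
  qed
qed

lemma reduced_exists: assumes "g \<in> carrier G" "h \<in> carrier G" shows "\<exists>p. reduced_path_in G X T g p h"
proof -
  have "\<exists>p. tree_path g p h"
    using tree_path_rev tree_path_nf_word[OF assms(1)] tree_path_nf_word[OF assms(2)] tree_path_append by blast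
  \<comment> \<open>A shortest tree path has no backtracking, since cutting out an edge and its
    reverse would shorten it.\<close>
  then obtain p where p: "tree_path g p h" "\<And>q. tree_path g q h \<Longrightarrow> length p \<le> length q"
    using ex_has_least_nat[of "\<lambda>p. tree_path g p h" _ length] by blast
  have "no_backtrack G p" unfolding no_backtrack_def
  proof (intro allI impI notI)
    fix i assume i: "Suc i < length p" "p ! Suc i = rev_edge G (p ! i)"
    obtain a p1 p2 where pp: "p = p1 @ [a, rev_edge G a] @ p2"
    proof
      show "p = take i p @ [p ! i, rev_edge G (p ! i)] @ drop (Suc (Suc i)) p"
        using i by (metis Cons_nth_drop_Suc Suc_lessD append_Cons append_Nil append_take_drop_id)
    qed
    obtain k l where k: "tree_path g p1 k" "tree_path k [a, rev_edge G a] l" "tree_path l p2 h"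
      using p(1) unfolding pp tree_path_append by blast
    have "l = k" using k(2) by (auto simp: tree_path_Cons) (auto simp: tree_path_def)
    then have "tree_path g (p1 @ p2) h" using k tree_path_append by blast
    then show False using p(2) pp by fastforce
  qed
  then show ?thesis using p(1) unfolding reduced_path_iff by blast
qed

lemma ex1_reduced: assumes "g \<in> carrier G" "h \<in> carrier G" shows "\<exists>!p. reduced_path_in G X T g p h"
proof -
  obtain p where p: "reduced_path_in G X T g p h" using reduced_exists[OF assms] by (rule exE)
  show ?thesis using p by (rule ex1I) (rule reduced_unique[OF _ p])
qed

lemma T_edges: "T \<subseteq> undirected G ` edges G X"
  unfolding T_def by (rule image_mono) (simp add: subset_iff)

lemma maximal_tree: "maximal_tree G X T"
  unfolding maximal_tree_def using T_edges ex1_reduced by (intro conjI ballI)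

lemma nf_eq: assumes "g \<in> carrier G" shows "nf G X T g = nf_word g"
proof -
  obtain p where p: "reduced_path_in G X T \<one> p g" using reduced_exists assms by blast
  then have "(THE p. reduced_path_in G X T \<one> p g) = p" by (rule the_equality) (rule reduced_unique[OF _ p])
  moreover have "path_label p = nf_word g"
    using reduced_shape[of \<one> p g] p nf_word_one unfolding reduced_path_iff by auto
  ultimately show ?thesis by (simp add: nf_def)
qed

lemma flow_function: "flow_function G X T \<Phi>"
proof -
  have "flow_rel G X T \<Phi> \<subseteq> r"
  proof
    fix z assume z: "z \<in> flow_rel G X T \<Phi>"
    obtain h y g x where zz: "z = ((h, y), (g, x))" by (cases z) (metis prod.exhaust)
    have e: "(g, x) \<in> edges G X" "(h, y) \<in> set (walk G g (tab (st g) x))" "undirected G (g, x) \<notin> T" "undirected G (h, y) \<notin> T"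
      using z unfolding zz flow_rel_def \<Phi>_def by simp_all
    have gx: "g \<in> carrier G" "x \<in> X" using e(1) by simp_all
    have hy: "(h, y) \<in> edges G X"
      using is_path_edges[OF is_path_walk[OF is_group X_carrier gx(1) tab_X[OF gx]]] e(2) by (rule subsetD)
    have "\<not> is_tree (h, y)" "\<not> is_tree (g, x)"
      using e(3,4) undirected_in_T[OF hy] undirected_in_T[OF e(1)] by simp_all
    then show "z \<in> r" unfolding zz is_tree_def fst_conv snd_conv using tab_r[OF gx _ e(2)] by simp
  qed
  then have wf: "wf ((flow_rel G X T \<Phi>)\<^sup>+)" by (intro wf_trancl wf_subset[OF wf_r])
  then have "irrefl ((flow_rel G X T \<Phi>)\<^sup>+)" by (intro irreflI wf_not_refl)
  moreover have "is_path G X (init_vertex e) (\<Phi> e) (term_vertex G e)" if eE: "e \<in> edges G X" for e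
  proof -
    obtain g x where e: "e = (g, x)" "g \<in> carrier G" "x \<in> X" using eE by (cases e) simp
    show ?thesis using is_path_walk[OF is_group X_carrier e(2) tab_X[OF e(2,3)]] tab_end[OF e(2,3)]
      by (simp add: e(1) \<Phi>_def init_vertex_def term_vertex_def label_def)
  qed
  moreover have "\<Phi> e = [e]" if eE: "e \<in> edges G X" "undirected G e \<in> T" for e
  proof -
    obtain g x where e: "e = (g, x)" "g \<in> carrier G" "x \<in> X" using eE(1) by (cases e) simp
    have "tab (st g) x = [x]" using eE(2) undirected_in_T[OF eE(1)] tab_tree[OF e(2,3)] by (simp add: e(1) is_tree_def)
    then show ?thesis by (simp add: e(1) \<Phi>_def)
  qed
  ultimately show ?thesis unfolding flow_function_def using wf trans_trancl by (intro conjI ballI impI)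
qed

definition tab_vals :: "'a list set" where
  "tab_vals = (\<lambda>(q, x). tab q x) ` (UNIV \<times> X)"

lemma finite_tab_vals: "finite tab_vals"
  unfolding tab_vals_def by (intro finite_imageI finite_cartesian_product finite_X) simp

lemma bounded_flow_function: "bounded_flow_function G X T \<Phi>"
proof -
  have "length (\<Phi> e) \<le> Max (length ` tab_vals)" if "e \<in> edges G X" for e
  proof -
    obtain g x where e: "e = (g, x)" "x \<in> X" using \<open>e \<in> edges G X\<close> by (cases e) simp
    then have "tab (st g) x \<in> tab_vals" unfolding tab_vals_def by (intro image_eqI[of _ _ "(st g, x)"]) simp_all
    then have "length (\<Phi> e) \<in> length ` tab_vals" by (simp add: e(1) \<Phi>_def)
    then show ?thesis using finite_tab_vals by (intro Max_ge finite_imageI)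
  qed
  then show ?thesis unfolding bounded_flow_function_def using flow_function by blast
qed

fun acc :: "('q \<Rightarrow> bool) \<Rightarrow> 'q \<Rightarrow> 'a list \<Rightarrow> bool" where
  "acc Q q [] \<longleftrightarrow> Q q"
| "acc Q q (a # w) \<longleftrightarrow> a \<in> X \<and> push q a \<and> acc Q (dl q a) w"

text \<open>Words are read from the left, but \<open>parent\<close> removes the last letter; here
  the last letter moves into the acceptance condition.\<close>

lemma acc_snoc: "acc Q q (w @ [x]) \<longleftrightarrow> acc (\<lambda>q. x \<in> X \<and> push q x \<and> Q (dl q x)) q w"
  by (induction w arbitrary: q) auto

lemma acc_complete: "g \<in> carrier G \<Longrightarrow> Q (st g) \<Longrightarrow> acc Q (st \<one>) (nf_word g)"
proof (induction "length (nf_word g)" arbitrary: g Q rule: less_induct)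
  case less
  show ?case
  proof (cases "g = \<one>")
    case True then show ?thesis using less by (simp add: nf_word_one)
  next
    case False
    then obtain h x where h: "h \<in> carrier G" "x \<in> X" "push (st h) x" "g = h \<otimes> x" using parent less by blast
    then have "nf_word g = nf_word h @ [x]" using nf_word_push by simp
    then show ?thesis using less h st_push by (simp add: acc_snoc)
  qed
qed

lemma acc_sound: "acc Q (st g) w \<Longrightarrow> g \<in> carrier G \<Longrightarrow> \<exists>h\<in>carrier G. nf_word h = nf_word g @ w \<and> Q (st h)"
proof (induction w arbitrary: g)
  case (Cons a w)
  then have a: "a \<in> X" "push (st g) a" "acc Q (dl (st g) a) w" by simp_all
  then have "\<exists>h\<in>carrier G. nf_word h = nf_word (g \<otimes> a) @ w \<and> Q (st h)"
    using Cons.prems(2) by (intro Cons.IH) (simp_all add: st_push)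
  then show ?case using nf_word_push[OF Cons.prems(2) a(1,2)] by simp
qed auto

lemma fin_deriv_acc: "fin_deriv {w. acc Q q w}"
proof -
  define H where "H = insert {} (range (\<lambda>q. {w. acc Q q w}))"
  have H: "{w. acc Q q w} \<in> H" for q unfolding H_def by (intro insertI2 rangeI)
  have e: "{} \<in> H" unfolding H_def by (rule insertI1)
  have "deriv c M \<in> H" if "M \<in> H" for c M
  proof (cases "M = {}")
    case True
    then show ?thesis using e by (simp add: deriv_def)
  next
    case False
    then have "M \<in> range (\<lambda>q. {w. acc Q q w})" using \<open>M \<in> H\<close> unfolding H_def by (elim insertE) simp_all
    then obtain q where M: "M = {w. acc Q q w}" by (rule rangeE)
    show ?thesis
    proof (cases "c \<in> X \<and> push q c")
      case True
      then have "deriv c M = {w. acc Q (dl q c) w}" unfolding deriv_def M by simp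
      then show ?thesis using H by simp
    next
      case False
      then have "deriv c M = {}" unfolding deriv_def M by auto
      then show ?thesis using e by simp
    qed
  qed
  moreover have "finite H" unfolding H_def by simp
  ultimately show ?thesis unfolding fin_deriv_def using H by (intro exI[of _ H] conjI ballI allI)
qed

lemma stacking_graph_eq:
  "stacking_graph G X T \<Phi> = {[nf_word g, [x], tab (st g) x] | g x. g \<in> carrier G \<and> x \<in> X}"
proof -
  have inj: "inj_on (nf G X T) (carrier G)"
    using nf_eq tree_path_nf_word by (intro inj_on_inverseI[of _ "foldl (\<otimes>) \<one>"]) auto
  have eq: "[nf G X T g, [x], stacking_map G X T \<Phi> (nf G X T g) x] = [nf_word g, [x], tab (st g) x]"
    if "g \<in> carrier G" for g x
    using that nf_eq inv_into_f_f[OF inj that] by (simp add: stacking_map_def \<Phi>_def)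
  have "(ws = [nf G X T g, [x], stacking_map G X T \<Phi> (nf G X T g) x] \<and> g \<in> carrier G \<and> x \<in> X) =
      (ws = [nf_word g, [x], tab (st g) x] \<and> g \<in> carrier G \<and> x \<in> X)" for ws g x
    by (cases "g \<in> carrier G") (simp_all only: eq simp_thms)
  then show ?thesis unfolding stacking_graph_def by (simp only:)
qed

text \<open>For a fixed letter and a fixed table entry only the normal form varies, subject to a
  condition on its final state. There are finitely many such pairs, so regularity on three tracks
  reduces to regularity on one.\<close>

lemma pad_stacking_graph:
  "pad ` stacking_graph G X T \<Phi> = (\<Union>(x, v)\<in>X \<times> tab_vals. pad_lang {w. acc (\<lambda>q. tab q x = v) (st \<one>) w} [x] v)"
    (is "?L = ?R")
proof
  show "?L \<subseteq> ?R"
  proof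
    fix z assume "z \<in> ?L"
    then obtain g x where z: "z = pad [nf_word g, [x], tab (st g) x]" "g \<in> carrier G" "x \<in> X"
      unfolding stacking_graph_eq by blast
    have "tab (st g) x \<in> tab_vals" unfolding tab_vals_def using z by (intro image_eqI[of _ _ "(st g, x)"]) simp_all
    moreover have "acc (\<lambda>q. tab q x = tab (st g) x) (st \<one>) (nf_word g)" using acc_complete[OF z(2)] by simp
    ultimately show "z \<in> ?R"
      using z by (intro UN_I[of "(x, tab (st g) x)"]) (simp_all add: pad_lang_def)
  qed
  show "?R \<subseteq> ?L"
  proof
    fix z assume "z \<in> ?R"
    then obtain x v w where z: "x \<in> X" "acc (\<lambda>q. tab q x = v) (st \<one>) w" "z = pad [w, [x], v]"
      by (auto simp: pad_lang_def)
    then obtain g where "g \<in> carrier G" "nf_word g = w" "tab (st g) x = v" using acc_sound[OF z(2)] nf_word_one by auto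
    then show "z \<in> ?L" unfolding stacking_graph_eq using z by blast
  qed
qed

lemma synchronously_regular: "synchronously_regular 3 X (stacking_graph G X T \<Phi>)"
  unfolding synchronously_regular_def
proof
  show 1: "stacking_graph G X T \<Phi> \<subseteq> {ws. length ws = 3 \<and> set ws \<subseteq> lists X}"
  proof
    fix ws assume "ws \<in> stacking_graph G X T \<Phi>"
    then obtain g x where gx: "ws = [nf_word g, [x], tab (st g) x]" "g \<in> carrier G" "x \<in> X"
      unfolding stacking_graph_eq by blast
    have "nf_word g \<in> lists X" "[x] \<in> lists X" "tab (st g) x \<in> lists X" using tree_path_nf_word[OF gx(2)] tab_X gx by simp_all
    then show "ws \<in> {ws. length ws = 3 \<and> set ws \<subseteq> lists X}" unfolding gx(1) by simp
  qed
  show "regular_language (pad_alphabet 3 X) (pad ` stacking_graph G X T \<Phi>)"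
  proof (rule fin_deriv_regular)
    show "fin_deriv (pad ` stacking_graph G X T \<Phi>)" unfolding pad_stacking_graph
    proof (intro fin_deriv_UN finite_cartesian_product finite_X finite_tab_vals)
      fix i :: "'a \<times> 'a list"
      show "fin_deriv (case i of (x, v) \<Rightarrow> pad_lang {w. acc (\<lambda>q. tab q x = v) (st \<one>) w} [x] v)"
        by (cases i) (simp add: fin_deriv_pad_lang fin_deriv_acc)
    qed
    show "pad ` stacking_graph G X T \<Phi> \<subseteq> lists (pad_alphabet 3 X)" using 1 pad_in_lists by blast
  qed
qed

theorem autostackable: "autostackable G"
  unfolding autostackable_def autostackable_over_def
  by (intro conjI exI[of _ X] exI[of _ T] exI[of _ \<Phi>] is_group gen_set maximal_tree bounded_flow_function synchronously_regular)

end

section \<open>Spherical maps and potentials\<close>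

lemma self_in_orbit: "f permutes D \<Longrightarrow> finite D \<Longrightarrow> x \<in> orbit f x"
  using permutation_permutes permutation_self_in_orbit by metis

lemma orbit_eq: "f permutes D \<Longrightarrow> finite D \<Longrightarrow> y \<in> orbit f x \<Longrightarrow> orbit f y = orbit f x"
  by (meson orbit_cyclic_eq3 cyclic_on_orbit)

lemma orbit_apply: "f permutes D \<Longrightarrow> finite D \<Longrightarrow> orbit f (f x) = orbit f x"
  using orbit_eq[of f D "f x" x] orbit.base by metis

lemma orbit_invariant:
  assumes "y \<in> orbit g x" "g permutes D" "x \<in> D" "\<And>x. x \<in> D \<Longrightarrow> h (g x) = h x"
  shows "h y = h x"
  using assms(1)
proof (induction rule: orbit.induct)
  case base then show ?case using assms by simp
next
  case (step y)
  have "y \<in> D" using step(1) permutes_orbit_subset[OF assms(2,3)] by blast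
  then show ?case using step assms(4) by simp
qed

text \<open>An invariant of \<open>g\<close> takes at most one value per orbit.\<close>

lemma card_invariant_le:
  assumes "g permutes D" "finite D" "\<And>x. x \<in> D \<Longrightarrow> h (g x) = h x"
  shows "card (h ` D) \<le> card (orbit g ` D)"
proof -
  have "h ` D \<subseteq> (\<lambda>O'. h (SOME y. y \<in> O')) ` (orbit g ` D)"
  proof
    fix z assume "z \<in> h ` D"
    then obtain x where x: "z = h x" "x \<in> D" by (rule imageE)
    have "(SOME y. y \<in> orbit g x) \<in> orbit g x" using self_in_orbit[OF assms(1,2)] by (rule someI)
    then have "h (SOME y. y \<in> orbit g x) = z" using orbit_invariant[OF _ assms(1) x(2), of _ h] assms(3) x(1) by simp
    then show "z \<in> (\<lambda>O'. h (SOME y. y \<in> O')) ` (orbit g ` D)" using x(2) by (intro image_eqI[of _ _ "orbit g x"]) simp_all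
  qed
  then have "card (h ` D) \<le> card ((\<lambda>O'. h (SOME y. y \<in> O')) ` (orbit g ` D))"
    using assms(2) by (intro card_mono finite_imageI)
  also have "\<dots> \<le> card (orbit g ` D)" using assms(2) by (intro card_image_le finite_imageI)
  finally show ?thesis .
qed

text \<open>\<open>q\<close> is \<open>p\<close> preceded by the transposition of \<open>d\<close>
  and \<open>d'\<close>. Gluing or cutting one edge changes the permutation whose orbits are the
  regions in just this way.\<close>

locale swap =
  fixes D :: "'d set" and p q :: "'d \<Rightarrow> 'd" and d d' :: 'd
  assumes fin: "finite D" and p: "p permutes D" and q: "q permutes D" and d: "d \<in> D" "d' \<in> D"
    and swap: "q d = p d'" "q d' = p d" "\<And>x. x \<in> D \<Longrightarrow> x \<noteq> d \<Longrightarrow> x \<noteq> d' \<Longrightarrow> q x = p x"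
begin

text \<open>After the orbits of \<open>d\<close> and \<open>d'\<close> are identified, the
  \<open>p\<close>-orbit becomes an invariant of \<open>q\<close>; the identification costs at most
  one value.\<close>

lemma card_orbits_le: "card (orbit p ` D) \<le> card (orbit q ` D) + 1"
proof -
  define h where "h x = (if orbit p x = orbit p d' then orbit p d else orbit p x)" for x
  have "h (q x) = h x" if "x \<in> D" for x
    using swap that orbit_apply[OF p fin] unfolding h_def by (cases "x = d"; cases "x = d'") simp_all
  then have 1: "card (h ` D) \<le> card (orbit q ` D)" by (rule card_invariant_le[OF q fin])
  have "orbit p ` D \<subseteq> insert (orbit p d') (h ` D)"
  proof
    fix z assume "z \<in> orbit p ` D"
    then obtain x where x: "z = orbit p x" "x \<in> D" by (rule imageE)
    show "z \<in> insert (orbit p d') (h ` D)"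
    proof (cases "z = orbit p d'")
      case False
      then have "h x = z" using x by (simp add: h_def)
      then show ?thesis using x(2) by (intro insertI2) (rule image_eqI, simp_all)
    qed simp
  qed
  then have "card (orbit p ` D) \<le> card (insert (orbit p d') (h ` D))" using fin by (intro card_mono) simp_all
  also have "\<dots> \<le> card (h ` D) + 1" using fin by (simp add: card_insert_if)
  finally show ?thesis using 1 by simp
qed

text \<open>Within a single \<open>p\<close>-orbit the exchange cannot merge anything: the
  \<open>p\<close>-orbit itself is invariant under \<open>q\<close>.\<close>

lemma card_orbits_same: assumes "d' \<in> orbit p d" shows "card (orbit p ` D) \<le> card (orbit q ` D)"
proof (rule card_invariant_le[OF q fin])
  fix x assume x: "x \<in> D"
  have "orbit p d' = orbit p d" using orbit_eq[OF p fin assms] .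
  then show "orbit p (q x) = orbit p x"
    using swap x orbit_apply[OF p fin] by (cases "x = d"; cases "x = d'") simp_all
qed

text \<open>The first \<open>q\<close>-step from \<open>b\<close> is the first \<open>p\<close>-step
  from \<open>a\<close>; from there \<open>q\<close> follows \<open>p\<close>, never meeting
  \<open>b\<close>, until it returns to \<open>a\<close>.\<close>

lemma merge_aux:
  assumes "b \<notin> orbit p a" "q b = p a" "\<And>x. x \<in> D \<Longrightarrow> x \<noteq> a \<Longrightarrow> x \<noteq> b \<Longrightarrow> q x = p x" "a \<in> D" "b \<in> D"
  shows "a \<in> orbit q b"
proof -
  have "y \<in> orbit q b" if "y \<in> orbit p a" for y
    using that
  proof (induction rule: orbit.induct)
    case base then show ?case using assms(2) orbit.base[of q b] by simp
  next
    case (step y)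
    have yD: "y \<in> D" using step(1) permutes_orbit_subset[OF p assms(4)] by blast
    have "y \<noteq> b" using step(1) assms(1) by blast
    show ?case
    proof (cases "y = a")
      case True then show ?thesis using assms(2) orbit.base[of q b] by simp
    next
      case False
      then have "p y = q y" using assms(3)[OF yD] \<open>y \<noteq> b\<close> by simp
      then show ?thesis using orbit.step[OF step(2)] by simp
    qed
  qed
  then show ?thesis using self_in_orbit[OF p fin] by blast
qed

lemma merge:
  assumes "d' \<notin> orbit p d"
  shows "d' \<in> orbit q d" "x \<in> D \<Longrightarrow> p x \<in> orbit q x" "x \<in> D \<Longrightarrow> orbit p x \<subseteq> orbit q x"
proof -
  have "d \<notin> orbit p d'" using assms orbit_eq[OF p fin] self_in_orbit[OF p fin] by metis
  then show 1: "d' \<in> orbit q d" using merge_aux[of d d'] swap d by blast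
  have e: "orbit q d' = orbit q d" using orbit_eq[OF q fin 1] .
  show 2: "p x \<in> orbit q x" if "x \<in> D" for x
  proof -
    have "p d' \<in> orbit q d" "p d \<in> orbit q d'" using swap orbit.base[of q] by metis+
    then show ?thesis using e swap(3)[OF that] orbit.base[of q x] by (cases "x = d"; cases "x = d'") simp_all
  qed
  show "orbit p x \<subseteq> orbit q x" if x: "x \<in> D"
  proof
    fix y assume y: "y \<in> orbit p x"
    have "orbit q y = orbit q x"
      using orbit_invariant[OF y p x, of "orbit q"] 2 orbit_eq[OF q fin] by blast
    then show "y \<in> orbit q x" using self_in_orbit[OF q fin] by metis
  qed
qed

end

section \<open>Group-valued potentials on maps of Euler characteristic 2\<close>

locale labelled_map = group G for G (structure) +
  fixes D :: "'d set" and op \<rho> :: "'d \<Rightarrow> 'd" and l :: "'d \<Rightarrow> 'a"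
  assumes fin: "finite D" and op: "op permutes D" "\<And>x. x \<in> D \<Longrightarrow> op x \<noteq> x" "\<And>x. x \<in> D \<Longrightarrow> op (op x) = x"
    and \<rho>: "\<rho> permutes D"
    and l: "\<And>x. x \<in> D \<Longrightarrow> l x \<in> carrier G" "\<And>x. x \<in> D \<Longrightarrow> l (op x) = inv (l x)"
begin

lemma op_in: "x \<in> D \<Longrightarrow> op x \<in> D"
  using permutes_in_image[OF op(1)] by simp

text \<open>The map in which only the edges in \<open>A\<close> are glued; the darts outside \<open>A\<close> are dead ends.\<close>

definition nx :: "'d set \<Rightarrow> 'd \<Rightarrow> 'd" where
  "nx A x = (if x \<in> A then \<rho> (op x) else \<rho> x)"

definition lA :: "'d set \<Rightarrow> 'd \<Rightarrow> 'a" where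
  "lA A x = (if x \<in> A then l x else \<one>)"

definition edge_set :: "'d set \<Rightarrow> bool" where
  "edge_set A \<longleftrightarrow> A \<subseteq> D \<and> op ` A \<subseteq> A"

lemma edge_setD: "edge_set A \<Longrightarrow> x \<in> A \<Longrightarrow> x \<in> D" "edge_set A \<Longrightarrow> x \<in> A \<Longrightarrow> op x \<in> A"
  by (auto simp: edge_set_def)

lemma nx_permutes: assumes "edge_set A" shows "nx A permutes D"
proof -
  define \<sigma> where "\<sigma> x = (if x \<in> A then op x else x)" for x
  have "\<sigma> (\<sigma> x) = x" for x
    unfolding \<sigma>_def using edge_setD[OF assms, of x] op(3) by simp
  moreover have "\<sigma> x = x" if "x \<notin> D" for x using that edge_setD[OF assms] unfolding \<sigma>_def by auto
  ultimately have "\<sigma> permutes D" unfolding permutes_def by metis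
  then have "\<rho> \<circ> \<sigma> permutes D" using \<rho> by (rule permutes_compose)
  moreover have "\<rho> \<circ> \<sigma> = nx A" by (rule ext) (simp add: nx_def \<sigma>_def)
  ultimately show ?thesis by simp
qed

text \<open>With no edge glued, every vertex is a region of its own. Thus \<open>orbs {}\<close>
  below is the number of vertices, while \<open>orbs A\<close> is the number of regions.\<close>

lemma nx_empty: "nx {} = \<rho>"
  by (rule ext) (simp add: nx_def)

lemma remove_edge:
  assumes "edge_set A" "d \<in> A" defines "A' \<equiv> A - {d, op d}"
  shows "edge_set A'" "card A = card A' + 2" "swap D (nx A') (nx A) d (op d)" "swap D (nx A) (nx A') d (op d)"
proof -
  have dD: "d \<in> D" "op d \<in> D" "op d \<in> A" "op (op d) = d" "op d \<noteq> d" using edge_setD[OF assms(1)] assms(2) op by auto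
  have op': "op x \<in> A'" if x: "x \<in> A'" for x
  proof -
    have xA: "x \<in> A" "x \<noteq> d" "x \<noteq> op d" using x by (simp_all add: A'_def)
    have "op x \<in> A" "op (op x) = x" using edge_setD[OF assms(1) xA(1)] op(3) by simp_all
    moreover have "op x \<noteq> d" using xA(3) \<open>op (op x) = x\<close> by metis
    moreover have "op x \<noteq> op d" using xA(2) \<open>op (op x) = x\<close> dD(4) by metis
    ultimately show ?thesis unfolding A'_def by simp
  qed
  show e: "edge_set A'" unfolding edge_set_def
  proof
    show "A' \<subseteq> D" using edge_setD(1)[OF assms(1)] unfolding A'_def by (intro subsetI) simp
    show "op ` A' \<subseteq> A'" using op' by (rule image_subsetI)
  qed
  have "A \<subseteq> D" using assms(1) by (simp add: edge_set_def)
  then have "finite A" using fin by (rule finite_subset)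
  then have "finite A'" by (simp add: A'_def)
  moreover have "A = insert d (insert (op d) A')" using assms(2) dD(3) unfolding A'_def by blast
  moreover have "d \<notin> insert (op d) A'" "op d \<notin> A'" using dD(5) by (simp_all add: A'_def)
  ultimately show "card A = card A' + 2" by simp
  show "swap D (nx A') (nx A) d (op d)" "swap D (nx A) (nx A') d (op d)"
    using fin nx_permutes[OF e] nx_permutes[OF assms(1)] dD assms(2)
    by (unfold_locales; simp add: nx_def A'_def)+
qed

lemma edge_induct [consumes 1, case_names empty remove]:
  assumes "edge_set A" "P {}" "\<And>A d. edge_set A \<Longrightarrow> d \<in> A \<Longrightarrow> (\<And>d. d \<in> A \<Longrightarrow> P (A - {d, op d})) \<Longrightarrow> P A"
  shows "P A"
  using assms(1)
proof (induction "card A" arbitrary: A rule: less_induct)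
  case less
  show ?case
  proof (cases "A = {}")
    case False
    then obtain d where d: "d \<in> A" by blast
    have "P (A - {d, op d})" if "d \<in> A" for d
      using less.hyps remove_edge(1,2)[OF less.prems that] by simp
    then show ?thesis using assms(3)[OF less.prems d] by blast
  qed (use assms(2) in simp)
qed

abbreviation orbs :: "'d set \<Rightarrow> nat" where
  "orbs A \<equiv> card (orbit (nx A) ` D)"

text \<open>Each edge changes the number of regions by at most one. The factors 2 appear because
  \<open>A\<close> contains both darts of an edge.\<close>

lemma orbs_ge: "edge_set A \<Longrightarrow> 2 * orbs {} \<le> 2 * orbs A + card A"
proof (induction rule: edge_induct)
  case (remove A d)
  interpret s: swap D "nx (A - {d, op d})" "nx A" d "op d" using remove_edge(3)[OF remove(1,2)] .
  show ?case using s.card_orbits_le remove_edge(2)[OF remove(1,2)] remove(3)[OF remove(2)] by simp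
qed simp

text \<open>The orbits of \<open>\<rho>\<close> are the vertices, so this is a label-preserving map
  from the graph with edges \<open>A\<close> to the Cayley graph.\<close>

definition potential :: "'d set \<Rightarrow> ('d \<Rightarrow> 'a) \<Rightarrow> bool" where
  "potential A v \<longleftrightarrow> (\<forall>x\<in>D. v x \<in> carrier G \<and> v (\<rho> x) = v x) \<and> (\<forall>x\<in>A. v (op x) = v x \<otimes> l x)"

lemma potentialD:
  assumes "potential A v"
  shows "x \<in> D \<Longrightarrow> v x \<in> carrier G" "x \<in> D \<Longrightarrow> v (\<rho> x) = v x" "x \<in> A \<Longrightarrow> v (op x) = v x \<otimes> l x"
  using assms by (auto simp: potential_def)

text \<open>Equality in \<open>orbs_ge\<close> characterises a forest, with one region per
  component. There the labels are unconstrained: the potential on one side of an edge can be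
  translated to fit that edge.\<close>

lemma potential_tree:
  "edge_set A \<Longrightarrow> 2 * orbs A + card A = 2 * orbs {} \<Longrightarrow>
    (\<forall>x\<in>A. op x \<in> orbit (nx A) x) \<and> (\<exists>v. potential A v)"
proof (induction rule: edge_induct)
  case empty
  have "potential {} (\<lambda>_. \<one>)" by (simp add: potential_def)
  then show ?case by blast
next
  case (remove A d)
  define A' where "A' = A - {d, op d}"
  note re = remove_edge[OF remove(1,2), folded A'_def]
  interpret s: swap D "nx A'" "nx A" d "op d" using re(3) .
  \<comment> \<open>Equality for \<open>A\<close> and the inequality for \<open>A'\<close> force the
    removal to create a region, so the two darts of the edge lie in different regions of
    \<open>A'\<close>.\<close>
  have o: "orbs A' = orbs A + 1" using s.card_orbits_le orbs_ge[OF re(1)] re(2) remove(4) by simp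
  then have "2 * orbs A' + card A' = 2 * orbs {}" using re(2) remove(4) by simp
  then have IH: "\<forall>x\<in>A'. op x \<in> orbit (nx A') x" "\<exists>v. potential A' v"
    using remove(3)[OF remove(2)] unfolding A'_def by blast+
  have nin: "op d \<notin> orbit (nx A') d" using s.card_orbits_same o by linarith
  obtain v where v: "potential A' v" using IH(2) by blast
  define C where "C = orbit (nx A') (op d)"
  have dD: "d \<in> D" "op d \<in> D" "op (op d) = d" using edge_setD[OF remove(1)] remove(2) op(3) by blast+
  note oe = orbit_eq[OF s.p fin] and si = self_in_orbit[OF s.p fin]
  have C: "x \<in> C \<longleftrightarrow> orbit (nx A') x = C" for x unfolding C_def using oe si by metis
  have Cop: "op x \<in> C \<longleftrightarrow> x \<in> C" if "x \<in> A'" for x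
    using oe[of "op x" x] IH(1) that unfolding C by simp
  have Cnx: "nx A' x \<in> C \<longleftrightarrow> x \<in> C" for x
    unfolding C using orbit_apply[OF s.p fin] by simp
  have C\<rho>: "\<rho> x \<in> C \<longleftrightarrow> x \<in> C" if "x \<in> D" for x
  proof (cases "x \<in> A'")
    case True
    then have "op x \<in> A'" "op (op x) = x" using edge_setD[OF re(1)] op(3) that by blast+
    then have "nx A' (op x) = \<rho> x" by (simp add: nx_def)
    then show ?thesis using Cnx[of "op x"] Cop[OF True] by simp
  next
    case False
    then show ?thesis using Cnx[of x] by (simp add: nx_def)
  qed
  define c where "c = v d \<otimes> l d \<otimes> inv (v (op d))"
  define v' where "v' x = (if x \<in> C then c \<otimes> v x else v x)" for x
  note vD = potentialD[OF v]
  have cc: "c \<in> carrier G" using vD(1) l(1) dD by (simp add: c_def)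
  have dC: "d \<notin> C" "op d \<in> C" using nin si[of "op d"] oe[of d "op d"] si[of d] unfolding C_def by auto
  have "potential A v'" unfolding potential_def
  proof (intro conjI ballI)
    fix x assume x: "x \<in> D"
    show "v' x \<in> carrier G" using vD(1)[OF x] cc by (simp add: v'_def)
    show "v' (\<rho> x) = v' x" using vD(2)[OF x] C\<rho>[OF x] by (simp add: v'_def)
  next
    fix x assume x: "x \<in> A"
    have e: "v' (op d) = v' d \<otimes> l d"
      using dC vD(1) l(1) dD by (simp add: v'_def c_def m_assoc)
    consider "x = d" | "x = op d" | "x \<in> A'" using x unfolding A'_def by blast
    then show "v' (op x) = v' x \<otimes> l x"
    proof cases
      case 2
      have "v' d \<in> carrier G" using dC vD(1) dD by (simp add: v'_def)
      then show ?thesis using e l dD unfolding 2 by (simp add: m_assoc)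
    next
      case 3
      have xD: "x \<in> D" using edge_setD[OF re(1) 3] by simp
      show ?thesis using vD(3)[OF 3] Cop[OF 3] vD(1)[OF xD] l(1)[OF xD] cc by (simp add: v'_def m_assoc)
    qed (use e in simp)
  qed
  moreover have "op x \<in> orbit (nx A) x" if x: "x \<in> A" for x
  proof -
    have oq: "orbit (nx A) (op d) = orbit (nx A) d" using orbit_eq[OF s.q fin s.merge(1)[OF nin]] .
    consider "x = d" | "x = op d" | "x \<in> A'" using x unfolding A'_def by blast
    then show ?thesis
    proof cases
      case 2
      then show ?thesis using oq dD self_in_orbit[OF s.q fin, of d] by simp
    next
      case 3
      then show ?thesis using IH(1) s.merge(3)[OF nin] edge_setD[OF re(1) 3] by blast
    qed (use s.merge(1)[OF nin] in simp)
  qed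
  ultimately show ?case by blast
qed

definition conn :: "'d set \<Rightarrow> bool" where
  "conn A \<longleftrightarrow> (\<forall>S. S \<subseteq> D \<longrightarrow> S \<noteq> {} \<longrightarrow> nx A ` S \<subseteq> S \<longrightarrow> op ` (S \<inter> A) \<subseteq> S \<longrightarrow> S = D)"

text \<open>The inequality says that vertices minus edges plus regions is at least 2;
  \<open>u\<close> witnesses that the labels around each region other than that of \<open>z\<close>
  multiply to 1. Deleting an edge between two distinct regions merges them and keeps the inequality.
  When no such edge is left, connectedness leaves a single region and the map is a tree. The
  potential found for the smaller map fits the deleted edge because at least one side of that edge
  is an inner region.\<close>

lemma exists_potential:
  "edge_set A \<Longrightarrow> D \<noteq> {} \<Longrightarrow> conn A \<Longrightarrow> card A + 4 \<le> 2 * orbs {} + 2 * orbs A \<Longrightarrow> z \<in> D \<Longrightarrow>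
    (\<And>x. x \<in> D \<Longrightarrow> u x \<in> carrier G) \<Longrightarrow>
    (\<And>x. x \<in> D \<Longrightarrow> x \<notin> orbit (nx A) z \<Longrightarrow> u (nx A x) = u x \<otimes> lA A x) \<Longrightarrow>
    \<exists>v. potential A v"
proof (induction arbitrary: u rule: edge_induct)
  case empty
  have "potential {} (\<lambda>_. \<one>)" by (simp add: potential_def)
  then show ?case by blast
next
  case (remove A d0)
  note A = remove(1)
  note perm = nx_permutes[OF A]
  show ?case
  proof (cases "\<exists>d\<in>A. op d \<notin> orbit (nx A) d")
    case False
    have "orbit (nx A) x = D" if x: "x \<in> D" for x
    proof -
      have "orbit (nx A) x \<subseteq> D" using permutes_orbit_subset[OF perm x] .
      moreover have "orbit (nx A) x \<noteq> {}" using self_in_orbit[OF perm fin] by blast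
      moreover have "nx A ` orbit (nx A) x \<subseteq> orbit (nx A) x" using orbit.step by (intro image_subsetI)
      moreover have "op ` (orbit (nx A) x \<inter> A) \<subseteq> orbit (nx A) x"
        using False orbit_eq[OF perm fin] by (intro image_subsetI) blast
      ultimately show ?thesis using remove(5) unfolding conn_def by blast
    qed
    then have "orbit (nx A) ` D = {D}" using remove(4) by auto
    then have "orbs A = 1" by simp
    then have "2 * orbs A + card A = 2 * orbs {}" using remove(6) orbs_ge[OF A] by simp
    then show ?thesis using potential_tree[OF A] by blast
  next
    case True
    then obtain d where d: "d \<in> A" "op d \<notin> orbit (nx A) d" by blast
    define A' where "A' = A - {d, op d}"
    note re = remove_edge[OF A d(1), folded A'_def]
    interpret s: swap D "nx A" "nx A'" d "op d" using re(4) .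
    note m = s.merge[OF d(2)]
    have dD: "d \<in> D" "op d \<in> D" "op (op d) = d" "op d \<in> A" using edge_setD[OF A] d(1) op(3) by blast+
    have closed: "orbit (nx A') x \<subseteq> S" if "nx A' ` S \<subseteq> S" "x \<in> S" for S x
    proof
      fix y assume "y \<in> orbit (nx A') x"
      then show "y \<in> S" using that by (induction rule: orbit.induct) blast+
    qed
    have conn: "conn A'" unfolding conn_def
    proof (intro allI impI)
      fix S assume S: "S \<subseteq> D" "S \<noteq> {}" "nx A' ` S \<subseteq> S" "op ` (S \<inter> A') \<subseteq> S"
      have "nx A ` S \<subseteq> S" using m(2) closed[OF S(3)] S(1) by (intro image_subsetI) blast
      moreover have "op x \<in> S" if x: "x \<in> S" "x \<in> A" for x
      proof -
        consider "x = d" | "x = op d" | "x \<in> A'" using x unfolding A'_def by blast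
        then show ?thesis
        proof cases
          case 1 then show ?thesis using m(1) closed[OF S(3) x(1)] by blast
        next
          case 2
          have "d \<in> orbit (nx A') (op d)" using orbit_eq[OF s.q fin m(1)] self_in_orbit[OF s.q fin, of d] by simp
          then show ?thesis using 2 dD closed[OF S(3) x(1)] by auto
        next
          case 3 then show ?thesis using S(4) x(1) by blast
        qed
      qed
      ultimately show "S = D" using remove(5) S(1,2) unfolding conn_def by blast
    qed
    have count: "card A' + 4 \<le> 2 * orbs {} + 2 * orbs A'" using remove(6) re(2) s.card_orbits_le by simp
    define C where "C = orbit (nx A) (op d)"
    \<comment> \<open>Translating \<open>u\<close> by \<open>c\<close> on the region of
      \<open>op d\<close> makes the two witnesses agree along the deleted edge, so together they
      form one for the merged region.\<close>
    define c where "c = u d \<otimes> l d \<otimes> inv (u (op d))"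
    define u' where "u' x = (if x \<in> C then c \<otimes> u x else u x)" for x
    note uc = remove(8) and ue = remove(9)
    have cc: "c \<in> carrier G" using uc l(1) dD by (simp add: c_def)
    have dC: "d \<notin> C" "op d \<in> C"
      using d(2) self_in_orbit[OF perm fin] orbit_eq[OF perm fin, of d "op d"] unfolding C_def by auto
    have Cnx: "nx A x \<in> C \<longleftrightarrow> x \<in> C" for x
      unfolding C_def using orbit_apply[OF perm fin] orbit_eq[OF perm fin] self_in_orbit[OF perm fin] by metis
    have zz: "orbit (nx A) z \<subseteq> orbit (nx A') z" using m(3)[OF remove(7)] .
    have c1: "c \<otimes> u (op d) = u d \<otimes> l d" using uc l(1) dD by (simp add: c_def m_assoc)
    have u'e: "u' (nx A' x) = u' x \<otimes> lA A' x" if x: "x \<in> D" "x \<notin> orbit (nx A') z" for x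
    proof -
      have qq: "orbit (nx A') (op d) = orbit (nx A') d" using orbit_eq[OF s.q fin m(1)] .
      have out: "y \<notin> orbit (nx A) z" if "orbit (nx A') y = orbit (nx A') x" for y
      proof
        assume "y \<in> orbit (nx A) z"
        then have "orbit (nx A') y = orbit (nx A') z" using zz orbit_eq[OF s.q fin] by blast
        then show False using that x(2) self_in_orbit[OF s.q fin, of x] by simp
      qed
      consider "x = d" | "x = op d" | "x \<noteq> d" "x \<noteq> op d" by blast
      then show ?thesis
      proof cases
        case 1
        have "u (nx A (op d)) = u (op d) \<otimes> lA A (op d)" using ue[OF dD(2)] out[of "op d"] 1 qq by simp
        also have "lA A (op d) = inv (l d)" using dD l(2) by (simp add: lA_def)
        finally have "c \<otimes> u (nx A (op d)) = (c \<otimes> u (op d)) \<otimes> inv (l d)" using cc uc l(1) dD by (simp add: m_assoc)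
        also have "\<dots> = u d" unfolding c1 using uc l(1) dD by (simp add: m_assoc)
        finally show ?thesis using 1 dC s.swap(1) Cnx[of "op d"] uc dD
          by (simp add: u'_def lA_def A'_def)
      next
        case 2
        have "u (nx A d) = u d \<otimes> l d" using ue[OF dD(1)] out[of d] 2 qq d(1) by (simp add: lA_def)
        then show ?thesis using 2 dC s.swap(2) Cnx[of d] c1 uc dD cc l(1)[OF dD(1)]
          by (simp add: u'_def lA_def A'_def)
      next
        case 3
        have "u (nx A x) = u x \<otimes> lA A x" using ue[OF x(1)] out[of x] by simp
        moreover have "lA A' x = lA A x" "nx A' x = nx A x" "lA A x \<in> carrier G"
          using 3 s.swap(3)[OF x(1)] l(1)[OF x(1)] by (simp_all add: lA_def A'_def)
        ultimately show ?thesis using Cnx[of x] uc[OF x(1)] cc by (simp add: u'_def m_assoc)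
      qed
    qed
    have u'c: "u' x \<in> carrier G" if "x \<in> D" for x using uc[OF that] cc by (simp add: u'_def)
    have "\<exists>v. potential A' v"
      using remove(3)[OF d(1), folded A'_def, OF remove(4) conn count remove(7) u'c u'e] by blast
    then obtain v where v: "potential A' v" by blast
    note vD = potentialD[OF v]
    \<comment> \<open>Around the region of \<open>e\<close>, \<open>v\<close> and \<open>u\<close>
      are multiplied by the same factor at every dart other than \<open>e\<close>, so their quotient
      \<open>\<kappa>\<close> is constant from the successor of \<open>e\<close> back to
      \<open>e\<close>. As the region closes up, the factors agree at \<open>e\<close> as
      well.\<close>
    have key: "v (op e) = v e \<otimes> l e" if e: "e = d \<or> e = op d" "e \<notin> orbit (nx A) z" for e
    proof -
      have eD: "e \<in> D" "e \<in> A" "op e \<in> D" "op (op e) = e" using e(1) dD d(1) by auto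
      have ope: "op e \<notin> orbit (nx A) e"
        using e(1) d(2) dD(3) orbit_eq[OF perm fin, of d "op d"] self_in_orbit[OF perm fin] by auto
      define \<kappa> where "\<kappa> x = v x \<otimes> inv (u x)" for x
      have \<kappa>: "\<kappa> (nx A x) = \<kappa> x" if x: "x \<in> orbit (nx A) e" "x \<noteq> e" for x
      proof -
        have xD: "x \<in> D" using x(1) permutes_orbit_subset[OF perm eD(1)] by blast
        have "x \<noteq> op e" using x(1) ope by blast
        then have xA: "x \<in> A' \<longleftrightarrow> x \<in> A" using x(2) e(1) dD(3) unfolding A'_def by auto
        have "x \<notin> orbit (nx A) z" using x(1) e(2) orbit_eq[OF perm fin] self_in_orbit[OF perm fin] by metis
        then have 1: "u (nx A x) = u x \<otimes> lA A x" using ue[OF xD] by simp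
        have 2: "v (nx A x) = v x \<otimes> lA A x"
        proof (cases "x \<in> A")
          case True
          then have "v (nx A x) = v (op x)" using vD(2)[OF op_in[OF xD]] by (simp add: nx_def)
          then show ?thesis using vD(3) True xA by (simp add: lA_def)
        next
          case False
          then show ?thesis using vD(1,2)[OF xD] by (simp add: nx_def lA_def)
        qed
        have "lA A x \<in> carrier G" using l(1)[OF xD] by (simp add: lA_def)
        then show ?thesis unfolding \<kappa>_def 1 2 using vD(1)[OF xD] uc[OF xD]
          by (simp add: inv_mult_group m_assoc) (simp add: m_assoc[symmetric])
      qed
      have all: "\<kappa> y = \<kappa> (nx A e)" if "y \<in> orbit (nx A) e" for y
        using that
      proof (induction rule: orbit.induct)
        case (step y)
        then show ?case using \<kappa>[of y] by (cases "y = e") simp_all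
      qed simp
      have "\<kappa> e = \<kappa> (nx A e)" using all self_in_orbit[OF perm fin] by blast
      moreover have "v (nx A e) = v (op e)" using vD(2)[OF eD(3)] eD(2) by (simp add: nx_def)
      moreover have "u (nx A e) = u e \<otimes> l e" using ue[OF eD(1) e(2)] eD(2) by (simp add: lA_def)
      ultimately have k: "v e \<otimes> inv (u e) = v (op e) \<otimes> inv (u e \<otimes> l e)" by (simp add: \<kappa>_def)
      have cs: "v e \<in> carrier G" "u e \<in> carrier G" "l e \<in> carrier G" "v (op e) \<in> carrier G"
        using vD(1) uc l(1) eD by blast+
      have "v (op e) = v (op e) \<otimes> inv (u e \<otimes> l e) \<otimes> (u e \<otimes> l e)" using cs by (simp add: m_assoc)
      also have "\<dots> = v e \<otimes> inv (u e) \<otimes> (u e \<otimes> l e)" unfolding k ..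
      also have "\<dots> = v e \<otimes> (inv (u e) \<otimes> u e) \<otimes> l e" using cs by (simp only: m_assoc inv_closed m_closed)
      also have "\<dots> = v e \<otimes> l e" using cs by simp
      finally show ?thesis .
    qed
    have flip: "v (op e) = v e \<otimes> l e" if e: "e \<in> D" "v (op (op e)) = v (op e) \<otimes> l (op e)" for e
    proof -
      have cs: "v e \<in> carrier G" "l e \<in> carrier G" "v (op e) \<in> carrier G" using vD(1) l(1) op_in e(1) by blast+
      have "v e = v (op e) \<otimes> inv (l e)" using e op(3) l(2) by simp
      then show ?thesis using cs by (simp add: m_assoc)
    qed
    \<comment> \<open>The two darts lie in different regions, so at most one of them is in the
      region of \<open>z\<close>.\<close>
    have both: "v (op d) = v d \<otimes> l d"
    proof (cases "d \<in> orbit (nx A) z")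
      case True
      then have "op d \<notin> orbit (nx A) z" using d(2) orbit_eq[OF perm fin] by metis
      then show ?thesis using key[of "op d"] flip[OF dD(1)] by simp
    qed (use key in simp)
    have both': "v (op (op d)) = v (op d) \<otimes> l (op d)" using flip[of "op d"] both dD by simp
    have "potential A v" unfolding potential_def
    proof (intro conjI ballI)
      fix x assume "x \<in> A"
      then consider "x = d" | "x = op d" | "x \<in> A'" unfolding A'_def by blast
      then show "v (op x) = v x \<otimes> l x" by cases (use both both' vD(3) in simp_all)
    qed (use vD(1,2) in simp_all)
    then show ?thesis by blast
  qed
qed

end

section \<open>Elements of the Baumslag--Gersten group\<close>

text \<open>Right HNN normal forms. \<open>Up e y\<close> is reached from \<open>e\<close> by \<open>t\<close> followed by \<open>a\<^sup>y\<close>, where \<open>y\<close> is a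
  dyadic rational and \<open>a\<^sup>1\<^sup>/\<^sup>2\<close> stands for \<open>s\<^sup>-\<^sup>1 a s\<close>; \<open>Down e x k\<close> is reached by \<open>t\<^sup>-\<^sup>1\<close> followed by \<open>a\<^sup>x s\<^sup>k\<close> with
  \<open>0 \<le> x < 1\<close>. An element of the affine group itself is a coset below a fictitious line \<open>Bottom n\<close>, so that
  \<open>Down (Bottom n) x k\<close> is \<open>a\<^sup>n\<^sup>+\<^sup>x s\<^sup>k\<close>.\<close>

datatype elt = Bottom int | Up elt rat | Down elt rat int

instance elt :: countable by countable_datatype

fun is_B :: "elt \<Rightarrow> bool" where
  "is_B (Bottom n) = True" | "is_B _ = False"

text \<open>Right multiplication by \<open>a\<^sup>z s\<^sup>j\<close>. What does not fit into the coset representative is carried across \<open>t\<close>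
  by \<open>t s\<^sup>j = a\<^sup>j t\<close> and \<open>t\<^sup>-\<^sup>1 a\<^sup>n = s\<^sup>n t\<^sup>-\<^sup>1\<close>.\<close>

fun bs :: "rat \<Rightarrow> int \<Rightarrow> elt \<Rightarrow> elt" where
  "bs z j (Bottom n) = Bottom (n + j)"
| "bs z j (Up e y) = Up (bs (of_int j) 0 e) ((y + z) / 2 powi j)"
| "bs z j (Down e x k) = Down (bs 0 \<lfloor>x + 2 powi k * z\<rfloor> e) (frac (x + 2 powi k * z)) (k + j)"

lemma floor_add_frac: "\<lfloor>u + v\<rfloor> = \<lfloor>u\<rfloor> + \<lfloor>frac u + v\<rfloor>" for u v :: rat
  by (simp add: frac_def) linarith

lemma frac_add_frac: "frac (frac u + v) = frac (u + v)" for u v :: rat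
  using floor_add_frac[of u v] by (simp add: frac_def)

text \<open>The multiplication of the affine group, a^z s^j a^z' s^j' = a^(z + 2^j z') s^(j+j'). The
  carries compose because the floor of a sum splits after the first summand has been reduced modulo
  1.\<close>

lemma bs_bs: "bs z' j' (bs z j e) = bs (z + 2 powi j * z') (j + j') e"
proof (induction e arbitrary: z j z' j')
  case (Down e x k)
  have *: "x + 2 powi k * (z + 2 powi j * z') = (x + 2 powi k * z) + 2 powi (k + j) * z'"
    by (simp add: algebra_simps power_int_add)
  show ?case
    unfolding bs.simps Down * frac_add_frac floor_add_frac[of "x + 2 powi k * z" "2 powi (k + j) * z'"]
    by simp
qed (simp_all add: power_int_add field_simps)


section \<open>Reduced HNN normal forms\<close>

definition dyadic :: "rat \<Rightarrow> bool" where
  "dyadic y \<longleftrightarrow> (\<exists>j::nat. y * 2 ^ j \<in> \<int>)"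

text \<open>The trivial coset directly after t^-1, where a following t would cancel;
  \<open>pline\<close> is the same after t. Excluding both in \<open>good\<close> is Britton
  reducedness. Over a \<open>Bottom n\<close> no t^-1 has been read, so there nothing
  cancels.\<close>

fun mline :: "elt \<Rightarrow> bool" where
  "mline (Down e x k) \<longleftrightarrow> x = 0 \<and> k = 0 \<and> \<not> is_B e" | "mline _ = False"

fun pline :: "elt \<Rightarrow> bool" where
  "pline (Up e y) \<longleftrightarrow> y = 0" | "pline _ = False"

fun good :: "elt \<Rightarrow> bool" where
  "good (Bottom n) = True"
| "good (Up e y) \<longleftrightarrow> good e \<and> \<not> is_B e \<and> dyadic y \<and> \<not> mline e"
| "good (Down e x k) \<longleftrightarrow> good e \<and> 0 \<le> x \<and> x < 1 \<and> dyadic x \<and> \<not> pline e"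

lemma dyadic_of_int [simp]: "dyadic (of_int n)" "dyadic 0" "dyadic 1" "dyadic (-1)"
  unfolding dyadic_def by (auto intro: exI[of _ 0])

lemma dyadic_add: assumes "dyadic x" "dyadic y" shows "dyadic (x + y)"
proof -
  obtain i j where "x * 2 ^ i \<in> \<int>" "y * 2 ^ j \<in> \<int>" using assms by (auto simp: dyadic_def)
  then have "x * 2 ^ i * 2 ^ j \<in> \<int>" "y * 2 ^ j * 2 ^ i \<in> \<int>" by (meson Ints_mult Ints_numeral Ints_power)+
  then have "(x * 2 ^ i * 2 ^ j) + (y * 2 ^ j * 2 ^ i) \<in> \<int>" by (rule Ints_add)
  then have "(x + y) * 2 ^ (i + j) \<in> \<int>" by (simp add: power_add algebra_simps)
  then show ?thesis unfolding dyadic_def by blast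
qed

lemma dyadic_mult_powi: assumes "dyadic x" shows "dyadic (2 powi k * x)"
proof -
  obtain i where i: "x * 2 ^ i \<in> \<int>" using assms by (auto simp: dyadic_def)
  show ?thesis
  proof (cases k)
    case (nonneg n)
    have "2 ^ n * (x * 2 ^ i) \<in> \<int>" using i by (meson Ints_mult Ints_numeral Ints_power)
    then show ?thesis unfolding dyadic_def nonneg by (intro exI[of _ i]) (simp add: algebra_simps)
  next
    case (neg n)
    have "(2 powi k * x) * 2 ^ (i + Suc n) = x * 2 ^ i"
      unfolding neg power_int_minus power_int_of_nat by (simp add: power_add field_simps)
    then show ?thesis unfolding dyadic_def using i by metis
  qed
qed

lemma dyadic_div_powi: "dyadic x \<Longrightarrow> dyadic (x / 2 powi k)"
  using dyadic_mult_powi[of x "-k"] by (simp add: power_int_minus field_simps)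

lemma dyadic_frac: "dyadic x \<Longrightarrow> dyadic (frac x)"
  using dyadic_add[of x "of_int (- \<lfloor>x\<rfloor>)"] dyadic_of_int(1)[of "- \<lfloor>x\<rfloor>"] by (simp add: frac_def)

lemma is_B_bs [simp]: "is_B (bs z j e) = is_B e" by (cases e) auto

lemma frac_add_of_int [simp]: "frac (x + of_int n) = frac x" for x :: rat by (simp add: frac_def)

lemma unit_Ints: "0 \<le> x \<Longrightarrow> x < 1 \<Longrightarrow> x \<in> \<int> \<longleftrightarrow> x = 0" for x :: rat
  by (auto elim!: Ints_cases)

lemma unit_floor: "0 \<le> x \<Longrightarrow> x < 1 \<Longrightarrow> \<lfloor>x\<rfloor> = 0" for x :: rat
  by (simp add: floor_eq_iff)

lemma mline_bs [simp]: "good e \<Longrightarrow> mline (bs (of_int n) 0 e) = mline e"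
  by (cases e) (auto simp: unit_Ints)

lemma pline_bs [simp]: "pline (bs 0 j e) = pline e"
  by (cases e) auto

lemma good_bs [simp]: "good e \<Longrightarrow> dyadic z \<Longrightarrow> good (bs z j e)"
proof (induction e arbitrary: z j)
  case (Up e y) then show ?case using dyadic_of_int by (auto intro!: dyadic_div_powi dyadic_add)
next
  case (Down e x k) then show ?case by (auto intro!: dyadic_frac dyadic_add dyadic_mult_powi simp: frac_ge_0 frac_lt_1)
qed simp

lemma bs_0_0 [simp]: "good e \<Longrightarrow> bs 0 0 e = e"
  by (induction e) (auto simp: frac_eq unit_floor)

fun depth :: "elt \<Rightarrow> nat" where
  "depth (Bottom n) = 0" | "depth (Up e y) = Suc (depth e)" | "depth (Down e x k) = Suc (depth e)"

lemma depth_bs [simp]: "depth (bs z j e) = depth e"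
  by (induction e arbitrary: z j) auto

fun mult_t :: "elt \<Rightarrow> elt" where
  "mult_t (Down e x k) = (if mline (Down e x k) then e else Up (Down e x k) 0)"
| "mult_t e = Up e 0"

fun mult_t_inv :: "elt \<Rightarrow> elt" where
  "mult_t_inv (Up e y) = (if y = 0 then e else Down (Up e y) 0 0)"
| "mult_t_inv e = Down e 0 0"

definition is_elt :: "elt \<Rightarrow> bool" where "is_elt e \<longleftrightarrow> good e \<and> \<not> is_B e"

lemma mult_t_line: "\<not> is_B e \<Longrightarrow> mult_t (Down e 0 0) = e" and mult_t_P: "\<not> mline e \<Longrightarrow> mult_t e = Up e 0"
  and mult_t_inv_line: "mult_t_inv (Up e 0) = e" and mult_t_inv_M: "\<not> pline e \<Longrightarrow> mult_t_inv e = Down e 0 0"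
  by (cases e; simp)+

lemma mlineE: "mline e \<Longrightarrow> (\<And>e'. e = Down e' 0 0 \<Longrightarrow> \<not> is_B e' \<Longrightarrow> thesis) \<Longrightarrow> thesis"
  by (cases e) auto

lemma plineE: "pline e \<Longrightarrow> (\<And>e'. e = Up e' 0 \<Longrightarrow> thesis) \<Longrightarrow> thesis"
  by (cases e) auto

lemma is_elt_mult_t: "is_elt e \<Longrightarrow> is_elt (mult_t e)"
  by (cases "mline e") (auto elim!: mlineE simp: is_elt_def mult_t_line mult_t_P simp del: mult_t.simps)

lemma is_elt_mult_t_inv: "is_elt e \<Longrightarrow> is_elt (mult_t_inv e)"
  by (cases "pline e") (auto elim!: plineE simp: is_elt_def mult_t_inv_line mult_t_inv_M simp del: mult_t_inv.simps)

lemma mult_t_inv_mult_t: "is_elt e \<Longrightarrow> mult_t_inv (mult_t e) = e"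
  by (cases "mline e") (auto elim!: mlineE simp: is_elt_def mult_t_line mult_t_P mult_t_inv_line mult_t_inv_M simp del: mult_t.simps mult_t_inv.simps)

lemma mult_t_mult_t_inv: "is_elt e \<Longrightarrow> mult_t (mult_t_inv e) = e"
  by (cases "pline e") (auto elim!: plineE simp: is_elt_def mult_t_line mult_t_P mult_t_inv_line mult_t_inv_M simp del: mult_t.simps mult_t_inv.simps)

text \<open>The relation t s^j = a^j t. Multiplying by an integral power of a does not affect
  whether the t cancels, so both sides fall into the same case.\<close>

lemma bs_mult_t: assumes "is_elt e" shows "bs 0 j (mult_t e) = mult_t (bs (of_int j) 0 e)"
proof (cases "mline e")
  case True
  then show ?thesis by (elim mlineE) (simp add: mult_t_line del: mult_t.simps)
next
  case False
  moreover have "\<not> mline (bs (of_int j) 0 e)" using assms False by (simp add: is_elt_def)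
  ultimately show ?thesis by (simp add: mult_t_P)
qed

section \<open>The right action of words on normal forms\<close>

type_synonym letter = "nat \<times> bool"

abbreviation la :: letter where "la \<equiv> (0, True)"
abbreviation lA :: letter where "lA \<equiv> (0, False)"
abbreviation ls :: letter where "ls \<equiv> (2, True)"
abbreviation lS :: letter where "lS \<equiv> (2, False)"
abbreviation lt :: letter where "lt \<equiv> (3, True)"
abbreviation lT :: letter where "lT \<equiv> (3, False)"

text \<open>The generator 1 is skipped because the simplifier rewrites it to \<open>Suc 0\<close>.\<close>

definition gens :: "nat set" where "gens = {0, 2, 3}"

abbreviation letters :: "letter set" where "letters \<equiv> gens \<times> UNIV"

lemma letters_eq: "letters = {la, lA, ls, lS, lt, lT}"
  by (auto simp: gens_def)

lemma letter_cases: "x \<in> letters \<Longrightarrow> x = la \<or> x = lA \<or> x = ls \<or> x = lS \<or> x = lt \<or> x = lT"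
  unfolding letters_eq by auto

fun act :: "letter \<Rightarrow> elt \<Rightarrow> elt" where
  "act (n, b) e = (if n = 0 then bs (if b then 1 else - 1) 0 e
     else if n = 2 then bs 0 (if b then 1 else - 1) e
     else if b then mult_t e else mult_t_inv e)"

lemma act_simps [simp]:
  "act la e = bs 1 0 e" "act lA e = bs (-1) 0 e" "act ls e = bs 0 1 e" "act lS e = bs 0 (-1) e"
  "act lt e = mult_t e" "act lT e = mult_t_inv e"
  by simp_all

declare act.simps [simp del]

lemma inv_letter_simps [simp]: "inv_letter (n, b) = (n, \<not> b)"
  by (simp add: inv_letter_def)

lemma inv_letter_inv_letter [simp]: "inv_letter (inv_letter x) = x"
  by (simp add: inv_letter_def)

lemma inv_letter_in [simp]: "inv_letter x \<in> letters \<longleftrightarrow> x \<in> letters"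
  by (cases x) simp

lemma is_elt_bs: "is_elt e \<Longrightarrow> dyadic z \<Longrightarrow> is_elt (bs z j e)"
  by (simp add: is_elt_def)

lemma is_elt_act [simp]: "x \<in> letters \<Longrightarrow> is_elt e \<Longrightarrow> is_elt (act x e)"
  using letter_cases[of x] by (auto simp: is_elt_bs is_elt_mult_t is_elt_mult_t_inv)

lemma act_inv [simp]: "x \<in> letters \<Longrightarrow> is_elt e \<Longrightarrow> act (inv_letter x) (act x e) = e"
  using letter_cases[of x] by (auto simp: bs_bs mult_t_mult_t_inv mult_t_inv_mult_t) (auto simp: is_elt_def)

lemma act_inv' [simp]: "x \<in> letters \<Longrightarrow> is_elt e \<Longrightarrow> act x (act (inv_letter x) e) = e"
  using act_inv[of "inv_letter x" e] by simp

primrec acts :: "letter list \<Rightarrow> elt \<Rightarrow> elt" where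
  "acts [] e = e" | "acts (x # w) e = acts w (act x e)"

lemma acts_append [simp]: "acts (u @ v) e = acts v (acts u e)"
  by (induction u arbitrary: e) auto

lemma is_elt_acts: "w \<in> words gens \<Longrightarrow> is_elt e \<Longrightarrow> is_elt (acts w e)"
  by (induction w arbitrary: e) (auto simp: words_def)

definition rels :: "letter list set" where
  "rels = {[lt, ls, lT, lA], [ls, la, lS, lA, lA]}"

lemma acts_rel: "r \<in> rels \<Longrightarrow> is_elt e \<Longrightarrow> acts r e = e"
  unfolding rels_def
  using bs_mult_t[of e 1]
  by (auto simp: bs_bs mult_t_inv_mult_t is_elt_bs) (auto simp: is_elt_def)

lemma inv_letter_mem: "x \<in> letters \<Longrightarrow> inv_letter x \<in> letters" by simp

lemma pres_eq_words: "pres_eq gens rels u v \<Longrightarrow> u \<in> words gens \<and> v \<in> words gens"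
proof (induction rule: pres_eq.induct)
  case (relator u v r)
  have "r \<in> words gens" using relator(3) by (auto simp: rels_def words_def gens_def)
  then show ?case using relator by (auto simp: words_def)
next
  case (cancel u v x)
  then show ?case using inv_letter_mem[of x] unfolding words_def by auto
qed auto

lemma pres_eq_acts: "pres_eq gens rels u v \<Longrightarrow> is_elt e \<Longrightarrow> acts u e = acts v e"
proof (induction rule: pres_eq.induct)
  case (relator u v r) then show ?case using acts_rel[of r "acts u e"] is_elt_acts[of u e] by simp
next
  case (cancel u v x) then show ?case using is_elt_acts[of u e] by simp
qed auto

section \<open>The automaton and the flow table\<close>

text \<open>The states record the last letter of the normal form: \<open>P\<close> and \<open>N\<close> distinguish the sign of the binary
  expansion, \<open>I\<close> stands for a power of \<open>a\<close>, and \<open>A\<close>, \<open>S\<close>, \<open>T\<close> are the inverse letters.\<close>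

datatype state = I0 | Ia | IA | Tt | TT | Pa | PS | Ss | NA | NS

fun line_state :: "elt \<Rightarrow> state" where
  "line_state (Bottom n) = (if n = 0 then I0 else if n > 0 then Ia else IA)" | "line_state _ = TT"

lemma line_state_simps [simp]:
  "line_state e \<noteq> Ss" "line_state e \<noteq> PS" "line_state e \<noteq> Pa" "line_state e \<noteq> NA" "line_state e \<noteq> NS"
  "line_state e \<noteq> Tt" "line_state e = TT \<longleftrightarrow> \<not> is_B e"
  by (cases e; simp)+

lemma line_state_nonB [simp]: "\<not> is_B e \<Longrightarrow> line_state e = TT"
  by (cases e) auto

text \<open>Since a^x s^k = s^k a^(x/2^k), the exponent of a seen from the right end is x/2^k for
  \<open>Down\<close>, as it is y for \<open>Up\<close>. Appending a adds 1 to it, s^-1 doubles it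
  and s halves it. Hence a fraction must end in s, an even integer in s^-1 and an odd integer in a
  or a^-1; in a \<open>Down\<close> coset positive k also forces a final s.\<close>

fun state_of :: "elt \<Rightarrow> state" where
  "state_of (Bottom n) = I0"
| "state_of (Up e y) = (if y = 0 then Tt else if y \<notin> \<int> then Ss else
     if y > 0 then (if even \<lfloor>y\<rfloor> then PS else Pa) else (if even \<lfloor>y\<rfloor> then NS else NA))"
| "state_of (Down e x k) = (if x = 0 \<and> k = 0 then line_state e else if k > 0 \<or> x / 2 powi k \<notin> \<int> then Ss else
     if even \<lfloor>x / 2 powi k\<rfloor> then PS else Pa)"

fun step :: "state \<Rightarrow> letter \<Rightarrow> state option" where
  "step q (n, b) =
     (if n = 3 then (if b then (if q = TT then None else Some Tt) else (if q = Tt then None else Some TT))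
      else if n = 2 then
        (if b then (if q \<in> {Tt, PS, NS} then None else Some Ss)
         else (if q \<in> {Tt, Ss} then None else Some (if q \<in> {NA, NS} then NS else PS)))
      else
        (if b then (if q \<in> {Tt, PS} then Some Pa else if q \<in> {I0, Ia} then Some Ia else None)
         else (if q \<in> {Tt, NS} then Some NA else if q \<in> {I0, IA} then Some IA else None)))"

fun last_letter :: "state \<Rightarrow> letter option" where
  "last_letter I0 = None" | "last_letter Ia = Some la" | "last_letter IA = Some lA"
| "last_letter Tt = Some lt" | "last_letter TT = Some lT"
| "last_letter Pa = Some la" | "last_letter PS = Some lS" | "last_letter Ss = Some ls"
| "last_letter NA = Some lA" | "last_letter NS = Some lS"

definition tree_letter :: "state \<Rightarrow> letter \<Rightarrow> bool" where
  "tree_letter q x \<longleftrightarrow> step q x \<noteq> None \<or> last_letter q = Some (inv_letter x)"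

text \<open>Each replacement solves a rotation of a relator, or of its inverse, for the letter. For
  letters outside the tree the catch-all branches are reached only in state \<open>TT\<close> and
  the last line only in state \<open>Tt\<close>.\<close>

definition flow_word :: "state \<Rightarrow> letter \<Rightarrow> letter list" where
  "flow_word q x = (if tree_letter q x then [x] else
     if x = la then (case q of Pa \<Rightarrow> [lA, ls, la, lS] | Ss \<Rightarrow> [lS, la, la, ls] | NS \<Rightarrow> [ls, la, lS, lA] | _ \<Rightarrow> [lt, ls, lT])
     else if x = lA then (case q of PS \<Rightarrow> [ls, lA, lS, la] | Ss \<Rightarrow> [lS, lA, lA, ls] | NA \<Rightarrow> [la, ls, lA, lS] | _ \<Rightarrow> [lt, lS, lT])
     else if x = ls then [lT, la, lt] else [lT, lA, lt])"

lemma step_last: "step q x = Some q' \<Longrightarrow> x \<in> letters \<Longrightarrow> last_letter q' = Some x"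
  by (drule letter_cases) (auto split: if_splits)

abbreviation root :: elt where "root \<equiv> Down (Bottom 0) 0 0"

lemma st_I0: "is_elt e \<Longrightarrow> state_of e = I0 \<longleftrightarrow> e = root"
  by (cases e) (auto simp: is_elt_def split: if_splits elim!: line_state.elims)

lemma half_Ints: fixes y :: rat assumes "y \<in> \<int>" shows "y / 2 \<in> \<int> \<longleftrightarrow> even \<lfloor>y\<rfloor>"
proof -
  obtain n where n: "y = of_int n" using assms by (elim Ints_cases)
  show ?thesis
  proof
    assume "y / 2 \<in> \<int>"
    then obtain m where "y / 2 = of_int m" by (elim Ints_cases)
    then have "of_int n = (of_int (2 * m) :: rat)" using n by simp
    then have "n = 2 * m" unfolding of_int_eq_iff .
    then show "even \<lfloor>y\<rfloor>" unfolding n floor_of_int by simp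
  next
    assume "even \<lfloor>y\<rfloor>"
    then obtain m where "n = 2 * m" using n by auto
    then show "y / 2 \<in> \<int>" using n by simp
  qed
qed

lemma half_notin: "y \<notin> \<int> \<Longrightarrow> y / 2 \<notin> \<int>" for y :: rat
proof
  assume "y / 2 \<in> \<int>" then have "2 * (y / 2) \<in> \<int>" by (intro Ints_mult) auto
  then show "y \<notin> \<int> \<Longrightarrow> False" by simp
qed

lemma floor_double: "y \<in> \<int> \<Longrightarrow> \<lfloor>2 * y\<rfloor> = 2 * \<lfloor>y\<rfloor>" for y :: rat
  by (auto elim!: Ints_cases) (metis floor_of_int of_int_mult of_int_numeral)

lemma floor_double': "y \<in> \<int> \<Longrightarrow> \<lfloor>y * 2\<rfloor> = 2 * \<lfloor>y\<rfloor>" for y :: rat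
  using floor_double[of y] by (simp add: mult.commute)

lemma floor_m1 [simp]: "\<lfloor>- 1 :: rat\<rfloor> = - 1"
  by (simp add: floor_eq_iff)

lemma Ints_add1: "y + 1 \<in> \<int> \<longleftrightarrow> y \<in> \<int>" "y - 1 \<in> \<int> \<longleftrightarrow> y \<in> \<int>" for y :: rat
  by (auto simp: Ints_def) (metis add_diff_cancel_right' of_int_1 of_int_diff of_int_add diff_add_cancel rangeI)+

lemma Ints_pos_ge1: "y \<in> \<int> \<Longrightarrow> y > 0 \<Longrightarrow> y \<ge> 1" for y :: rat
  by (auto elim!: Ints_cases)

lemma step_st_P:
  assumes "is_elt (Up e y)" "step (state_of (Up e y)) x = Some q" "x \<in> {la, lA, ls, lS}"
  shows "state_of (act x (Up e y)) = q"
proof -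
  note H = half_Ints half_notin floor_double floor_double' Ints_add1
  have flux_letter: "y \<in> \<int> \<Longrightarrow> of_int \<lfloor>y\<rfloor> = y" by (auto elim!: Ints_cases)
  have 1: "y \<in> \<int> \<Longrightarrow> y > 0 \<Longrightarrow> y \<ge> 1" by (rule Ints_pos_ge1)
  have 2: "y \<in> \<int> \<Longrightarrow> y < 0 \<Longrightarrow> y \<le> -1" using Ints_pos_ge1[of "-y"] by auto
  show ?thesis using assms 1 2 flux_letter
    by (auto simp: H power_int_minus split: if_splits)
qed


lemma bs_s_M: "is_elt (Down e x k) \<Longrightarrow> bs 0 j (Down e x k) = Down e x (k + j)"
  by (simp add: is_elt_def unit_floor frac_eq)

lemma div_powi_add1: "x / 2 powi (k + 1) = x / 2 powi k / 2" "x / 2 powi (k - 1) = 2 * (x / 2 powi k)" for x :: rat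
  by (simp_all add: power_int_add power_int_diff)

text \<open>Both the exponent and its bound 2^(-k) are even, so the exponent is at most 2^(-k) - 2
  and adding 1 causes no carry across t^-1.\<close>

lemma PS_carry: assumes "0 \<le> x" "x < 1" "k < 0" "x / 2 powi k \<in> \<int>" "even \<lfloor>x / 2 powi k\<rfloor>"
  shows "x + 2 powi k < (1::rat)"
proof -
  obtain n where n: "x / 2 powi k = of_int n" using assms by (elim Ints_cases)
  then have x: "x = of_int n * 2 powi k" by (simp add: field_simps)
  define m where "m = nat (- k)"
  have k: "2 powi k = (1 :: rat) / 2 ^ m" and m: "m > 0" using assms by (auto simp: m_def power_int_def field_simps)
  have "of_int n < (of_int (2 ^ m) :: rat)" using assms(2) unfolding x k by (simp add: field_simps)
  then have "n < 2 ^ m" unfolding of_int_less_iff .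
  moreover have "even n" "even (2 ^ m :: int)" using assms n m by auto
  ultimately have "n + 1 < 2 ^ m" by (metis add.commute even_plus_one_iff zless_imp_add1_zle order_le_less)
  then have "of_int (n + 1) < (of_int (2 ^ m) :: rat)" unfolding of_int_less_iff .
  then show ?thesis unfolding x k by (simp add: field_simps)
qed

lemma step_st_M:
  assumes "is_elt (Down e x k)" "step (state_of (Down e x k)) y = Some q" "y \<in> {la, lA, ls, lS}"
  shows "state_of (act y (Down e x k)) = q"
proof -
  have g: "0 \<le> x" "x < 1" using assms by (auto simp: is_elt_def)
  define z where "z = x / 2 powi k"
  have z: "x / 2 powi (k + 1) = z / 2" "x / 2 powi (k - 1) = 2 * z" unfolding div_powi_add1 z_def by simp_all
  have z0: "z = 0 \<longleftrightarrow> x = 0" by (simp add: z_def)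
  have k0: "x = 0" if "k = 0" "z \<in> \<int>" using that g by (simp add: z_def unit_Ints)
  have nz: "x \<noteq> 0" if "z \<notin> \<int> \<or> odd \<lfloor>z\<rfloor>" using that by (auto simp: z_def)
  note H = half_Ints half_notin floor_double
  consider "y = ls" | "y = lS" | "y = la" | "y = lA" using assms by auto
  then show ?thesis
  proof cases
    case 1
    then show ?thesis using assms(2) g k0 nz unfolding 1 act_simps bs_s_M[OF assms(1)]
      by (auto simp: z z_def[symmetric] H z0 split: if_splits elim!: line_state.elims)
  next
    case 2
    have i: "2 * z \<in> \<int>" if "z \<in> \<int>" using that by simp
    have i': "2 * z \<in> \<int>" "even \<lfloor>2 * z\<rfloor>" if "x = 0" using that by (simp_all add: z_def)
    show ?thesis using assms(2) g k0 i i' unfolding 2 act_simps bs_s_M[OF assms(1)]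
      by (auto simp: z z_def[symmetric] H z0 split: if_splits elim!: line_state.elims)
  next
    case 3
    show ?thesis
    proof (cases "state_of (Down e x k) = PS")
      case True
      have c: "k \<le> 0" "z \<in> \<int>" "even \<lfloor>z\<rfloor>" "x \<noteq> 0 \<or> k \<noteq> 0" using True by (auto simp: z_def[symmetric] split: if_splits)
      moreover have "k \<noteq> 0" using k0 c by auto
      ultimately have c: "k < 0" "z \<in> \<int>" "even \<lfloor>z\<rfloor>" by auto
      have l: "x + 2 powi k < 1" using PS_carry[of x k] c g by (simp add: z_def)
      have p: "(0::rat) < 2 powi k" by simp
      have s: "(x + 2 powi k) / 2 powi k = z + 1" by (simp add: z_def field_simps)
      have "bs 1 0 (Down e x k) = Down e (x + 2 powi k) k"
        using l p g assms(1) by (simp add: unit_floor frac_eq is_elt_def)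
      then show ?thesis using 3 True c assms(2) s by (auto simp: Ints_add1)
    next
      case False
      then show ?thesis using assms(2) unfolding 3 by (auto split: if_splits elim!: line_state.elims)
    qed
  next
    case 4
    then show ?thesis using assms(2) unfolding 4 by (auto split: if_splits elim!: line_state.elims)
  qed
qed

text \<open>The automaton, run along a word, computes a function of the element reached; this is
  what allows the flow to depend on the state only.\<close>

lemma step_st: assumes "is_elt e" "step (state_of e) x = Some q" "x \<in> letters" shows "state_of (act x e) = q"
proof -
  consider "x \<in> {la, lA, ls, lS}" | "x = lt" | "x = lT" using letter_cases[OF assms(3)] by auto
  then show ?thesis
  proof cases
    case 1
    then show ?thesis using step_st_P[of _ _ x q] step_st_M[of _ _ _ x q] assms by (cases e) (auto simp: is_elt_def)
  next
    case 2
    have "\<not> mline e" using assms(2) 2 by (auto elim!: mlineE line_state.elims split: if_splits)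
    then show ?thesis using 2 assms(2) mult_t_P by (auto split: if_splits)
  next
    case 3
    have "\<not> pline e" using assms(2) 3 by (auto elim!: plineE split: if_splits)
    then show ?thesis using 3 assms(1,2) mult_t_inv_M[of e] by (cases e) (auto simp: is_elt_def split: if_splits)
  qed
qed

lemma pop_P:
  assumes "is_elt (Up e y)" "last_letter (state_of (Up e y)) = Some x" "y \<noteq> 0"
  shows "step (state_of (act (inv_letter x) (Up e y))) x = Some (state_of (Up e y))"
proof -
  have flux_letter: "y \<in> \<int> \<Longrightarrow> of_int \<lfloor>y\<rfloor> = y" by (auto elim!: Ints_cases)
  have fl2: "2 * y \<in> \<int> \<Longrightarrow> y \<notin> \<int> \<Longrightarrow> odd \<lfloor>2 * y\<rfloor>" using half_Ints[of "2 * y"] by simp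
  have 1: "y \<in> \<int> \<Longrightarrow> y > 0 \<Longrightarrow> y \<ge> 1" by (rule Ints_pos_ge1)
  have 2: "y \<in> \<int> \<Longrightarrow> y < 0 \<Longrightarrow> y \<le> -1" using Ints_pos_ge1[of "-y"] by auto
  show ?thesis
    using assms 1 2 flux_letter fl2 unfolding is_elt_def
    by (auto simp: mult.commute[of y 2] half_Ints Ints_add1 power_int_minus split: if_splits)
qed

lemma pop_M:
  assumes "is_elt (Down e x k)" "last_letter (state_of (Down e x k)) = Some y" "x \<noteq> 0 \<or> k \<noteq> 0"
  shows "step (state_of (act (inv_letter y) (Down e x k))) y = Some (state_of (Down e x k))"
proof -
  have g: "0 \<le> x" "x < 1" using assms by (auto simp: is_elt_def)
  define z where "z = x / 2 powi k"
  have z: "x / 2 powi (k + 1) = z / 2" "x / 2 powi (k - 1) = 2 * z" unfolding div_powi_add1 z_def by simp_all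
  have z0: "z = 0 \<longleftrightarrow> x = 0" by (simp add: z_def)
  have k0: "x = 0" if "k = 0" "z \<in> \<int>" using that g by (simp add: z_def unit_Ints)
  \<comment> \<open>For positive k the exponent x/2^k is below 1/2, so its double is an integer only
    if it vanishes.\<close>
  have kp: "x = 0" if "k > 0" "2 * z \<in> \<int>" 
  proof -
    have z1: "z * 2 powi k < 1" "z \<ge> 0" using g by (auto simp: z_def field_simps)
    moreover have "2 powi k \<ge> (2 powi 1 :: rat)" using that by (intro power_int_increasing) auto
    ultimately have "z * 2 \<le> z * 2 powi k" by (intro mult_left_mono) auto
    then have "2 * z < 1" "2 * z \<ge> 0" using z1 by auto
    then show ?thesis using unit_Ints[of "2 * z"] that z0 by auto
  qed
  show ?thesis
  proof (cases "state_of (Down e x k)")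
    case Ss
    have fl2: "2 * z \<in> \<int> \<Longrightarrow> z \<notin> \<int> \<Longrightarrow> odd \<lfloor>2 * z\<rfloor>" using half_Ints[of "2 * z"] by simp
    have "step (state_of (Down e x (k - 1))) ls = Some Ss"
      using Ss assms(3) g k0 kp fl2 
      by (auto simp: z z_def[symmetric] z0 split: if_splits elim!: line_state.elims)
    then show ?thesis using assms(2) bs_s_M[OF assms(1), of "-1"] Ss by auto
  next
    case PS
    then have c: "k \<le> 0" "z \<in> \<int>" "even \<lfloor>z\<rfloor>" using assms(3) by (auto simp: z_def[symmetric] split: if_splits)
    moreover have "k \<noteq> 0" using k0 c assms(3) by auto
    ultimately have c: "k < 0" "z \<in> \<int>" "even \<lfloor>z\<rfloor>" by auto
    have h: "z / 2 \<in> \<int>" using half_Ints[of z] c by simp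
    have k1: "k + 1 = 0 \<Longrightarrow> x = 0" using h g z by (simp add: unit_Ints)
    have "step (state_of (Down e x (k + 1))) lS = Some PS"
      using c h k1 by (auto simp: z z_def[symmetric] z0 split: if_splits elim!: line_state.elims)
    then show ?thesis using assms(2) bs_s_M[OF assms(1), of 1] PS by auto
  next
    case Pa
    then have c: "k \<le> 0" "z \<in> \<int>" "odd \<lfloor>z\<rfloor>" using assms(3) by (auto simp: z_def[symmetric] split: if_splits)
    moreover have "k \<noteq> 0" using k0 c assms(3) by auto
    ultimately have c: "k < 0" "z \<in> \<int>" "odd \<lfloor>z\<rfloor>" by auto
    have "x \<noteq> 0" using c by (auto simp: z_def)
    then have "z > 0" using g by (simp add: z_def)
    then have "z \<ge> 1" using c by (intro Ints_pos_ge1)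
    then have "x \<ge> 2 powi k" by (simp add: z_def field_simps)
    moreover have "x - 2 powi k < 1" using g(2) by (rule order.strict_trans1[rotated]) simp
    ultimately have "bs (-1) 0 (Down e x k) = Down e (x - 2 powi k) k"
      using g assms(1) by (auto simp: is_elt_def frac_eq unit_floor)
    moreover have "(x - 2 powi k) / 2 powi k = z - 1" by (simp add: z_def field_simps)
    ultimately show ?thesis using c Pa assms(2) by (auto simp: Ints_add1)
  qed (use assms g in \<open>auto split: if_splits\<close>)
qed

text \<open>The converse of \<open>step_st\<close>: the letter recorded in the state can be
  stripped, and appending it again is a transition. So the recorded letter leads to the parent in
  the tree.\<close>

lemma pop_st:
  assumes "is_elt e" "last_letter (state_of e) = Some x"
  shows "step (state_of (act (inv_letter x) e)) x = Some (state_of e)" and "x \<in> letters"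
proof -
  show "x \<in> letters" using assms(2) by (cases "state_of e") (auto simp: gens_def)
  consider e' y where "e = Up e' y" "y \<noteq> 0" | e' where "e = Up e' 0"
    | e' x' k where "e = Down e' x' k" "x' \<noteq> 0 \<or> k \<noteq> 0" | e' where "e = Down e' 0 0" "\<not> is_B e'" | n where "e = Down (Bottom n) 0 0"
    using assms(1) by (cases e) (auto simp: is_elt_def, metis elt.exhaust is_B.elims(1))
  then show "step (state_of (act (inv_letter x) e)) x = Some (state_of e)"
  proof cases
    case 2
    have "state_of e' \<noteq> TT" using assms(1) unfolding 2 is_elt_def by (cases e') (auto elim!: line_state.elims)
    then show ?thesis using 2 assms by (auto simp: mult_t_inv_line simp del: mult_t_inv.simps)
  next
    case 4
    have "state_of e' \<noteq> Tt" using assms(1) 4 unfolding is_elt_def by (cases e') (auto elim!: line_state.elims)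
    moreover have "line_state e' = TT" using 4 by simp
    ultimately show ?thesis using 4 assms by (auto simp: mult_t_line simp del: mult_t.simps)
  next
    case 5
    then show ?thesis using assms by (auto split: if_splits)
  qed (use assms pop_P pop_M in auto)
qed

section \<open>Existence and uniqueness of normal words\<close>

inductive normal :: "letter list \<Rightarrow> elt \<Rightarrow> bool" where
  normal_root: "normal [] root"
| normal_snoc: "normal w e \<Longrightarrow> x \<in> letters \<Longrightarrow> step (state_of e) x \<noteq> None \<Longrightarrow> normal (w @ [x]) (act x e)"

lemma is_elt_root [simp]: "is_elt root"
  by (simp add: is_elt_def)

lemma normal_facts: "normal w e \<Longrightarrow> is_elt e \<and> w \<in> words gens \<and> acts w root = e"
  by (induction rule: normal.induct) (auto simp: words_def)

text \<open>The state of an element names the last letter of every normal word for it, so the word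
  can be read off backwards.\<close>

lemma normal_unique: "normal w e \<Longrightarrow> normal w' e \<Longrightarrow> w = w'"
proof (induction arbitrary: w' rule: normal.induct)
  case normal_root
  from normal_root show ?case
  proof (cases rule: normal.cases)
    case (normal_snoc w e x)
    then have "last_letter (state_of root) = Some x"
      using step_st[of e x] step_last normal_facts by (metis not_None_eq)
    then show ?thesis by simp
  qed auto
next
  case (normal_snoc w e x)
  have l: "last_letter (state_of (act x e)) = Some x"
    using normal_snoc step_st[of e x] step_last normal_facts by (metis not_None_eq)
  from normal_snoc.prems show ?case
  proof (cases rule: normal.cases)
    case normal_root
    then show ?thesis using l by (metis last_letter.simps(1) option.simps(3) st_I0 is_elt_root)
  next
    case (normal_snoc w2 e2 x2)
    have "last_letter (state_of (act x e)) = Some x2"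
      using normal_snoc step_st[of e2 x2] step_last normal_facts by (metis not_None_eq)
    then have "x2 = x" using l by simp
    then have "e2 = e" using normal_snoc act_inv normal_facts normal_snoc.hyps \<open>normal w e\<close> \<open>x \<in> letters\<close>
      by (metis act_inv)
    then show ?thesis using normal_snoc \<open>x2 = x\<close> normal_snoc.IH by auto
  qed
qed

lemma normal_parent:
  assumes "is_elt e" "e \<noteq> root" "\<And>x. last_letter (state_of e) = Some x \<Longrightarrow> \<exists>w. normal w (act (inv_letter x) e)"
  shows "\<exists>w. normal w e"
proof -
  obtain x where x: "last_letter (state_of e) = Some x" using st_I0 assms(1,2) by (cases "state_of e") auto
  obtain w where "normal w (act (inv_letter x) e)" using assms(3) x by auto
  then have "normal (w @ [x]) (act x (act (inv_letter x) e))"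
    using pop_st[OF assms(1) x] by (intro normal_snoc) auto
  then show ?thesis using pop_st[OF assms(1) x] assms(1) by auto
qed

lemma normal_B: "\<exists>w. normal w (Down (Bottom n) 0 0)"
proof (induction "nat \<bar>n\<bar>" arbitrary: n)
  case 0
  then show ?case using normal_root by auto
next
  case (Suc m)
  have *: "is_elt (Down (Bottom n) 0 0)" by (simp add: is_elt_def)
  show ?case
  proof (rule normal_parent[OF *])
    show "Down (Bottom n) 0 0 \<noteq> root" using Suc by auto
    fix x assume "last_letter (state_of (Down (Bottom n) 0 0)) = Some x"
    then have "act (inv_letter x) (Down (Bottom n) 0 0) = Down (Bottom (n - sgn n)) 0 0" using Suc by (auto split: if_splits)
    moreover have "m = nat \<bar>n - sgn n\<bar>" using Suc by (auto simp: sgn_if)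
    ultimately show "\<exists>w. normal w (act (inv_letter x) (Down (Bottom n) 0 0))" using Suc by metis
  qed
qed

text \<open>Stripping letters halves an even exponent, raising k towards 0, and makes an odd
  exponent even at the same k. The measure therefore gives two units to each level and one to odd
  parity.\<close>

lemma normal_M_int:
  assumes "\<exists>w. normal w (Down e 0 0)" "is_elt (Down e x k)" "k \<le> 0" "x / 2 powi k \<in> \<int>"
  shows "\<exists>w. normal w (Down e x k)"
  using assms(2-)
proof (induction "nat (- k) * 2 + (if even \<lfloor>x / 2 powi k\<rfloor> then 0 else 1)" arbitrary: x k rule: less_induct)
  case less
  show ?case
  proof (cases "x = 0 \<and> k = 0")
    case False
    have "k \<noteq> 0" using False less unit_Ints[of x] by (auto simp: is_elt_def)
    then have k: "k < 0" using less by simp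
    define z where "z = x / 2 powi k"
    show ?thesis
    proof (rule normal_parent[OF less.prems(1)])
      show "Down e x k \<noteq> root" using False by auto
      fix y assume y: "last_letter (state_of (Down e x k)) = Some y"
      show "\<exists>w. normal w (act (inv_letter y) (Down e x k))"
      proof (cases "even \<lfloor>x / 2 powi k\<rfloor>")
        case True
        then have "act (inv_letter y) (Down e x k) = Down e x (k + 1)"
          using y k less.prems bs_s_M[OF less.prems(1), of 1] by auto
        moreover have "x / 2 powi (k + 1) \<in> \<int>" using True less.prems(3) unfolding div_powi_add1(1) by (simp only: half_Ints)
        moreover have "is_elt (Down e x (k + 1))" using less.prems by (simp add: is_elt_def)
        moreover have "nat (- k) = Suc (nat (- (k + 1)))" using k by simp
        ultimately show ?thesis using less.hyps[of "k + 1" x] True k by (simp split: if_splits)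
      next
        case F: False
        then have state_of: "state_of (Down e x k) = Pa" and yy: "y = la" using y k less.prems by auto
        have ge: "z \<ge> 1"
        proof (rule Ints_pos_ge1)
          show "z \<in> \<int>" using less.prems by (simp add: z_def)
          have "x \<noteq> 0" using F by auto
          then show "z > 0" using less.prems by (auto simp: z_def is_elt_def)
        qed
        then have "x \<ge> 2 powi k" by (simp add: z_def field_simps)
        moreover have "x - 2 powi k < 1" using less.prems(1) by (auto simp: is_elt_def intro: order.strict_trans1[rotated])
        ultimately have e: "act (inv_letter y) (Down e x k) = Down e (x - 2 powi k) k"
          using less.prems(1) by (auto simp: is_elt_def frac_eq unit_floor yy)
        have z1: "(x - 2 powi k) / 2 powi k = z - 1" by (simp add: z_def field_simps)
        have i: "(x - 2 powi k) / 2 powi k \<in> \<int>" using less.prems unfolding z1 by (simp add: z_def)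
        have ev: "even \<lfloor>(x - 2 powi k) / 2 powi k\<rfloor>" using F unfolding z1 by (simp add: z_def)
        have "is_elt (act (inv_letter y) (Down e x k))" using less.prems(1) yy by (intro is_elt_act) (auto simp: gens_def)
        then show ?thesis using less.hyps[of k "x - 2 powi k"] F i ev k unfolding e by simp
      qed
    qed
  qed (use assms in auto)
qed

lemma normal_M_x0:
  assumes "\<exists>w. normal w (Down e 0 0)" "is_elt (Down e 0 0)"
  shows "\<exists>w. normal w (Down e 0 (int k))"
proof (induction k)
  case (Suc k)
  have g: "is_elt (Down e 0 (int (Suc k)))" using assms by (simp add: is_elt_def)
  show ?case
    by (rule normal_parent[OF g]) (use Suc bs_s_M[OF g, of "-1"] in auto)
qed (use assms in auto)

text \<open>Stripping a trailing s doubles the exponent, so the induction is on the power of 2 in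
  its denominator. The elements with x = 0 and positive k are treated apart because their exponent 0
  says nothing about the number of trailing s.\<close>

lemma normal_M:
  assumes "\<exists>w. normal w (Down e 0 0)" "is_elt (Down e 0 0)" "is_elt (Down e x k)"
  shows "\<exists>w. normal w (Down e x k)"
proof (cases "x = 0 \<and> k > 0")
  case True
  then show ?thesis using normal_M_x0[OF assms(1,2), of "nat k"] by simp
next
  case False
  have "\<exists>j::nat. x / 2 powi k * 2 ^ j \<in> \<int>"
    using dyadic_div_powi assms(3) by (auto simp: is_elt_def dyadic_def)
  then obtain j where "x / 2 powi k * 2 ^ j \<in> \<int>" by auto
  then show ?thesis using assms(3) False
  proof (induction j arbitrary: k)
    case 0
    then have z: "x / 2 powi k \<in> \<int>" by simp
    have "k \<le> 0"
    proof (rule ccontr)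
      assume "\<not> k \<le> 0"
      then have "1 < (2 powi k :: rat)" using power_int_strict_increasing[of 0 k "2::rat"] by simp
      then have "x / 2 powi k < 1" using 0 by (simp add: is_elt_def)
      then have "x / 2 powi k = 0" using z unit_Ints[of "x / 2 powi k"] 0 by (simp add: is_elt_def)
      then show False using 0 \<open>\<not> k \<le> 0\<close> by simp
    qed
    then show ?case using normal_M_int[OF assms(1) _ _ z] 0 by auto
  next
    case (Suc j)
    show ?case
    proof (cases "x / 2 powi k \<in> \<int> \<and> k \<le> 0")
      case True
      then show ?thesis using normal_M_int[OF assms(1)] Suc by auto
    next
      case F: False
      then have state_of: "state_of (Down e x k) = Ss" using Suc by auto
      have g: "is_elt (Down e x (k - 1))" using Suc by (simp add: is_elt_def)
      have "x / 2 powi (k - 1) * 2 ^ j \<in> \<int>" using Suc by (simp add: div_powi_add1 algebra_simps)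
      moreover have "\<not> (x = 0 \<and> k - 1 > 0)" using Suc by auto
      ultimately have n: "\<exists>w. normal w (Down e x (k - 1))" using Suc.IH[of "k - 1"] g by auto
      show ?thesis
      proof (rule normal_parent[OF Suc.prems(2)])
        show "Down e x k \<noteq> root" using F by auto
        fix y assume "last_letter (state_of (Down e x k)) = Some y"
        then have "y = ls" unfolding state_of by simp
        then show "\<exists>w. normal w (act (inv_letter y) (Down e x k))" using n bs_s_M[OF Suc.prems(2), of "-1"] by simp
      qed
    qed
  qed
qed

text \<open>Stripping s^-1 halves m but multiplies the element below t by a. All translates of
  \<open>e\<close> by powers of a are therefore treated at once.\<close>

lemma normal_P_int:
  assumes "\<And>n. \<exists>w. normal w (Up (bs (of_int n) 0 e) 0)" "is_elt (Up e (of_int m))"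
  shows "\<exists>w. normal w (Up (bs (of_int n) 0 e) (of_int m))"
  using assms(2)
proof (induction "nat \<bar>m\<bar>" arbitrary: m n rule: less_induct)
  case less
  show ?case
  proof (cases "m = 0")
    case False
    let ?e = "Up (bs (of_int n) 0 e) (of_int m)"
    have g: "is_elt ?e" using less.prems is_elt_bs[of e "of_int n" 0] by (simp add: is_elt_def)
    have gb: "good e" using less.prems by (simp add: is_elt_def)
    show ?thesis
    proof (rule normal_parent[OF g])
      fix y assume y: "last_letter (state_of ?e) = Some y"
      show "\<exists>w. normal w (act (inv_letter y) ?e)"
      proof (cases "even m")
        case True
        then obtain l where l: "m = 2 * l" by auto
        have "y = lS" using y False True by (auto split: if_splits)
        then have "act (inv_letter y) ?e = Up (bs (of_int (n + 1)) 0 e) (of_int l)"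
          by (simp add: l bs_bs)
        then show ?thesis using less.hyps[of l "n + 1"] False l less.prems dyadic_of_int(1)
          by (auto simp: is_elt_def)
      next
        case F: False
        then have "y = (if m > 0 then la else lA)" using y False by (auto split: if_splits)
        then have "act (inv_letter y) ?e = Up (bs (of_int n) 0 e) (of_int (m - sgn m))"
          using False gb by (auto simp: bs_bs)
        moreover have "nat \<bar>m - sgn m\<bar> < nat \<bar>m\<bar>" using False by (auto simp: sgn_if)
        ultimately show ?thesis using less.hyps[of "m - sgn m" n] less.prems dyadic_of_int(1)[of "m - sgn m"]
          by (auto simp: is_elt_def)
      qed
    qed auto
  qed (use assms in auto)
qed

lemma normal_P:
  assumes "\<And>n. \<exists>w. normal w (Up (bs (of_int n) 0 e) 0)" "is_elt (Up e y)"
  shows "\<exists>w. normal w (Up (bs (of_int n) 0 e) y)"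
proof -
  obtain j where "y * 2 ^ j \<in> \<int>" using assms(2) by (auto simp: is_elt_def dyadic_def)
  then show ?thesis using assms(2)
  proof (induction j arbitrary: y n)
    case 0
    then obtain m where "y = of_int m" by (auto elim: Ints_cases)
    then show ?case using normal_P_int[OF assms(1)] 0 by simp
  next
    case (Suc j)
    let ?e = "Up (bs (of_int n) 0 e) y"
    have g: "is_elt ?e" using Suc.prems is_elt_bs[of e "of_int n" 0] by (simp add: is_elt_def)
    show ?case
    proof (cases "y \<in> \<int>")
      case True
      then obtain m where "y = of_int m" by (auto elim: Ints_cases)
      then show ?thesis using normal_P_int[OF assms(1)] Suc.prems by simp
    next
      case False
      then have state_of: "state_of ?e = Ss" by auto
      show ?thesis
      proof (rule normal_parent[OF g])
        fix x assume "last_letter (state_of ?e) = Some x"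
        then have "x = ls" unfolding state_of by simp
        then have e: "act (inv_letter x) ?e = Up (bs (of_int (n - 1)) 0 e) (y * 2)"
          by (simp add: bs_bs power_int_minus)
        have "is_elt (Up e (y * 2))" using Suc.prems dyadic_mult_powi[of y 1] by (auto simp: is_elt_def mult.commute)
        then show "\<exists>w. normal w (act (inv_letter x) ?e)"
          unfolding e using Suc by (intro Suc.IH) (auto simp: algebra_simps)
      qed auto
    qed
  qed
qed

lemma normal_exists: "is_elt e \<Longrightarrow> \<exists>w. normal w e"
proof (induction "depth e" arbitrary: e)
  case 0 then show ?case by (cases e) (auto simp: is_elt_def)
next
  case (Suc d)
  show ?case
  proof (cases e)
    case (Up e' y)
    have "\<exists>w. normal w (Up (bs (of_int n) 0 e') 0)" for n
    proof (rule normal_parent)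
      show g: "is_elt (Up (bs (of_int n) 0 e') 0)" using Suc Up by (simp add: is_elt_def)
      have "is_elt (bs (of_int n) 0 e')" "depth (bs (of_int n) 0 e') = d" using Suc Up by (auto simp: is_elt_def)
      then have "\<exists>w. normal w (bs (of_int n) 0 e')" using Suc by auto
      then show "\<exists>w. normal w (act (inv_letter x) (Up (bs (of_int n) 0 e') 0))"
        if "last_letter (state_of (Up (bs (of_int n) 0 e') 0)) = Some x" for x using that by (auto simp: mult_t_inv_line)
    qed auto
    from normal_P[OF this, of y 0] show ?thesis using Up Suc by (auto simp: is_elt_def)
  next
    case (Down e' x k)
    have g: "is_elt (Down e' 0 0)" "is_elt (Down e' x k)" using Down Suc by (auto simp: is_elt_def)
    have "\<exists>w. normal w (Down e' 0 0)"
    proof (cases "is_B e'")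
      case True then show ?thesis using normal_B by (cases e') auto
    next
      case False
      show ?thesis
      proof (rule normal_parent[OF g(1)])
        have "\<exists>w. normal w e'" using Suc False Down g by (auto simp: is_elt_def)
        then show "\<exists>w. normal w (act (inv_letter x) (Down e' 0 0))"
          if "last_letter (state_of (Down e' 0 0)) = Some x" for x using that False by (auto simp: mult_t_line)
      qed (use False in auto)
    qed
    then show ?thesis using normal_M g Down by auto
  qed (use Suc in auto)
qed

definition nf_word :: "elt \<Rightarrow> letter list" where
  "nf_word e = (THE w. normal w e)"

lemma normal_nf_word: "is_elt e \<Longrightarrow> normal (nf_word e) e"
  unfolding nf_word_def using normal_exists normal_unique by (metis the_equality)

lemma nf_word_root [simp]: "nf_word root = []"
  using normal_nf_word normal_root normal_unique by (metis is_elt_root)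

lemma nf_word_act: "is_elt e \<Longrightarrow> x \<in> letters \<Longrightarrow> step (state_of e) x \<noteq> None \<Longrightarrow> nf_word (act x e) = nf_word e @ [x]"
  using normal_nf_word normal_snoc normal_unique is_elt_act by metis

lemma nf_word_words: "is_elt e \<Longrightarrow> nf_word e \<in> words gens" and acts_nf_word: "is_elt e \<Longrightarrow> acts (nf_word e) root = e"
  using normal_facts normal_nf_word by auto


section \<open>Flow and presentation\<close>

definition tail :: "elt \<Rightarrow> nat" where
  "tail e = length (takeWhile (\<lambda>x. x = ls) (rev (nf_word e)))"

lemma nf_word_pop: "is_elt e \<Longrightarrow> last_letter (state_of e) = Some x \<Longrightarrow> nf_word e = nf_word (act (inv_letter x) e) @ [x]"
  using nf_word_act[of "act (inv_letter x) e" x] pop_st[of e x] by (metis act_inv' is_elt_act inv_letter_in option.simps(3))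

lemma tail_Ss: "is_elt e \<Longrightarrow> state_of e = Ss \<Longrightarrow> tail e = Suc (tail (act lS e))"
  using nf_word_pop[of e ls] by (simp add: tail_def)

lemma tail_not_Ss: assumes "is_elt e" "state_of e \<noteq> Ss" shows "tail e = 0"
proof (cases "e = root")
  case True then show ?thesis by (simp add: tail_def)
next
  case False
  then obtain x where x: "last_letter (state_of e) = Some x" using st_I0 assms(1) by (cases "state_of e") auto
  then have "x \<noteq> ls" using assms(2) by (cases "state_of e") auto
  then show ?thesis using nf_word_pop[OF assms(1) x] by (simp add: tail_def)
qed

text \<open>Carrying n across t^-1 lowers the exponent seen from the right by n * 2^(-k), which is
  an integer for k at most 0, and an even one for negative k.\<close>

lemma shift_M:
  fixes x :: rat
  assumes "k \<le> 0"
  obtains n where "frac (x + 2 powi k * of_int m) / 2 powi k = x / 2 powi k + of_int (m - n * 2 ^ nat (- k))"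
proof
  let ?n = "\<lfloor>x + 2 powi k * of_int m\<rfloor>"
  have k: "(2::rat) powi k = 1 / 2 ^ nat (- k)" using assms by (auto simp: power_int_def field_simps)
  show "frac (x + 2 powi k * of_int m) / 2 powi k = x / 2 powi k + of_int (m - ?n * 2 ^ nat (- k))"
    unfolding frac_def k by (simp add: algebra_simps)
qed

lemma Ints_add_of_int: "y + of_int n \<in> \<int> \<longleftrightarrow> y \<in> \<int>" for y :: rat
  by (metis Ints_add Ints_diff Ints_of_int add_diff_cancel_right')

lemma Ss_bs: assumes "is_elt e" shows "state_of (bs (of_int m) 0 e) = Ss \<longleftrightarrow> state_of e = Ss"
proof (cases e)
  case (Up e' y)
  moreover have "y + of_int m = 0 \<Longrightarrow> y \<in> \<int>" by (metis Ints_add_of_int Ints_0)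
  ultimately show ?thesis using assms by (auto simp: is_elt_def Ints_add_of_int)
next
  case (Down e' x k)
  show ?thesis
  proof (cases "k > 0")
    case True
    then have "frac (x + 2 powi k * of_int m) = x"
    proof -
      have i: "2 powi k * of_int m = (of_int (2 ^ nat k * m) :: rat)" using True by (simp add: power_int_def)
      show ?thesis unfolding i frac_add_of_int using assms Down by (simp add: is_elt_def frac_eq)
    qed
    then show ?thesis using Down True by auto
  next
    case False
    then obtain n where n: "frac (x + 2 powi k * of_int m) / 2 powi k = x / 2 powi k + of_int (m - n * 2 ^ nat (- k))"
      using shift_M[of k x m] by auto
    let ?x = "frac (x + 2 powi k * of_int m)"
    have *: "?x / 2 powi k \<in> \<int> \<longleftrightarrow> x / 2 powi k \<in> \<int>" unfolding n Ints_add_of_int ..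
    have 1: "state_of (Down e'' x' k) = Ss \<longleftrightarrow> x' / 2 powi k \<notin> \<int>" for e'' x' using False by auto
    show ?thesis unfolding Down bs.simps add_0_right 1 * ..
  qed
qed (use assms in \<open>auto simp: is_elt_def\<close>)

text \<open>Since a^m s^-1 = s^-1 a^(2m), stripping a trailing s is compatible with multiplication
  by powers of a; and by \<open>Ss_bs\<close> such a multiplication does not change whether the last
  letter is s.\<close>

lemma tail_bs: "is_elt e \<Longrightarrow> tail (bs (of_int m) 0 e) = tail e"
proof (induction "tail e" arbitrary: e m rule: less_induct)
  case less
  note g = less.prems is_elt_bs[OF less.prems, of "of_int m" 0, OF dyadic_of_int(1)]
  show ?case
  proof (cases "state_of e = Ss")
    case True
    have g1: "is_elt (bs 0 (-1) e)" using is_elt_act[of lS e] less.prems by (simp add: gens_def)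
    have "bs 0 (-1) (bs (of_int m) 0 e) = bs (of_int (2 * m)) 0 (bs 0 (-1) e)"
      by (simp add: bs_bs power_int_minus)
    then have "tail (bs 0 (-1) (bs (of_int m) 0 e)) = tail (bs 0 (-1) e)"
      using less.hyps[of "bs 0 (-1) e" "2 * m"] tail_Ss[OF g(1) True] g1 by simp
    then show ?thesis using tail_Ss[OF g(1) True] tail_Ss[OF g(2)] Ss_bs[OF g(1), of m] True by simp
  next
    case False
    then show ?thesis using tail_not_Ss g Ss_bs by auto
  qed
qed

text \<open>In a \<open>Down\<close> coset the exponent may wrap around from 0 to 2^(-k) - 1.
  Wrapping changes it by a multiple of the even number 2^(-k), so the parity is that of an ordinary
  decrement.\<close>

lemma PS_dec: assumes "is_elt e" "state_of e = PS" shows "state_of (bs (-1) 0 e) = Pa"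
proof (cases e)
  case (Up e' y)
  have 1: "y \<in> \<int> \<Longrightarrow> y > 0 \<Longrightarrow> y \<ge> 1" by (rule Ints_pos_ge1)
  then have "y \<noteq> 1" using Up assms by auto
  then show ?thesis using Up assms 1 by (auto simp: Ints_add1 split: if_splits)
next
  case (Down e' x k)
  define z where "z = x / 2 powi k"
  have c: "k \<le> 0" "z \<in> \<int>" "even \<lfloor>z\<rfloor>" "x \<noteq> 0 \<or> k \<noteq> 0" using Down assms(2) by (auto simp: z_def split: if_splits)
  moreover have "k \<noteq> 0" using c assms(1) Down by (auto simp: is_elt_def z_def unit_Ints)
  ultimately have k: "k < 0" by simp
  let ?x = "frac (x + 2 powi k * of_int (-1))"
  obtain n where n: "?x / 2 powi k = z + of_int (-1 - n * 2 ^ nat (- k))"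
    using shift_M[of k x "-1"] k unfolding z_def by auto
  have "even ((2::int) ^ nat (- k))" using k by simp
  then have o: "odd \<lfloor>?x / 2 powi k\<rfloor>" using c unfolding n floor_add_int[symmetric] by simp
  have "?x / 2 powi k \<in> \<int>" using c unfolding n Ints_add_of_int by simp
  then show ?thesis using o k unfolding Down by auto
qed (use assms in auto)

lemma NS_inc: assumes "is_elt e" "state_of e = NS" shows "state_of (bs 1 0 e) = NA"
proof (cases e)
  case (Up e' y)
  have 1: "y \<in> \<int> \<Longrightarrow> y < 0 \<Longrightarrow> y \<le> -1" using Ints_pos_ge1[of "-y"] by auto
  then have "y \<noteq> -1" using Up assms by auto
  then show ?thesis using Up assms 1 by (auto simp: Ints_add1 split: if_splits)
next
  case (Down e' x k) then show ?thesis using assms by (cases e') (auto split: if_splits)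
qed (use assms in auto)

primrec steps :: "letter list \<Rightarrow> elt \<Rightarrow> (elt \<times> letter) list" where
  "steps [] e = []" | "steps (x # w) e = (e, x) # steps w (act x e)"

text \<open>The second component ranks \<open>a\<close>-edges above \<open>s\<close>-edges of the
  same depth. The flow word of an \<open>a\<close>-edge may contain \<open>s\<close>-edges with
  longer tails, while an \<open>s\<close>-edge outside the tree itself flows to smaller
  depth.\<close>

definition flow_measure :: "elt \<times> letter \<Rightarrow> nat \<times> nat \<times> nat \<times> nat" where
  "flow_measure p = (depth (fst p), if fst (snd p) = 0 then 1 else 0, tail (fst p), length (nf_word (fst p)))"

definition flow_less :: "((elt \<times> letter) \<times> (elt \<times> letter)) set" where
  "flow_less = inv_image (less_than <*lex*> less_than <*lex*> less_than <*lex*> less_than) flow_measure"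

lemma wf_mu_rel: "wf flow_less"
  unfolding flow_less_def by (intro wf_inv_image wf_lex_prod wf_less_than)

lemma st_Tt: "state_of e = Tt \<Longrightarrow> \<exists>e'. e = Up e' 0"
  by (cases e) (auto split: if_splits)

lemma st_TT: "state_of e = TT \<Longrightarrow> \<exists>e'. e = Down e' 0 0 \<and> \<not> is_B e'"
  by (cases e) (auto split: if_splits)

lemma tree_letter_t [simp]: "tree_letter q lt" "tree_letter q lT"
  by (cases q; simp add: tree_letter_def)+

lemma not_tree_cases:
  "\<not> tree_letter q x \<Longrightarrow> x \<in> letters \<Longrightarrow>
    (q, x) \<in> {(Pa, la), (Ss, la), (NS, la), (TT, la), (PS, lA), (Ss, lA), (NA, lA), (TT, lA), (Tt, ls), (Tt, lS)}"
  by (drule letter_cases, cases q) (auto simp: tree_letter_def)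

lemma tree_letter_sym:
  assumes "is_elt e" "x \<in> letters" shows "tree_letter (state_of (act x e)) (inv_letter x) \<longleftrightarrow> tree_letter (state_of e) x"
proof -
  have "tree_letter (state_of (act x e)) (inv_letter x)" if "is_elt e" "x \<in> letters" "tree_letter (state_of e) x" for e x
  proof (cases "step (state_of e) x")
    case None
    then have "step (state_of (act x e)) (inv_letter x) \<noteq> None"
      using that pop_st[of e "inv_letter x"] by (simp add: tree_letter_def)
    then show ?thesis unfolding tree_letter_def by blast
  next
    case (Some q)
    then show ?thesis using step_st[OF that(1) Some that(2)] step_last[OF Some that(2)] by (simp add: tree_letter_def)
  qed
  from this[of e x] this[of "act x e" "inv_letter x"] show ?thesis using assms by auto
qed

lemma flow_word_simps:
  "flow_word Pa la = [lA, ls, la, lS]" "flow_word Ss la = [lS, la, la, ls]" "flow_word NS la = [ls, la, lS, lA]"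
  "flow_word TT la = [lt, ls, lT]"
  "flow_word PS lA = [ls, lA, lS, la]" "flow_word Ss lA = [lS, lA, lA, ls]" "flow_word NA lA = [la, ls, lA, lS]"
  "flow_word TT lA = [lt, lS, lT]" "flow_word Tt ls = [lT, la, lt]" "flow_word Tt lS = [lT, lA, lt]"
  by (simp_all add: flow_word_def tree_letter_def)

lemma acts_flow_word: "is_elt e \<Longrightarrow> x \<in> letters \<Longrightarrow> acts (flow_word (state_of e) x) e = act x e"
proof (cases "tree_letter (state_of e) x")
  case False
  assume g: "is_elt e" "x \<in> letters"
  have *: "bs 0 1 (mult_t e) = mult_t (bs 1 0 e)" "bs 0 (-1) (mult_t e) = mult_t (bs (-1) 0 e)"
    using bs_mult_t[OF g(1), of 1] bs_mult_t[OF g(1), of "-1"] by simp_all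
  have d: "mult_t_inv (mult_t (bs 1 0 e)) = bs 1 0 e" "mult_t_inv (mult_t (bs (-1) 0 e)) = bs (-1) 0 e"
    using mult_t_inv_mult_t is_elt_bs[OF g(1)] by simp_all
  have t: "e = mult_t (mult_t_inv e)" "is_elt (mult_t_inv e)" using mult_t_mult_t_inv g is_elt_mult_t_inv by auto
  have u: "mult_t (bs 1 0 (mult_t_inv e)) = bs 0 1 e" "mult_t (bs (-1) 0 (mult_t_inv e)) = bs 0 (-1) e"
    using bs_mult_t[OF t(2), of 1] bs_mult_t[OF t(2), of "-1"] t(1) by simp_all
  from not_tree_cases[OF False g(2)] show ?thesis
    by (auto simp: flow_word_simps bs_bs * d u power_int_minus)
qed (auto simp: flow_word_def)

lemma mu_s: "fst y \<noteq> 0 \<Longrightarrow> fst x = 0 \<Longrightarrow> depth e' = depth e \<Longrightarrow> ((e', y), (e, x)) \<in> flow_less"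
  by (simp add: flow_less_def flow_measure_def)

lemma mu_depth: "depth e' < depth e \<Longrightarrow> ((e', y), (e, x)) \<in> flow_less"
  by (simp add: flow_less_def flow_measure_def)

lemma mu_tail: "fst y = fst x \<Longrightarrow> depth e' = depth e \<Longrightarrow> tail e' < tail e \<Longrightarrow> ((e', y), (e, x)) \<in> flow_less"
  by (simp add: flow_less_def flow_measure_def)

lemma mu_len: "fst y = fst x \<Longrightarrow> depth e' = depth e \<Longrightarrow> tail e' = tail e \<Longrightarrow> length (nf_word e') < length (nf_word e)
  \<Longrightarrow> ((e', y), (e, x)) \<in> flow_less"
  by (simp add: flow_less_def flow_measure_def)

lemma flow_decreasing:
  assumes g: "is_elt e" and x: "x \<in> letters" "\<not> tree_letter (state_of e) x"
    and p: "p \<in> set (steps (flow_word (state_of e) x) e)" "\<not> tree_letter (state_of (fst p)) (snd p)"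
  shows "(p, (e, x)) \<in> flow_less"
proof -
  have L: "la \<in> letters" "lA \<in> letters" "ls \<in> letters" "lS \<in> letters" by (simp_all add: gens_def)
  from not_tree_cases[OF x(2,1)]
  consider "state_of e = Pa" "x = la" | "state_of e = Ss" "x = la" | "state_of e = NS" "x = la" | "state_of e = TT" "x = la \<or> x = lA"
    | "state_of e = PS" "x = lA" | "state_of e = Ss" "x = lA" | "state_of e = NA" "x = lA" | "state_of e = Tt" "x = ls \<or> x = lS" by auto
  then show ?thesis
  proof cases
    case 1
    define e1 where "e1 = act lA e"
    have g1: "is_elt e1" using is_elt_act[OF L(2) g] by (simp add: e1_def)
    have s1: "state_of e1 \<in> {Tt, PS}" using pop_st[OF g, of la] 1 by (auto simp: e1_def split: if_splits)
    have l1: "nf_word e = nf_word e1 @ [la]" using nf_word_pop[OF g, of la] 1 by (simp add: e1_def)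
    define e2 where "e2 = act ls e1"
    have g2: "is_elt e2" using is_elt_act[OF L(3) g1] by (simp add: e2_def)
    have d: "depth e1 = depth e" "depth e2 = depth e" "depth (act la e2) = depth e" by (simp_all add: e1_def e2_def)
    have t: "tail e = 0" using tail_not_Ss[OF g] 1 by simp
    \<comment> \<open>If \<open>e\<close> ends in s^-1 a, then \<open>e2\<close> is \<open>e\<close>
      without these two letters, and no s is exposed at its end. If it ends in t a, then
      \<open>e2\<close> again ends in t, where the \<open>a\<close>-edge belongs to the
      tree.\<close>
    have 2: "((e2, la), (e, x)) \<in> flow_less" if "\<not> tree_letter (state_of e2) la"
    proof (cases "state_of e1 = PS")
      case True
      then have "step (state_of e2) lS = Some PS" using pop_st[OF g1, of lS] by (simp add: e2_def)
      then have "state_of e2 \<noteq> Ss" by auto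
      moreover have "nf_word e1 = nf_word e2 @ [lS]" using nf_word_pop[OF g1, of lS] True by (simp add: e2_def)
      ultimately show ?thesis using tail_not_Ss[OF g2] t d l1 1 by (intro mu_len) auto
    next
      case False
      then obtain e' where "e1 = Up e' 0" using s1 st_Tt by auto
      then have "state_of e2 = Tt" by (simp add: e2_def)
      then show ?thesis using that by (simp add: tree_letter_def)
    qed
    have "p \<in> {(e, lA), (e1, ls), (e2, la), (act la e2, lS)}"
      using p(1) 1 unfolding e1_def e2_def by (auto simp: flow_word_simps)
    moreover have "tree_letter (state_of e) lA" using 1 by (simp add: tree_letter_def)
    ultimately show ?thesis using p(2) 1 2 d by (auto intro: mu_s)
  next
    case 7
    define e1 where "e1 = act la e"
    have g1: "is_elt e1" using is_elt_act[OF L(1) g] by (simp add: e1_def)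
    have s1: "state_of e1 \<in> {Tt, NS}" using pop_st[OF g, of lA] 7 by (auto simp: e1_def split: if_splits)
    have l1: "nf_word e = nf_word e1 @ [lA]" using nf_word_pop[OF g, of lA] 7 by (simp add: e1_def)
    define e2 where "e2 = act ls e1"
    have g2: "is_elt e2" using is_elt_act[OF L(3) g1] by (simp add: e2_def)
    have d: "depth e1 = depth e" "depth e2 = depth e" "depth (act lA e2) = depth e" by (simp_all add: e1_def e2_def)
    have t: "tail e = 0" using tail_not_Ss[OF g] 7 by simp
    have 2: "((e2, lA), (e, x)) \<in> flow_less" if "\<not> tree_letter (state_of e2) lA"
    proof (cases "state_of e1 = NS")
      case True
      then have "step (state_of e2) lS = Some NS" using pop_st[OF g1, of lS] by (simp add: e2_def)
      then have "state_of e2 \<noteq> Ss" by auto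
      moreover have "nf_word e1 = nf_word e2 @ [lS]" using nf_word_pop[OF g1, of lS] True by (simp add: e2_def)
      ultimately show ?thesis using tail_not_Ss[OF g2] t d l1 7 by (intro mu_len) auto
    next
      case False
      then obtain e' where "e1 = Up e' 0" using s1 st_Tt by auto
      then have "state_of e2 = Tt" by (simp add: e2_def)
      then show ?thesis using that by (simp add: tree_letter_def)
    qed
    have "p \<in> {(e, la), (e1, ls), (e2, lA), (act lA e2, lS)}"
      using p(1) 7 unfolding e1_def e2_def by (auto simp: flow_word_simps)
    moreover have "tree_letter (state_of e) la" using 7 by (simp add: tree_letter_def)
    ultimately show ?thesis using p(2) 7 2 d by (auto intro: mu_s)
  next
    case 3
    define e1 where "e1 = act ls e"
    have g1: "is_elt e1" using is_elt_act[OF L(3) g] by (simp add: e1_def)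
    have "step (state_of e1) lS = Some NS" using pop_st[OF g, of lS] 3 by (simp add: e1_def)
    then have s1: "state_of e1 \<noteq> Ss" by auto
    have l1: "nf_word e = nf_word e1 @ [lS]" using nf_word_pop[OF g, of lS] 3 by (simp add: e1_def)
    define e3 where "e3 = act lS (act la e1)"
    have g3: "is_elt e3" unfolding e3_def by (intro is_elt_act L g1)
    have d: "depth e1 = depth e" "depth (act la e1) = depth e" by (simp_all add: e1_def)
    have "act lA e3 = act la e" unfolding e3_def e1_def by (simp add: bs_bs power_int_minus)
    \<comment> \<open>The last edge of the flow word ends at e a, whose normal form is that of
      \<open>e3\<close> followed by a^-1; so it is a tree edge and only the edge at
      \<open>e1\<close> has to be compared.\<close>
    then have "state_of (act lA e3) = NA" using NS_inc[OF g] 3 by simp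
    then have "tree_letter (state_of (act lA e3)) la" by (simp add: tree_letter_def)
    then have 2: "tree_letter (state_of e3) lA" using tree_letter_sym[OF g3 L(2)] by simp
    have "p \<in> {(e, ls), (e1, la), (act la e1, lS), (e3, lA)}"
      using p(1) 3 unfolding e1_def e3_def by (auto simp: flow_word_simps)
    then show ?thesis using p(2) 3 2 d s1 l1 tail_not_Ss[OF g] tail_not_Ss[OF g1] by (auto intro: mu_s mu_len)
  next
    case 5
    define e1 where "e1 = act ls e"
    have g1: "is_elt e1" using is_elt_act[OF L(3) g] by (simp add: e1_def)
    have "step (state_of e1) lS = Some PS" using pop_st[OF g, of lS] 5 by (simp add: e1_def)
    then have s1: "state_of e1 \<noteq> Ss" by auto
    have l1: "nf_word e = nf_word e1 @ [lS]" using nf_word_pop[OF g, of lS] 5 by (simp add: e1_def)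
    define e3 where "e3 = act lS (act lA e1)"
    have g3: "is_elt e3" unfolding e3_def by (intro is_elt_act L g1)
    have d: "depth e1 = depth e" "depth (act lA e1) = depth e" by (simp_all add: e1_def)
    have "act la e3 = act lA e" unfolding e3_def e1_def by (simp add: bs_bs power_int_minus)
    then have "state_of (act la e3) = Pa" using PS_dec[OF g] 5 by simp
    then have "tree_letter (state_of (act la e3)) lA" by (simp add: tree_letter_def)
    then have 2: "tree_letter (state_of e3) la" using tree_letter_sym[OF g3 L(1)] by simp
    have "p \<in> {(e, ls), (e1, lA), (act lA e1, lS), (e3, la)}"
      using p(1) 5 unfolding e1_def e3_def by (auto simp: flow_word_simps)
    then show ?thesis using p(2) 5 2 d s1 l1 tail_not_Ss[OF g] tail_not_Ss[OF g1] by (auto intro: mu_s mu_len)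
  next
    case 2
    define e1 where "e1 = act lS e"
    have g1: "is_elt e1" using is_elt_act[OF L(4) g] by (simp add: e1_def)
    \<comment> \<open>Both \<open>a\<close>-edges of the flow word start after one trailing s has
      been stripped, and the first of them does not create a new one.\<close>
    have t: "tail e = Suc (tail e1)" "tail (act la e1) = tail e1"
      using tail_Ss[OF g] 2 tail_bs[OF g1, of 1] by (simp_all add: e1_def)
    have d: "depth e1 = depth e" by (simp add: e1_def)
    have "p \<in> {(e, lS), (e1, la), (act la e1, la), (act la (act la e1), ls)}"
      using p(1) 2 unfolding e1_def by (auto simp: flow_word_simps)
    then show ?thesis using 2 d t by (auto intro: mu_s mu_tail)
  next
    case 6
    define e1 where "e1 = act lS e"
    have g1: "is_elt e1" using is_elt_act[OF L(4) g] by (simp add: e1_def)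
    have t: "tail e = Suc (tail e1)" "tail (act lA e1) = tail e1"
      using tail_Ss[OF g] 6 tail_bs[OF g1, of "-1"] by (simp_all add: e1_def)
    have d: "depth e1 = depth e" by (simp add: e1_def)
    have "p \<in> {(e, lS), (e1, lA), (act lA e1, lA), (act lA (act lA e1), ls)}"
      using p(1) 6 unfolding e1_def by (auto simp: flow_word_simps)
    then show ?thesis using 6 d t by (auto intro: mu_s mu_tail)
  next
    case 4
    then obtain e' where e: "e = Down e' 0 0" "\<not> is_B e'" using st_TT by blast
    have "p \<in> {(e, lt), (e', ls), (e', lS)} \<or> snd p = lT"
      using p(1) 4 e by (auto simp: flow_word_simps mult_t_line simp del: mult_t.simps)
    then show ?thesis using p(2) e by (cases p) (auto intro!: mu_depth)
  next
    case 8
    then obtain e' where e: "e = Up e' 0" using st_Tt by blast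
    have "p \<in> {(e, lT), (e', la), (e', lA)} \<or> snd p = lt"
      using p(1) 8 e by (auto simp: flow_word_simps mult_t_inv_line simp del: mult_t_inv.simps)
    then show ?thesis using p(2) e by (cases p) (auto intro!: mu_depth)
  qed
qed

section \<open>Words modulo the relators\<close>

abbreviation peq :: "letter list \<Rightarrow> letter list \<Rightarrow> bool" (infix "\<approx>" 50) where
  "u \<approx> v \<equiv> pres_eq gens rels u v"

lemma words_append [simp]: "u @ v \<in> words S \<longleftrightarrow> u \<in> words S \<and> v \<in> words S"
  and words_Nil [simp]: "[] \<in> words S"
  and words_Cons [simp]: "x # v \<in> words S \<longleftrightarrow> x \<in> S \<times> UNIV \<and> v \<in> words S"
  by (auto simp: words_def)

lemma inv_word_words [simp]: "inv_word w \<in> words S \<longleftrightarrow> w \<in> words S"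
  by (induction w) (auto simp: inv_word_def words_def inv_letter_def)

lemma inv_word_simps [simp]: "inv_word [] = []" "inv_word (x # w) = inv_word w @ [inv_letter x]"
  "inv_word (u @ v) = inv_word v @ inv_word u" "inv_word (inv_word w) = w"
  by (simp_all add: inv_word_def rev_map[symmetric] comp_def)

lemma pres_eq_ctxt:
  assumes "R \<subseteq> words S" "pres_eq S R u v" "p \<in> words S" "q \<in> words S"
  shows "pres_eq S R (p @ u @ q) (p @ v @ q)"
  using assms(2)
proof (induction rule: pres_eq.induct)
  case (refl w) then show ?case using assms by (auto intro: pres_eq.refl)
next
  case (sym v w) then show ?case by (auto intro: pres_eq.sym)
next
  case (trans u v w) then show ?case by (auto intro: pres_eq.trans)
next
  case (cancel u v x) then show ?case using pres_eq.cancel[of "p @ u" S "v @ q" x R] assms by simp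
next
  case (relator u v r) then show ?case using pres_eq.relator[of "p @ u" S "v @ q" r R] assms by simp
qed

lemma rels_words: "rels \<subseteq> words gens"
  by (auto simp: rels_def gens_def)

lemmas peq_ctxt = pres_eq_ctxt[OF rels_words]

lemma peq_words: "u \<approx> v \<Longrightarrow> u \<in> words gens" "u \<approx> v \<Longrightarrow> v \<in> words gens"
  using pres_eq_words by auto

lemma peq_append: "u \<approx> u' \<Longrightarrow> v \<approx> v' \<Longrightarrow> u @ v \<approx> u' @ v'"
  using peq_ctxt[of u u' "[]" v] peq_ctxt[of v v' u' "[]"] peq_words pres_eq.trans by fastforce

lemma peq_inv_right: "w \<in> words gens \<Longrightarrow> w @ inv_word w \<approx> []"
proof (induction w rule: rev_induct)
  case (snoc x w)
  then have "w @ [x, inv_letter x] @ inv_word w \<approx> w @ inv_word w" by (intro pres_eq.cancel) auto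
  then show ?case using snoc pres_eq.trans by fastforce
qed (auto intro: pres_eq.refl)

lemma peq_inv_left: "w \<in> words gens \<Longrightarrow> inv_word w @ w \<approx> []"
  using peq_inv_right[of "inv_word w"] by simp

lemma peq_rotate: assumes "u @ v \<approx> []" shows "v @ u \<approx> []"
proof -
  have w: "u \<in> words gens" "v \<in> words gens" using peq_words(1)[OF assms] by auto
  have "v @ u \<approx> (v @ u) @ (v @ inv_word v)"
    using peq_append[OF pres_eq.refl peq_inv_right[OF w(2)], of "v @ u"] w by (auto intro: pres_eq.sym)
  also have "(v @ u) @ (v @ inv_word v) = v @ (u @ v) @ inv_word v" by simp
  finally have "v @ u \<approx> v @ inv_word v"
    using peq_ctxt[OF assms, of v "inv_word v"] w pres_eq.trans by fastforce
  then show ?thesis using peq_inv_right[OF w(2)] pres_eq.trans by blast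
qed

lemma peq_inv: assumes "w \<approx> []" shows "inv_word w \<approx> []"
proof -
  have w: "w \<in> words gens" using peq_words[OF assms] by auto
  have "[] @ inv_word w \<approx> w @ inv_word w" using assms w by (intro peq_append pres_eq.sym[OF assms] pres_eq.refl) auto
  then show ?thesis using peq_inv_right[OF w] pres_eq.trans by fastforce
qed

lemma peq_letter: assumes "inv_letter x # w \<approx> []" shows "[x] \<approx> w"
proof -
  have w: "x \<in> letters" "w \<in> words gens" using peq_words(1)[OF assms] by (cases x; auto)+
  have "[x] @ (inv_letter x # w) \<approx> [x] @ []" using w assms by (intro peq_append pres_eq.refl) auto
  moreover have "[] @ [x, inv_letter x] @ w \<approx> [] @ w" using w by (intro pres_eq.cancel) auto
  ultimately show ?thesis using pres_eq.trans pres_eq.sym by fastforce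
qed

lemma peq_flow_word: assumes "x \<in> letters" shows "[x] \<approx> flow_word q x"
proof (cases "tree_letter q x")
  case True
  then show ?thesis using assms by (auto simp: flow_word_def intro: pres_eq.refl)
next
  case False
  have r1: "[lt, ls, lT, lA] \<approx> []" and r2: "[ls, la, lS, lA, lA] \<approx> []"
    using pres_eq.relator[of "[]" gens "[]"] by (auto simp: rels_def)
  have i1: "[la, lt, lS, lT] \<approx> []" and i2: "[la, la, ls, lA, lS] \<approx> []"
    using peq_inv[OF r1] peq_inv[OF r2] by simp_all
  \<comment> \<open>All proper rotations of a relator of length 4, then of one of length 5.\<close>
  note r = peq_rotate[of "[_]" "[_, _, _]"] peq_rotate[of "[_, _]" "[_, _]"] peq_rotate[of "[_, _, _]" "[_]"]
    peq_rotate[of "[_]" "[_, _, _, _]"] peq_rotate[of "[_, _]" "[_, _, _]"]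
    peq_rotate[of "[_, _, _]" "[_, _]"] peq_rotate[of "[_, _, _, _]" "[_]"]
  note rr = r[simplified]
  show ?thesis
    using not_tree_cases[OF False assms] rr(1-3)[OF r1] rr(1-3)[OF i1] rr(4-7)[OF r2] rr(4-7)[OF i2] r1 r2 i1 i2
    by (auto simp: flow_word_simps intro!: peq_letter)
qed

lemma steps_letter: "(e', y) \<in> set (steps w e) \<Longrightarrow> w \<in> words S \<Longrightarrow> y \<in> S \<times> UNIV"
  by (induction w arbitrary: e) auto

lemma nf_word_step_tree:
  assumes "is_elt e" "x \<in> letters" "tree_letter (state_of e) x" shows "nf_word e @ [x] \<approx> nf_word (act x e)"
proof (cases "step (state_of e) x")
  case None
  then have n: "nf_word e = nf_word (act x e) @ [inv_letter x]"
    using assms nf_word_pop[of e "inv_letter x"] by (simp add: tree_letter_def)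
  have "nf_word (act x e) @ [inv_letter x, inv_letter (inv_letter x)] @ [] \<approx> nf_word (act x e) @ []"
    using assms nf_word_words[of "act x e"] by (intro pres_eq.cancel) auto
  then show ?thesis unfolding n by simp
next
  case (Some q)
  then have "nf_word (act x e) = nf_word e @ [x]" using nf_word_act assms by auto
  then show ?thesis using assms nf_word_words[of e] by (auto intro!: pres_eq.refl)
qed

lemma nf_word_steps:
  "is_elt e \<Longrightarrow> w \<in> words gens \<Longrightarrow> (\<And>e' y. (e', y) \<in> set (steps w e) \<Longrightarrow> is_elt e' \<Longrightarrow> nf_word e' @ [y] \<approx> nf_word (act y e')) \<Longrightarrow>
    nf_word e @ w \<approx> nf_word (acts w e)"
proof (induction w arbitrary: e)
  case Nil
  then show ?case using nf_word_words by (auto intro: pres_eq.refl)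
next
  case (Cons x w)
  have "nf_word e @ [x] \<approx> nf_word (act x e)" using Cons by auto
  then have "(nf_word e @ [x]) @ w \<approx> nf_word (act x e) @ w" using Cons by (intro peq_append pres_eq.refl) auto
  moreover have "nf_word (act x e) @ w \<approx> nf_word (acts w (act x e))" using Cons by (intro Cons.IH) auto
  ultimately show ?case using pres_eq.trans by fastforce
qed

text \<open>Induction along the flow: a letter outside the tree is replaced by its flow word, whose
  letters lie in the tree or are smaller. This is the completeness half of the presentation: words
  that act alike on \<open>root\<close> are equal modulo the relators.\<close>

lemma nf_word_step: "is_elt e \<Longrightarrow> x \<in> letters \<Longrightarrow> nf_word e @ [x] \<approx> nf_word (act x e)"
proof (induction "(e, x)" arbitrary: e x rule: wf_induct_rule[OF wf_mu_rel])
  case 1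
  let ?w = "flow_word (state_of e) x"
  show ?case
  proof (cases "tree_letter (state_of e) x")
    case False
    have w: "?w \<in> words gens" using peq_flow_word[OF 1(3)] peq_words by blast
    have l: "y \<in> letters" if "(e', y) \<in> set (steps ?w e)" for e' y
      using steps_letter that w by blast
    have "nf_word e @ [x] \<approx> nf_word e @ ?w"
      using peq_append[OF pres_eq.refl peq_flow_word[OF 1(3)]] nf_word_words 1 by blast
    moreover have "nf_word e @ ?w \<approx> nf_word (acts ?w e)"
    proof (rule nf_word_steps[OF 1(2) w])
      fix e' y assume *: "(e', y) \<in> set (steps ?w e)" "is_elt e'"
      show "nf_word e' @ [y] \<approx> nf_word (act y e')"
      proof (cases "tree_letter (state_of e') y")
        case False': False
        have "((e', y), (e, x)) \<in> flow_less" using flow_decreasing[OF 1(2,3) False *(1)] False' by simp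
        then show ?thesis using 1(1) * l by blast
      qed (use * l nf_word_step_tree in blast)
    qed
    ultimately show ?thesis using acts_flow_word 1 pres_eq.trans by metis
  qed (use 1 nf_word_step_tree in blast)
qed

lemma peq_nf_word: "w \<in> words gens \<Longrightarrow> w \<approx> nf_word (acts w root)"
  using nf_word_steps[of root w] nf_word_step steps_letter[of _ _ w root gens] by auto

lemma peq_iff: "u \<in> words gens \<Longrightarrow> v \<in> words gens \<Longrightarrow> u \<approx> v \<longleftrightarrow> acts u root = acts v root"
  using peq_nf_word[of u] peq_nf_word[of v] pres_eq_acts[of u v root] by (metis is_elt_root pres_eq.sym pres_eq.trans)

section \<open>The group and its presentation\<close>

definition enc :: "elt \<Rightarrow> nat" where "enc = to_nat"
definition dec :: "nat \<Rightarrow> elt" where "dec = from_nat"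

lemma dec_enc [simp]: "dec (enc e) = e"
  by (simp add: enc_def dec_def)

lemma enc_inj [simp]: "enc e = enc e' \<longleftrightarrow> e = e'"
  by (metis dec_enc)

text \<open>An element is identified with the image of \<open>root\<close> under it. To form a
  product, a word for the right factor acts on the left factor; by \<open>acts_nf_word_acts\<close>
  any word representing the right factor gives the same result, which is what makes the product
  associative.\<close>

definition BG :: "nat monoid" where
  "BG = \<lparr>carrier = enc ` {e. is_elt e}, monoid.mult = (\<lambda>m n. enc (acts (nf_word (dec n)) (dec m))), one = enc root\<rparr>"

lemma BG_simps [simp]: "carrier BG = enc ` {e. is_elt e}" "\<one>\<^bsub>BG\<^esub> = enc root"
  "enc e \<otimes>\<^bsub>BG\<^esub> enc e' = enc (acts (nf_word e') e)"
  by (simp_all add: BG_def)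

lemma acts_nf_word_acts: "w \<in> words gens \<Longrightarrow> is_elt e \<Longrightarrow> acts (nf_word (acts w root)) e = acts w e"
  using pres_eq_acts[OF peq_nf_word] by metis

lemma mult_acts: "w \<in> words gens \<Longrightarrow> is_elt e \<Longrightarrow> enc e \<otimes>\<^bsub>BG\<^esub> enc (acts w root) = enc (acts w e)"
  by (simp add: acts_nf_word_acts)

lemma acts_inv_word: "w \<in> words gens \<Longrightarrow> is_elt e \<Longrightarrow> acts w (acts (inv_word w) e) = e"
  using pres_eq_acts[OF peq_inv_left, of w e] by simp

lemma group_BG: "group BG"
proof (rule groupI)
  fix x y z assume "x \<in> carrier BG" "y \<in> carrier BG" "z \<in> carrier BG"
  then obtain a b c where *: "x = enc a" "is_elt a" "y = enc b" "is_elt b" "z = enc c" "is_elt c" by auto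
  show "x \<otimes>\<^bsub>BG\<^esub> y \<otimes>\<^bsub>BG\<^esub> z = x \<otimes>\<^bsub>BG\<^esub> (y \<otimes>\<^bsub>BG\<^esub> z)"
    using * nf_word_words acts_nf_word_acts[of "nf_word b @ nf_word c" a] by (simp add: acts_nf_word)
next
  fix x assume "x \<in> carrier BG"
  then obtain a where *: "x = enc a" "is_elt a" by auto
  let ?b = "acts (inv_word (nf_word a)) root"
  have "is_elt ?b" using nf_word_words * by (intro is_elt_acts) auto
  moreover have "enc ?b \<otimes>\<^bsub>BG\<^esub> x = \<one>\<^bsub>BG\<^esub>" using * nf_word_words acts_inv_word by simp
  ultimately show "\<exists>y\<in>carrier BG. y \<otimes>\<^bsub>BG\<^esub> x = \<one>\<^bsub>BG\<^esub>" by fastforce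
qed (auto simp: is_elt_acts nf_word_words acts_nf_word)

definition gen_elt :: "nat \<Rightarrow> nat" where
  "gen_elt i = enc (act (i, True) root)"

lemma eval_letter_BG: assumes "x \<in> letters" shows "eval_letter BG gen_elt x = enc (act x root)"
proof -
  interpret group BG by (rule group_BG)
  obtain i b where x: "x = (i, b)" by (cases x)
  have "enc (act (i, False) root) \<otimes>\<^bsub>BG\<^esub> enc (act (i, True) root) = \<one>\<^bsub>BG\<^esub>"
    using mult_acts[of "[(i, True)]" "act (i, False) root"] act_inv[of "(i, False)" root] assms x by simp
  then have "inv\<^bsub>BG\<^esub> (enc (act (i, True) root)) = enc (act (i, False) root)"
    using assms x by (intro inv_equality) simp_all
  then show ?thesis by (cases b) (auto simp: x eval_letter_def gen_elt_def)
qed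

lemma eval_word_BG: "w \<in> words gens \<Longrightarrow> eval_word BG gen_elt w = enc (acts w root)"
proof (induction w)
  case (Cons x w)
  then show ?case using eval_letter_BG[of x] mult_acts[of w "act x root"] by (simp add: eval_word_def)
qed (simp add: eval_word_def)

lemma eval_word_generate:
  assumes "group G" "\<pi> ` S \<subseteq> carrier G" "w \<in> words S" shows "eval_word G \<pi> w \<in> generate G (\<pi> ` S)"
  using assms(3)
proof (induction w)
  case Nil then show ?case by (simp add: eval_word_def generate.one)
next
  case (Cons x w)
  then have "eval_letter G \<pi> x \<in> generate G (\<pi> ` S)"
    by (auto simp: eval_letter_def intro: generate.incl generate.inv)
  then show ?case using Cons by (auto simp: eval_word_def intro: generate.eng)
qed

lemma generate_gens: "generate BG (gen_elt ` gens) = carrier BG"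
proof
  interpret group BG by (rule group_BG)
  have c: "gen_elt ` gens \<subseteq> carrier BG" by (auto simp: gen_elt_def)
  show "generate BG (gen_elt ` gens) \<subseteq> carrier BG" using generate_incl[OF c] .
  show "carrier BG \<subseteq> generate BG (gen_elt ` gens)"
  proof
    fix x assume "x \<in> carrier BG"
    then obtain e where e: "x = enc e" "is_elt e" by auto
    then have "x = eval_word BG gen_elt (nf_word e)" using eval_word_BG nf_word_words acts_nf_word by simp
    then show "x \<in> generate BG (gen_elt ` gens)" using eval_word_generate[OF group_BG c] nf_word_words e by simp
  qed
qed

lemma finite_presentation_BG: "finite_presentation_of BG gens rels"
  unfolding finite_presentation_of_def
proof (intro conjI exI ballI)
  show "gen_elt ` gens \<subseteq> carrier BG" by (auto simp: gen_elt_def)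
  show "(eval_word BG gen_elt w = \<one>\<^bsub>BG\<^esub>) = (w \<approx> [])" if "w \<in> words gens" for w
    using that peq_iff[of w "[]"] eval_word_BG by simp
qed (use rels_words generate_gens in \<open>auto simp: gens_def rels_def\<close>)

section \<open>Autostackability of the group\<close>

instance state :: finite
proof
  have "UNIV = {I0, Ia, IA, Tt, TT, Pa, PS, Ss, NA, NS}" using state.exhaust by blast
  then show "finite (UNIV :: state set)" by (metis finite.emptyI finite_insert)
qed

definition gen_of :: "letter \<Rightarrow> nat" where
  "gen_of x = enc (act x root)"

definition letter_of :: "nat \<Rightarrow> letter" where
  "letter_of = inv_into letters gen_of"

lemma step_root: "x \<in> letters \<Longrightarrow> step (state_of root) x \<noteq> None"
  by (drule letter_cases) auto

lemma nf_word_letter: "x \<in> letters \<Longrightarrow> nf_word (act x root) = [x]"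
  using nf_word_act[OF is_elt_root _ step_root] by simp

lemma gen_of_inj: "inj_on gen_of letters"
proof (rule inj_onI)
  fix x y assume xy: "x \<in> letters" "y \<in> letters" "gen_of x = gen_of y"
  have "act x root = act y root" using xy(3) unfolding gen_of_def enc_inj .
  then have "[x] = [y]" using nf_word_letter[OF xy(1)] nf_word_letter[OF xy(2)] by metis
  then show "x = y" by simp
qed

lemma letter_of_gen_of [simp]: "x \<in> letters \<Longrightarrow> letter_of (gen_of x) = x"
  unfolding letter_of_def by (rule inv_into_f_f[OF gen_of_inj])

lemma mult_gen_of [simp]: "is_elt e \<Longrightarrow> x \<in> letters \<Longrightarrow> enc e \<otimes>\<^bsub>BG\<^esub> gen_of x = enc (act x e)"
  using mult_acts[of "[x]" e] by (simp add: gen_of_def)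

lemma gen_of_carrier: "x \<in> letters \<Longrightarrow> gen_of x \<in> carrier BG"
  by (simp add: gen_of_def)

lemma inv_gen_of [simp]: assumes "x \<in> letters" shows "inv\<^bsub>BG\<^esub> (gen_of x) = gen_of (inv_letter x)"
proof -
  interpret group BG by (rule group_BG)
  have "gen_of (inv_letter x) \<otimes>\<^bsub>BG\<^esub> gen_of x = \<one>\<^bsub>BG\<^esub>"
    using mult_gen_of[of "act (inv_letter x) root" x] assms by (simp add: gen_of_def)
  then show ?thesis using assms by (intro inv_equality gen_of_carrier) (simp_all only: inv_letter_in)
qed

lemma walk_BG: "is_elt e \<Longrightarrow> w \<in> words gens \<Longrightarrow> walk BG (enc e) (map gen_of w) = map (\<lambda>(e, x). (enc e, gen_of x)) (steps w e)"
proof (induction w arbitrary: e)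
  case (Cons x w)
  then have "x \<in> letters" "w \<in> words gens" by (simp_all only: words_Cons)
  then show ?case using Cons.IH[OF is_elt_act] Cons.prems(1) by (simp only: list.map walk.simps mult_gen_of steps.simps split)
qed simp

lemma foldl_BG: "is_elt e \<Longrightarrow> w \<in> words gens \<Longrightarrow> foldl (\<otimes>\<^bsub>BG\<^esub>) (enc e) (map gen_of w) = enc (acts w e)"
proof (induction w arbitrary: e)
  case (Cons x w)
  then have "x \<in> letters" "w \<in> words gens" by (simp_all only: words_Cons)
  then show ?case using Cons.IH[OF is_elt_act] Cons.prems(1) by (simp only: list.map foldl_Cons mult_gen_of acts.simps)
qed simp

lemma tree_letter_iff:
  assumes "is_elt e" "x \<in> letters"
  shows "tree_letter (state_of e) x \<longleftrightarrow> step (state_of e) x \<noteq> None \<or> step (state_of (act x e)) (inv_letter x) \<noteq> None"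
proof
  assume "tree_letter (state_of e) x"
  then show "step (state_of e) x \<noteq> None \<or> step (state_of (act x e)) (inv_letter x) \<noteq> None"
    using pop_st[OF assms(1), of "inv_letter x"] assms unfolding tree_letter_def
    by (elim disjE) (simp_all only: inv_letter_inv_letter option.distinct simp_thms not_False_eq_True)
next
  assume "step (state_of e) x \<noteq> None \<or> step (state_of (act x e)) (inv_letter x) \<noteq> None"
  then show "tree_letter (state_of e) x"
  proof
    assume "step (state_of (act x e)) (inv_letter x) \<noteq> None"
    then obtain q where q: "step (state_of (act x e)) (inv_letter x) = Some q" by blast
    have "state_of e = q" using step_st[OF _ q] assms by simp
    then show ?thesis using step_last[OF q] assms unfolding tree_letter_def by simp
  qed (simp add: tree_letter_def)
qed

lemma flow_word_words: "x \<in> letters \<Longrightarrow> flow_word q x \<in> words gens"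
  using peq_flow_word peq_words by blast

lemma steps_gd: "(e', y) \<in> set (steps w e) \<Longrightarrow> w \<in> words gens \<Longrightarrow> is_elt e \<Longrightarrow> is_elt e'"
  by (induction w arbitrary: e) auto

lemma fin_gen_set_BG: "fin_gen_set BG (gen_of ` letters)"
  unfolding fin_gen_set_def
proof (intro conjI ballI)
  interpret group BG by (rule group_BG)
  show "finite (gen_of ` letters)" unfolding letters_eq by (intro finite_imageI) simp
  show c: "gen_of ` letters \<subseteq> carrier BG" using gen_of_carrier by (intro image_subsetI)
  show "generate BG (gen_of ` letters) = carrier BG"
  proof
    show "generate BG (gen_of ` letters) \<subseteq> carrier BG" using generate_incl[OF c] .
    have "gen_elt ` gens \<subseteq> gen_of ` letters"
    proof
      fix y assume "y \<in> gen_elt ` gens"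
      then obtain i where "i \<in> gens" "y = gen_elt i" by (rule imageE)
      then have "y = gen_of (i, True)" "(i, True) \<in> letters" by (simp_all add: gen_of_def gen_elt_def)
      then show "y \<in> gen_of ` letters" by (rule image_eqI)
    qed
    then show "carrier BG \<subseteq> generate BG (gen_of ` letters)" using mono_generate generate_gens by metis
  qed
  show "inv\<^bsub>BG\<^esub> a \<in> gen_of ` letters" if a: "a \<in> gen_of ` letters" for a
  proof -
    obtain x where x: "a = gen_of x" "x \<in> letters" using a by (rule imageE)
    show ?thesis unfolding x(1) inv_gen_of[OF x(2)] using x(2) by (intro imageI) (simp only: inv_letter_in)
  qed
  show "\<one>\<^bsub>BG\<^esub> \<notin> gen_of ` letters"
  proof
    assume "\<one>\<^bsub>BG\<^esub> \<in> gen_of ` letters"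
    then obtain x where x: "\<one>\<^bsub>BG\<^esub> = gen_of x" "x \<in> letters" by (rule imageE)
    then have "root = act x root" by (simp add: gen_of_def)
    then show False using nf_word_act[OF is_elt_root x(2) step_root[OF x(2)]] by simp
  qed
qed

theorem autostackable_BG: "autostackable BG"
proof -
  interpret group BG by (rule group_BG)
  let ?X = "gen_of ` letters"
  have L: "\<exists>e. g = enc e \<and> is_elt e" if "g \<in> carrier BG" for g using that by auto
  have LX: "\<exists>x. y = gen_of x \<and> x \<in> letters" if "y \<in> ?X" for y using that by (rule imageE) blast
  interpret stacking BG ?X "\<lambda>n. map gen_of (nf_word (dec n))" "\<lambda>n. state_of (dec n)" "\<lambda>q n. step q (letter_of n) \<noteq> None"
    "\<lambda>q n. the (step q (letter_of n))" "\<lambda>q n. map gen_of (flow_word q (letter_of n))"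
    "inv_image flow_less (\<lambda>(n, m). (dec n, letter_of m))"
  proof
    show "fin_gen_set BG ?X" by (rule fin_gen_set_BG)
    show "map gen_of (nf_word (dec \<one>\<^bsub>BG\<^esub>)) = []" by simp
    show "wf (inv_image flow_less (\<lambda>(n, m). (dec n, letter_of m)))" by (rule wf_inv_image[OF wf_mu_rel])
    fix g y assume gy: "g \<in> carrier BG" "y \<in> ?X"
    obtain e where e: "g = enc e" "is_elt e" using L[OF gy(1)] by blast
    obtain x where x: "y = gen_of x" "x \<in> letters" using LX[OF gy(2)] by blast
    have tree: "(step (state_of (dec g)) (letter_of y) \<noteq> None \<or> step (state_of (dec (g \<otimes>\<^bsub>BG\<^esub> y))) (letter_of (inv\<^bsub>BG\<^esub> y)) \<noteq> None) \<longleftrightarrow>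
        tree_letter (state_of e) x"
      using tree_letter_iff[OF e(2) x(2)] e x by simp
    show "map gen_of (nf_word (dec (g \<otimes>\<^bsub>BG\<^esub> y))) = map gen_of (nf_word (dec g)) @ [y]" if "step (state_of (dec g)) (letter_of y) \<noteq> None"
      using that nf_word_act[OF e(2) x(2)] e x by simp
    show "state_of (dec (g \<otimes>\<^bsub>BG\<^esub> y)) = the (step (state_of (dec g)) (letter_of y))" if "step (state_of (dec g)) (letter_of y) \<noteq> None"
      using that step_st[OF e(2) _ x(2)] e x by auto
    have flux: "flow_word (state_of e) x \<in> words gens" by (rule flow_word_words[OF x(2)])
    show "map gen_of (flow_word (state_of (dec g)) (letter_of y)) \<in> lists ?X"
      using flux e x unfolding words_def lists_image by (simp add: imageI)
    show "foldl (\<otimes>\<^bsub>BG\<^esub>) g (map gen_of (flow_word (state_of (dec g)) (letter_of y))) = g \<otimes>\<^bsub>BG\<^esub> y"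
      using e x foldl_BG[OF e(2) flux] acts_flow_word[OF e(2) x(2)] by simp
    show "map gen_of (flow_word (state_of (dec g)) (letter_of y)) = [y]"
      if "step (state_of (dec g)) (letter_of y) \<noteq> None \<or> step (state_of (dec (g \<otimes>\<^bsub>BG\<^esub> y))) (letter_of (inv\<^bsub>BG\<^esub> y)) \<noteq> None"
      using that unfolding tree using e x by (simp add: flow_word_def)
    fix h z
    assume nt: "\<not> (step (state_of (dec g)) (letter_of y) \<noteq> None \<or> step (state_of (dec (g \<otimes>\<^bsub>BG\<^esub> y))) (letter_of (inv\<^bsub>BG\<^esub> y)) \<noteq> None)"
      and hz: "(h, z) \<in> set (walk BG g (map gen_of (flow_word (state_of (dec g)) (letter_of y))))"
      and nt': "\<not> (step (state_of (dec h)) (letter_of z) \<noteq> None \<or> step (state_of (dec (h \<otimes>\<^bsub>BG\<^esub> z))) (letter_of (inv\<^bsub>BG\<^esub> z)) \<noteq> None)"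
    have "(h, z) \<in> (\<lambda>(e, x). (enc e, gen_of x)) ` set (steps (flow_word (state_of e) x) e)"
      using hz walk_BG[OF e(2) flux] e x by simp
    then obtain p where p: "(h, z) = (\<lambda>(e, x). (enc e, gen_of x)) p" "p \<in> set (steps (flow_word (state_of e) x) e)" by (rule imageE)
    obtain e' x' where p': "p = (e', x')" by (cases p)
    have hz': "h = enc e'" "z = gen_of x'" using p(1) unfolding p' by simp_all
    have x': "x' \<in> letters" using steps_letter[OF p(2)[unfolded p'] flux] .
    have g': "is_elt e'" using steps_gd[OF p(2)[unfolded p'] flux e(2)] .
    have "\<not> tree_letter (state_of e') x'" using nt' tree_letter_iff[OF g' x'] g' x' unfolding hz' by simp
    then have "(p, (e, x)) \<in> flow_less" using flow_decreasing[OF e(2) x(2) _ p(2)] nt unfolding tree p' by simp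
    then show "((h, z), (g, y)) \<in> inv_image flow_less (\<lambda>(n, m). (dec n, letter_of m))"
      using e x hz' x' p' by simp
  next
    fix g assume g: "g \<in> carrier BG" "g \<noteq> \<one>\<^bsub>BG\<^esub>"
    obtain e where e: "g = enc e" "is_elt e" using L[OF g(1)] by blast
    then have "state_of e \<noteq> I0" using g(2) st_I0 by auto
    then obtain x where x: "last_letter (state_of e) = Some x" by (cases "state_of e") simp_all
    note p = pop_st[OF e(2) x]
    have "is_elt (act (inv_letter x) e)" using p(2) e(2) by simp
    moreover have "g = enc (act (inv_letter x) e) \<otimes>\<^bsub>BG\<^esub> gen_of x" using calculation p(2) e by simp
    ultimately show "\<exists>h\<in>carrier BG. \<exists>y\<in>?X. step (state_of (dec h)) (letter_of y) \<noteq> None \<and> g = h \<otimes>\<^bsub>BG\<^esub> y"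
      using p by (intro bexI[of _ "enc (act (inv_letter x) e)"] bexI[of _ "gen_of x"] conjI imageI) simp_all
  qed
  show ?thesis by (rule autostackable)
qed

section \<open>A cochain with bounded coboundary\<close>

text \<open>The values of the cochain on the paths \<open>a\<^sup>m\<close> and \<open>s\<^sup>m\<close> starting in an element. The affine coset is
  retracted to the line through which it is entered, which extends the cochain with coboundary 0; on the
  initial coset the coboundary is 1 on the relator \<open>s a s\<^sup>-\<^sup>1 a\<^sup>-\<^sup>2\<close> at \<open>a\<^sup>n s\<close> with \<open>n\<close> even and 0 elsewhere.\<close>

fun flux_a :: "int \<Rightarrow> elt \<Rightarrow> int" and flux_s :: "int \<Rightarrow> elt \<Rightarrow> int" where
  "flux_a m (Bottom n) = 0"
| "flux_a m (Up e y) = 0"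
| "flux_a m (Down e x k) = (case e of
      Bottom n \<Rightarrow> if x = 0 \<and> k \<ge> 2 \<and> even n then m * 2 ^ nat (k - 2) else 0
    | _ \<Rightarrow> flux_s \<lfloor>x + 2 powi k * of_int m\<rfloor> e)"
| "flux_s m (Bottom n) = 0"
| "flux_s m (Up e y) = flux_a m e"
| "flux_s m (Down e x k) = 0"

lemma flux_a_M: "\<not> is_B e \<Longrightarrow> flux_a m (Down e x k) = flux_s \<lfloor>x + 2 powi k * of_int m\<rfloor> e"
  by (cases e) auto

lemma flux_a_B: "flux_a m (Down (Bottom n) x k) = (if x = 0 \<and> k \<ge> 2 \<and> even n then m * 2 ^ nat (k - 2) else 0)"
  by simp

declare flux_a.simps(3) [simp del] mult_t.simps [simp del] mult_t_inv.simps [simp del]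

lemma powi_mult_int: "k \<ge> 0 \<Longrightarrow> (2::rat) powi k * of_int m = of_int (2 ^ nat k * m)"
  by (simp add: power_int_def)

lemma bs_M_int:
  assumes "0 \<le> x" "x < 1" "k \<ge> 0"
  shows "bs (of_int m) 0 (Down e x k) = Down (bs 0 (2 ^ nat k * m) e) x k"
proof -
  have "\<lfloor>x + of_int (2 ^ nat k * m)\<rfloor> = 2 ^ nat k * m" using unit_floor[OF assms(1,2)] by (simp only: floor_add_int[symmetric])
  moreover have "frac (x + of_int (2 ^ nat k * m)) = x" using assms by (simp only: frac_add_of_int frac_eq)
  ultimately show ?thesis unfolding bs.simps powi_mult_int[OF assms(3)] by simp
qed

text \<open>At level k at least 2 the path a^m shifts n by the even number 2^k m, so the parity
  condition is constant along it.\<close>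

lemma flux_a_B_add:
  assumes "0 \<le> x" "x < 1"
  shows "flux_a (m + m') (Down (Bottom n) x k) = flux_a m (Down (Bottom n) x k) + flux_a m' (bs (of_int m) 0 (Down (Bottom n) x k))"
proof (cases "k \<ge> 2")
  case True
  then have e: "even ((2::int) ^ nat k * m)" by simp
  show ?thesis unfolding bs_M_int[OF assms order.trans[OF _ True, of 0, simplified]] bs.simps(1) flux_a_B
    using e by (simp add: algebra_simps)
qed (simp add: flux_a_B)

text \<open>Additivity along lines, so that the values given for powers agree with those summed
  letter by letter. Both statements are proved together because each function calls the other one
  level down.\<close>

lemma flux_as_add:
  "good e \<Longrightarrow> flux_a (m + m') e = flux_a m e + flux_a m' (bs (of_int m) 0 e) \<and> flux_s (m + m') e = flux_s m e + flux_s m' (bs 0 m e)"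
proof (induction e arbitrary: m m')
  case (Down e x k)
  have x: "0 \<le> x" "x < 1" "good e" using Down.prems by simp_all
  have "flux_a (m + m') (Down e x k) = flux_a m (Down e x k) + flux_a m' (bs (of_int m) 0 (Down e x k))"
  proof (cases "is_B e")
    case True
    then obtain n where "e = Bottom n" by (cases e) auto
    then show ?thesis using flux_a_B_add[OF x(1,2)] by simp
  next
    case False
    have s: "x + 2 powi k * of_int (m + m') = (x + 2 powi k * of_int m) + 2 powi k * of_int m'" by (simp add: algebra_simps)
    have flux_letter: "\<lfloor>x + 2 powi k * of_int (m + m')\<rfloor> =
        \<lfloor>x + 2 powi k * of_int m\<rfloor> + \<lfloor>frac (x + 2 powi k * of_int m) + 2 powi k * of_int m'\<rfloor>"
      unfolding s by (rule floor_add_frac)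
    have Bottom: "\<not> is_B (bs 0 \<lfloor>x + 2 powi k * of_int m\<rfloor> e)" using False by simp
    show ?thesis unfolding bs.simps flux_a_M[OF False] flux_a_M[OF Bottom] flux_letter add_0_right
      using Down.IH[OF x(3)] by simp
  qed
  then show ?case by simp
qed simp_all

lemma flux_a_add: "is_elt e \<Longrightarrow> flux_a (m + m') e = flux_a m e + flux_a m' (bs (of_int m) 0 e)"
  and flux_s_add: "is_elt e \<Longrightarrow> flux_s (m + m') e = flux_s m e + flux_s m' (bs 0 m e)"
  using flux_as_add unfolding is_elt_def by blast+

lemma flux_a_0 [simp]: "is_elt e \<Longrightarrow> flux_a 0 e = 0" and flux_s_0 [simp]: "is_elt e \<Longrightarrow> flux_s 0 e = 0"
  using flux_a_add[of e 0 0] flux_s_add[of e 0 0] by (simp_all add: is_elt_def)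

fun base :: "elt \<Rightarrow> bool" where
  "base (Down e x k) = is_B e" | "base _ = False"

text \<open>The relation s^N a^m s^-N = a^(2^N m) has value 0 here, since both paths carry the same
  amount 2^(k+N) m across the line of entry. General powers are allowed because
  \<open>flux_tower_word\<close> needs N to be a tower.\<close>

lemma cell_nonbase:
  assumes "is_elt e" "\<not> base e"
  shows "flux_s (int N) e + flux_a m (bs 0 (int N) e) = flux_a (2 ^ N * m) e + flux_s (int N) (bs (of_int (2 ^ N * m)) 0 e)"
proof (cases e)
  case (Down e' x k)
  have x: "0 \<le> x" "x < 1" "\<not> is_B e'" "good e'" using assms Down by (auto simp: is_elt_def)
  have A: "bs 0 (int N) e = Down e' x (k + int N)" using bs_s_M[OF assms(1)[unfolded Down], of "int N"] unfolding Down .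
  have "(2::rat) powi (k + int N) * of_int m = 2 powi k * of_int (2 ^ N * m)" by (simp add: power_int_add)
  then have "flux_a m (Down e' x (k + int N)) = flux_a (2 ^ N * m) (Down e' x k)" by (simp only: flux_a_M[OF x(3)])
  then show ?thesis unfolding A unfolding Down by simp
qed (use assms in \<open>auto simp: is_elt_def\<close>)

text \<open>Going up one level doubles the weight and halves the number of \<open>a\<close>-edges.
  The defect 1 arises only at k = 1, just below the first level that carries weight.\<close>

lemma cell_base:
  assumes "is_elt e" "base e"
  shows "\<bar>flux_s 1 e + flux_a 1 (bs 0 1 e) - flux_a 2 e - flux_s 1 (bs 2 0 e)\<bar> \<le> 1"
proof -
  obtain n x k where e: "e = Down (Bottom n) x k" using assms(2) by (cases e) (auto elim: is_B.elims)
  have x: "0 \<le> x" "x < 1" using assms e by (auto simp: is_elt_def)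
  have s: "bs 0 1 e = Down (Bottom n) x (k + 1)" using bs_s_M[OF assms(1)[unfolded e], of 1] unfolding e .
  have "\<bar>flux_a 1 (Down (Bottom n) x (k + 1)) - flux_a 2 (Down (Bottom n) x k)\<bar> \<le> 1"
  proof (cases "k \<ge> 2")
    case True
    then have "nat (k + 1 - 2) = Suc (nat (k - 2))" by simp
    then show ?thesis using True by (simp add: flux_a_B)
  next
    case False
    then have "k + 1 \<ge> 2 \<Longrightarrow> k = 1" by simp
    then show ?thesis using False by (auto simp: flux_a_B)
  qed
  then show ?thesis unfolding s unfolding e by simp
qed

text \<open>The cochain is transported unchanged across t: with \<open>t\<close>-edges of value 0,
  the relation t s^m t^-1 = a^m contributes nothing, whether or not the t cancels.\<close>

lemma flux_s_mult_t: assumes "is_elt e" shows "flux_s m (mult_t e) = flux_a m e"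
proof (cases "mline e")
  case True
  then show ?thesis by (elim mlineE) (simp add: mult_t_line flux_a_M del: mult_t.simps)
next
  case False
  then show ?thesis by (simp add: mult_t_P)
qed

definition flux_letter :: "letter \<Rightarrow> elt \<Rightarrow> int" where
  "flux_letter x e = (if fst x = 0 then flux_a (if snd x then 1 else - 1) e
     else if fst x = 2 then flux_s (if snd x then 1 else - 1) e else 0)"

lemma flux_letter_simps [simp]:
  "flux_letter la e = flux_a 1 e" "flux_letter lA e = flux_a (- 1) e" "flux_letter ls e = flux_s 1 e" "flux_letter lS e = flux_s (- 1) e" "flux_letter lt e = 0" "flux_letter lT e = 0"
  by (simp_all add: flux_letter_def)

primrec flux :: "letter list \<Rightarrow> elt \<Rightarrow> int" where
  "flux [] e = 0" | "flux (x # w) e = flux_letter x e + flux w (act x e)"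

lemma flux_append [simp]: "flux (u @ v) e = flux u e + flux v (acts u e)"
  by (induction u arbitrary: e) simp_all

lemma flux_letter_inv: assumes "x \<in> letters" "is_elt e" shows "flux_letter (inv_letter x) (act x e) = - flux_letter x e"
  using letter_cases[OF assms(1)] flux_a_add[OF assms(2), of 1 "- 1"] flux_a_add[OF assms(2), of "- 1" 1]
    flux_s_add[OF assms(2), of 1 "- 1"] flux_s_add[OF assms(2), of "- 1" 1] assms(2)
  by (elim disjE) simp_all

lemma flux_inv: "w \<in> words gens \<Longrightarrow> is_elt e \<Longrightarrow> flux (inv_word w) (acts w e) = - flux w e"
proof (induction w arbitrary: e)
  case (Cons x w)
  then have x: "x \<in> letters" "w \<in> words gens" "is_elt (act x e)" by simp_all
  have "acts (inv_word w) (acts w (act x e)) = act x e"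
    using acts_inv_word[of "inv_word w" "act x e"] x by simp
  then show ?case using Cons.IH[OF x(2,3)] flux_letter_inv[OF x(1) Cons.prems(2)] by simp
qed simp

lemma flux_rel: assumes "r \<in> rels" "is_elt e" shows "\<bar>flux r e\<bar> \<le> 1"
proof -
  have "r = [lt, ls, lT, lA] \<or> r = [ls, la, lS, lA, lA]" using assms(1) unfolding rels_def by simp
  then show ?thesis
  proof
    assume r: "r = [lt, ls, lT, lA]"
    have g: "is_elt (bs 1 0 e)" using is_elt_bs[OF assms(2)] by simp
    have "mult_t_inv (bs 0 1 (mult_t e)) = bs 1 0 e" using bs_mult_t[OF assms(2), of 1] mult_t_inv_mult_t[OF g] by simp
    then show ?thesis using flux_s_mult_t[OF assms(2), of 1] flux_a_add[OF assms(2), of 1 "- 1"] assms(2) unfolding r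
      by simp
  next
    assume r: "r = [ls, la, lS, lA, lA]"
    have b: "bs 0 (- 1) (bs 1 0 (bs 0 1 e)) = bs 2 0 e" by (simp add: bs_bs)
    have g: "is_elt (bs 2 0 e)" using is_elt_bs[OF assms(2), of 2 0] dyadic_of_int(1)[of 2] by simp
    have b1: "bs 1 0 (bs 0 1 e) = bs 0 1 (bs 2 0 e)" by (simp add: bs_bs)
    have b2: "bs 0 (- 1) (bs 0 1 (bs 2 0 e)) = bs 2 0 e" by (simp add: bs_bs)
    have 1: "flux_s (- 1) (bs 0 1 (bs 2 0 e)) = - flux_s 1 (bs 2 0 e)" using flux_s_add[OF g, of 1 "- 1"] g by simp
    have 2: "flux_a (- 1) (bs 2 0 e) + flux_a (- 1) (bs (- 1) 0 (bs 2 0 e)) = flux_a (- 2) (bs 2 0 e)"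
      using flux_a_add[OF g, of "- 1" "- 1"] by simp
    have 3: "flux_a (- 2) (bs 2 0 e) = - flux_a 2 e" using flux_a_add[OF assms(2), of 2 "- 2"] assms(2) by simp
    have "flux r e = flux_s 1 e + flux_a 1 (bs 0 1 e) - flux_s 1 (bs 2 0 e) - flux_a 2 e"
      unfolding r flux.simps flux_letter_simps act_simps b1 b2 using 1 2 3 by linarith
    moreover have "\<bar>flux_s 1 e + flux_a 1 (bs 0 1 e) - flux_a 2 e - flux_s 1 (bs 2 0 e)\<bar> \<le> 1"
      using cell_base[OF assms(2)] cell_nonbase[OF assms(2), of 1 1] by (cases "base e") simp_all
    ultimately show ?thesis by simp
  qed
qed

text \<open>Free cancellation changes nothing and a relator at most 1, at any base point. The
  uniformity in \<open>e\<close> is what makes a comparison of generating sets possible.\<close>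

lemma flux_peq: "u \<approx> v \<Longrightarrow> \<exists>b. \<forall>e. is_elt e \<longrightarrow> \<bar>flux u e - flux v e\<bar> \<le> b"
proof (induction rule: pres_eq.induct)
  case (refl w) then show ?case by (intro exI[of _ 0]) simp
next
  case (sym v w) then show ?case by (simp only: abs_minus_commute)
next
  case (trans u v w)
  from trans.IH obtain b c where b: "\<forall>e. is_elt e \<longrightarrow> \<bar>flux u e - flux v e\<bar> \<le> b" and c: "\<forall>e. is_elt e \<longrightarrow> \<bar>flux v e - flux w e\<bar> \<le> c"
    by (elim exE)
  have "\<bar>flux u e - flux w e\<bar> \<le> b + c" if "is_elt e" for e
    using spec[OF b, of e] spec[OF c, of e] that by simp
  then show ?case by (intro exI[of _ "b + c"] allI impI)
next
  case (cancel u v x)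
  have "flux (u @ [x, inv_letter x] @ v) e = flux (u @ v) e" if "is_elt e" for e
    using flux_letter_inv[OF cancel(3) is_elt_acts[OF cancel(1) that]] act_inv[OF cancel(3) is_elt_acts[OF cancel(1) that]]
    by (simp only: flux_append acts_append flux.simps acts.simps append.simps)
  then show ?case by (intro exI[of _ 0] allI impI) simp
next
  case (relator u v r)
  have "\<bar>flux (u @ r @ v) e - flux (u @ v) e\<bar> \<le> 1" if "is_elt e" for e
    using flux_rel[OF relator(3) is_elt_acts[OF relator(1) that]] acts_rel[OF relator(3) is_elt_acts[OF relator(1) that]]
    by (simp only: flux_append acts_append)
  then show ?case by (intro exI[of _ 1] allI impI)
qed

section \<open>Short words for tower powers, and their commutators with a\<close>

primrec tower_word :: "nat \<Rightarrow> letter list" where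
  "tower_word 0 = [la]" | "tower_word (Suc n) = lT # tower_word n @ [lt, la, lT] @ inv_word (tower_word n) @ [lt]"

definition tower :: "nat \<Rightarrow> nat" where
  "tower n = iterated_exp n 1"

lemma tower_simps [simp]: "tower 0 = 1" "tower (Suc n) = 2 ^ tower n"
  by (simp_all add: tower_def iterated_exp_def)

lemma tower_word_words [simp]: "tower_word n \<in> words gens"
  by (induction n) (auto simp: gens_def)

lemma length_tower_word: "length (tower_word n) + 5 = 6 * 2 ^ n"
  by (induction n) (auto simp: inv_word_def)

lemma letters_mem: "la \<in> letters" "lA \<in> letters" "ls \<in> letters" "lS \<in> letters" "lt \<in> letters" "lT \<in> letters"
  by (simp_all add: gens_def)

lemma is_elt_bs_int: "is_elt e \<Longrightarrow> is_elt (bs (of_int m) j e)"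
  by (simp add: is_elt_bs)

lemma conj_tower:
  assumes "is_elt e" shows "mult_t (bs (of_int m) 0 (mult_t_inv e)) = bs 0 m e"
  using bs_mult_t[OF is_elt_mult_t_inv[OF assms], of m] mult_t_mult_t_inv[OF assms] by simp

text \<open>Conjugation by t turns a^N into s^N, and s^N a s^-N = a^(2^N).\<close>

lemma acts_tower_word: "is_elt e \<Longrightarrow> acts (tower_word n) e = bs (of_int (int (tower n))) 0 e"
proof (induction n arbitrary: e)
  case (Suc n)
  let ?N = "int (tower n)"
  have inv: "acts (inv_word (tower_word n)) e' = bs (of_int (- ?N)) 0 e'" if g: "is_elt e'" for e'
  proof -
    have g': "is_elt (bs (of_int (- ?N)) 0 e')" using is_elt_bs_int[OF g] .
    have "acts (tower_word n) (bs (of_int (- ?N)) 0 e') = e'"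
      unfolding Suc.IH[OF g'] using g by (simp add: bs_bs is_elt_def)
    then show ?thesis using acts_inv_word[of "inv_word (tower_word n)" "bs (of_int (- ?N)) 0 e'"] g' by simp
  qed
  have g1: "is_elt (mult_t_inv e)" "is_elt (bs 0 ?N e)" using Suc.prems is_elt_mult_t_inv is_elt_bs_int[of e 0 ?N] by simp_all
  then have g2: "is_elt (bs 1 0 (bs 0 ?N e))" using is_elt_bs_int[of "bs 0 ?N e" 1 0] by simp
  have a1: "mult_t (acts (tower_word n) (mult_t_inv e)) = bs 0 ?N e"
    unfolding Suc.IH[OF g1(1)] using conj_tower[OF Suc.prems] .
  have a2: "mult_t (acts (inv_word (tower_word n)) (mult_t_inv (bs 1 0 (bs 0 ?N e)))) = bs 0 (- ?N) (bs 1 0 (bs 0 ?N e))"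
    unfolding inv[OF is_elt_mult_t_inv[OF g2]] using conj_tower[OF g2] .
  have "acts (tower_word (Suc n)) e = mult_t (acts (inv_word (tower_word n)) (mult_t_inv (bs 1 0 (mult_t (acts (tower_word n) (mult_t_inv e))))))"
    by (simp only: tower_word.simps acts.simps acts_append act_simps append.simps)
  then show ?case unfolding a1 a2 by (simp add: bs_bs)
qed simp

lemma acts_inv_tower_word: assumes "is_elt e" shows "acts (inv_word (tower_word n)) e = bs (of_int (- int (tower n))) 0 e"
proof -
  have g': "is_elt (bs (of_int (- int (tower n))) 0 e)" using is_elt_bs_int[OF assms] .
  have "acts (tower_word n) (bs (of_int (- int (tower n))) 0 e) = e"
    unfolding acts_tower_word[OF g'] using assms by (simp add: bs_bs is_elt_def)
  then show ?thesis using acts_inv_word[of "inv_word (tower_word n)" "bs (of_int (- int (tower n))) 0 e"] g' by simp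
qed

text \<open>The exponent sum of \<open>t\<close>; an element of nonzero height lies outside the initial coset.\<close>

fun t_height :: "elt \<Rightarrow> int" where
  "t_height (Bottom n) = 0" | "t_height (Up e y) = t_height e + 1" | "t_height (Down e x k) = (if is_B e then 0 else t_height e - 1)"

lemma t_height_bs [simp]: "t_height (bs z j e) = t_height e"
  by (induction e arbitrary: z j) simp_all

lemma t_height_base: "base e \<Longrightarrow> t_height e = 0"
  by (cases e) simp_all

lemma t_height_mult_t_inv [simp]: "is_elt e \<Longrightarrow> t_height (mult_t_inv e) = t_height e - 1"
  by (cases "pline e") (auto elim!: plineE simp: mult_t_inv_line mult_t_inv_M is_elt_def simp del: mult_t_inv.simps)

text \<open>Both copies of the shorter word are read behind a t^-1, hence at negative height and
  outside the initial coset. There \<open>IH\<close> replaces them by a power of a, which t turns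
  into a path along s.\<close>

lemma flux_tower_word_Suc:
  assumes IH: "\<And>e. is_elt e \<Longrightarrow> t_height e < 0 \<Longrightarrow> flux (tower_word n) e = flux_a (int (tower n)) e" and e: "is_elt e" "t_height e \<le> 0"
  shows "flux (tower_word (Suc n)) e = flux_s (int (tower n)) e + flux_a 1 (bs 0 (int (tower n)) e)
    - flux_s (int (tower n)) (bs (of_int (int (tower (Suc n)))) 0 e)"
proof -
  let ?N = "int (tower n)"
  have g1: "is_elt (mult_t_inv e)" "is_elt (bs 0 ?N e)" using e is_elt_mult_t_inv is_elt_bs_int[of e 0 ?N] by simp_all
  define e2 where "e2 = bs 1 0 (bs 0 ?N e)"
  have g2: "is_elt e2" using is_elt_bs_int[OF g1(2), of 1 0] by (simp add: e2_def)
  have a1: "mult_t (acts (tower_word n) (mult_t_inv e)) = bs 0 ?N e"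
    unfolding acts_tower_word[OF g1(1)] using conj_tower[OF e(1)] .
  define e3 where "e3 = bs (of_int (- ?N)) 0 (mult_t_inv e2)"
  have g3: "is_elt e3" unfolding e3_def by (intro is_elt_bs_int is_elt_mult_t_inv g2)
  have t3: "t_height e3 < 0" "t_height (mult_t_inv e) < 0" using e g2 by (simp_all add: e3_def e2_def)
  have i: "acts (inv_word (tower_word n)) (mult_t_inv e2) = e3" unfolding e3_def by (rule acts_inv_tower_word[OF is_elt_mult_t_inv[OF g2]])
  have u3: "acts (tower_word n) e3 = mult_t_inv e2" unfolding acts_tower_word[OF g3] unfolding e3_def using is_elt_mult_t_inv[OF g2] by (simp add: bs_bs is_elt_def)
  have t: "mult_t e3 = bs (of_int (int (tower (Suc n)))) 0 e"
    using conj_tower[OF g2, of "- ?N"] unfolding e3_def by (simp add: e2_def bs_bs)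
  have f3: "flux (inv_word (tower_word n)) (mult_t_inv e2) = - flux_s ?N (bs (of_int (int (tower (Suc n)))) 0 e)"
    using flux_inv[OF tower_word_words g3, of n] u3 IH[OF g3 t3(1)] flux_s_mult_t[OF g3, of ?N] unfolding t by simp
  have f1: "flux (tower_word n) (mult_t_inv e) = flux_s ?N e" using IH[OF g1(1) t3(2)] flux_s_mult_t[OF g1(1)] mult_t_mult_t_inv[OF e(1)] by simp
  show ?thesis
    unfolding tower_word.simps append.simps flux.simps flux_append acts_append acts.simps act_simps flux_letter_simps a1 f1
      e2_def[symmetric] f3 by simp
qed

lemma flux_tower_word: "is_elt e \<Longrightarrow> t_height e < 0 \<Longrightarrow> flux (tower_word n) e = flux_a (int (tower n)) e"
proof (induction n arbitrary: e)
  case (Suc n)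
  have "\<not> base e" using t_height_base Suc.prems(2) by force
  then show ?case using flux_tower_word_Suc[OF Suc.IH Suc.prems(1)] Suc.prems(2) cell_nonbase[OF Suc.prems(1), of "tower n" 1] by simp
qed simp

definition commutator_word :: "nat \<Rightarrow> letter list" where
  "commutator_word n = tower_word n @ [la] @ inv_word (tower_word n) @ [lA]"

lemma commutator_word_words: "commutator_word n \<in> words gens"
  by (simp add: commutator_word_def) (simp add: gens_def)

lemma length_commutator_word: "length (commutator_word n) \<le> 12 * 2 ^ n"
  using length_tower_word[of n] by (simp add: commutator_word_def inv_word_def)

lemma bs_a_root: "bs (of_int m) 0 root = Down (Bottom m) 0 0"
  by simp

lemma acts_commutator_word: "acts (commutator_word n) root = root"
proof -
  have g: "is_elt (bs 1 0 (bs (of_int (int (tower n))) 0 root))"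
    using is_elt_act[OF letters_mem(1) is_elt_bs_int[OF is_elt_root, of "int (tower n)" 0]] unfolding act_simps .
  have c: "bs (- 1) 0 (bs (of_int (- m)) 0 (bs 1 0 (bs (of_int m) 0 e))) = bs 0 0 e" for m e
    by (simp add: bs_bs)
  show ?thesis unfolding commutator_word_def acts_append acts_tower_word[OF is_elt_root] acts.simps act_simps acts_inv_tower_word[OF g] c
    by simp
qed

text \<open>The value comes from a single \<open>a\<close>-edge, the one at s^N with N =
  \<open>tower n\<close>; the weights start at level 2, whence the assumption. The inverse copy,
  read backwards, starts at a, where the exponent 1 is odd and the value is 0.\<close>

lemma flux_commutator_word: assumes "tower n \<ge> 2" shows "flux (commutator_word (Suc n)) root = 2 ^ (tower n - 2)"
proof -
  let ?N = "int (tower n)" and ?Down = "int (tower (Suc n))"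
  define e1 where "e1 = Down (Bottom 1) 0 0"
  have g1: "is_elt e1" by (simp add: e1_def is_elt_def)
  have U0: "flux (tower_word (Suc n)) root = 2 ^ (tower n - 2)"
    using flux_tower_word_Suc[OF flux_tower_word is_elt_root, of n] assms by (simp add: flux_a_B nat_diff_distrib)
  have U1: "flux (tower_word (Suc n)) e1 = 0"
    using flux_tower_word_Suc[OF flux_tower_word g1, of n] by (simp add: e1_def flux_a_B)
  have a: "acts (tower_word (Suc n)) root = Down (Bottom ?Down) 0 0" using acts_tower_word[OF is_elt_root] bs_a_root by metis
  have a2: "bs 1 0 (Down (Bottom ?Down) 0 0) = acts (tower_word (Suc n)) e1" unfolding acts_tower_word[OF g1] by (simp add: e1_def)
  have f2: "flux (inv_word (tower_word (Suc n))) (acts (tower_word (Suc n)) e1) = 0" using flux_inv[OF tower_word_words g1, of "Suc n"] U1 by (simp del: tower_word.simps)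
  have a3: "acts (inv_word (tower_word (Suc n))) (acts (tower_word (Suc n)) e1) = e1"
    using acts_inv_word[of "inv_word (tower_word (Suc n))" e1] g1 by (simp del: tower_word.simps)
  show ?thesis unfolding commutator_word_def flux_append flux.simps acts_append acts.simps act_simps a a2 f2 a3 U0
    by (simp add: flux_a_B e1_def)
qed

section \<open>The Dehn function\<close>

lemma orbit_enum:
  fixes d :: 'a
  assumes "f permutes D" "finite D" defines "n \<equiv> card (orbit f d)"
  shows "(f ^^ n) d = d" "orbit f d = (\<lambda>i. (f ^^ i) d) ` {..<n}" "inj_on (\<lambda>i. (f ^^ i) d) {..<n}"
proof -
  have s: "d \<in> orbit f d" using self_in_orbit[OF assms(1,2)] .
  let ?m = "funpow_dist1 f d d"
  have o: "orbit f d = (\<lambda>i. (f ^^ i) d) ` {0..<?m}" using orbit_conv_funpow_dist1[OF s] .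
  have i: "inj_on (\<lambda>i. (f ^^ i) d) {0..<?m}" using inj_on_funpow_dist1[OF s] .
  have "n = ?m" unfolding n_def o card_image[OF i] by simp
  then show "(f ^^ n) d = d" "orbit f d = (\<lambda>i. (f ^^ i) d) ` {..<n}" "inj_on (\<lambda>i. (f ^^ i) d) {..<n}"
    using funpow_dist1_prop[OF s] o i by (simp_all only: atLeast0LessThan)
qed

section \<open>From van Kampen diagrams to the Cayley graph\<close>

context group
begin

lemma eval_letter_closed: "\<pi> ` S \<subseteq> carrier G \<Longrightarrow> x \<in> S \<times> UNIV \<Longrightarrow> eval_letter G \<pi> x \<in> carrier G"
  by (auto simp: eval_letter_def)

lemma eval_letter_inv: "\<pi> ` S \<subseteq> carrier G \<Longrightarrow> x \<in> S \<times> UNIV \<Longrightarrow> eval_letter G \<pi> (inv_letter x) = inv (eval_letter G \<pi> x)"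
  by (auto simp: eval_letter_def inv_letter_def)

lemma eval_word_closed: "\<pi> ` S \<subseteq> carrier G \<Longrightarrow> w \<in> words S \<Longrightarrow> eval_word G \<pi> w \<in> carrier G"
  by (induction w) (simp_all add: eval_word_def eval_letter_closed)

lemma eval_word_Cons: "eval_word G \<pi> (x # w) = eval_letter G \<pi> x \<otimes> eval_word G \<pi> w"
  by (simp add: eval_word_def)

lemma eval_word_append:
  assumes "\<pi> ` S \<subseteq> carrier G" "u \<in> words S" "v \<in> words S"
  shows "eval_word G \<pi> (u @ v) = eval_word G \<pi> u \<otimes> eval_word G \<pi> v"
  using assms(2)
proof (induction u)
  case Nil
  then show ?case using eval_word_closed[OF assms(1,3)] by (simp add: eval_word_def)
next
  case (Cons x u)
  then have x: "x \<in> S \<times> UNIV" "u \<in> words S" by (simp_all only: words_Cons)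
  then show ?case using Cons.IH eval_letter_closed[OF assms(1) x(1)] eval_word_closed[OF assms(1)] assms(3)
    by (simp add: eval_word_Cons m_assoc)
qed

lemma eval_word_inv: assumes "\<pi> ` S \<subseteq> carrier G" "w \<in> words S" shows "eval_word G \<pi> (inv_word w) = inv (eval_word G \<pi> w)"
  using assms(2)
proof (induction w)
  case Nil then show ?case by (simp add: eval_word_def)
next
  case (Cons x w)
  then have x: "x \<in> S \<times> UNIV" "w \<in> words S" by (simp_all only: words_Cons)
  have x': "inv_letter x \<in> S \<times> UNIV" using x(1) by (cases x) simp
  note c = eval_letter_closed[OF assms(1) x(1)] eval_word_closed[OF assms(1) x(2)]
  have "eval_word G \<pi> (inv_word w @ [inv_letter x]) = inv (eval_word G \<pi> w) \<otimes> inv (eval_letter G \<pi> x)"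
    using eval_word_append[OF assms(1), of "inv_word w" "[inv_letter x]"] Cons.IH x x' eval_letter_inv[OF assms(1) x(1)] c
    by (simp add: eval_word_def)
  then show ?case using c by (simp add: eval_word_Cons inv_mult_group)
qed

lemma generate_eval_word:
  assumes "\<pi> ` S \<subseteq> carrier G" "g \<in> generate G (\<pi> ` S)"
  shows "\<exists>w\<in>words S. eval_word G \<pi> w = g"
  using assms(2)
proof (induction rule: generate.induct)
  case one
  show ?case by (rule bexI[of _ "[]"]) (simp_all add: eval_word_def)
next
  case (incl h)
  then obtain s where s: "h = \<pi> s" "s \<in> S" by (rule imageE)
  then have "\<pi> s \<in> carrier G" using assms(1) by blast
  then show ?case using s by (intro bexI[of _ "[(s, True)]"]) (simp_all add: eval_word_def eval_letter_def)
next
  case (inv h)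
  then obtain s where s: "h = \<pi> s" "s \<in> S" by (rule imageE)
  then have "\<pi> s \<in> carrier G" using assms(1) by blast
  then show ?case using s by (intro bexI[of _ "[(s, False)]"]) (simp_all add: eval_word_def eval_letter_def)
next
  case (eng g h)
  then obtain u v where "u \<in> words S" "eval_word G \<pi> u = g" "v \<in> words S" "eval_word G \<pi> v = h" by blast
  then show ?case using eval_word_append[OF assms(1)] by (intro bexI[of _ "u @ v"]) simp_all
qed

text \<open>The partial products of the labels along the orbit serve as \<open>u\<close>; they match
  up at the starting point because the full product is 1.\<close>

lemma loop_potential:
  assumes "f permutes D" "finite D" "\<And>x. x \<in> orbit f d \<Longrightarrow> l x \<in> S \<times> UNIV" "\<pi> ` S \<subseteq> carrier G"
    and "eval_word G \<pi> (map (\<lambda>i. l ((f ^^ i) d)) [0..<card (orbit f d)]) = \<one>"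
  shows "\<exists>u. \<forall>x\<in>orbit f d. u x \<in> carrier G \<and> u (f x) = u x \<otimes> eval_letter G \<pi> (l x)"
proof -
  let ?n = "card (orbit f d)"
  note e = orbit_enum[OF assms(1,2), of d]
  define w where "w i = map (\<lambda>i. l ((f ^^ i) d)) [0..<i]" for i
  define ix where "ix = inv_into {..<?n} (\<lambda>i. (f ^^ i) d)"
  have ix: "ix ((f ^^ i) d) = i" if "i < ?n" for i using inv_into_f_f[OF e(3)] that by (simp add: ix_def)
  define u where "u x = eval_word G \<pi> (w (ix x))" for x
  have lS: "l ((f ^^ i) d) \<in> S \<times> UNIV" if "i < ?n" for i
    using assms(3)[of "(f ^^ i) d"] e(2) that by blast
  have wS: "w i \<in> words S" if "i \<le> ?n" for i
    using that
  proof (induction i)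
    case (Suc i)
    then show ?case using lS[of i] by (simp add: w_def)
  qed (simp add: w_def)
  have wSuc: "eval_word G \<pi> (w (Suc i)) = eval_word G \<pi> (w i) \<otimes> eval_letter G \<pi> (l ((f ^^ i) d))" if "i < ?n" for i
  proof -
    have "w (Suc i) = w i @ [l ((f ^^ i) d)]" by (simp add: w_def)
    then show ?thesis using eval_word_append[OF assms(4) wS, of i "[l ((f ^^ i) d)]"] lS[OF that]
        eval_letter_closed[OF assms(4) lS[OF that]] that by (simp add: eval_word_def)
  qed
  have "u x \<in> carrier G \<and> u (f x) = u x \<otimes> eval_letter G \<pi> (l x)" if xo: "x \<in> orbit f d" for x
  proof -
    have "x \<in> (\<lambda>i. (f ^^ i) d) ` {..<?n}" using equalityD1[OF e(2)] xo by (rule subsetD)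
    then obtain i where i: "x = (f ^^ i) d" "i < ?n" by blast
    have ux: "u x = eval_word G \<pi> (w i)" using ix[OF i(2)] i(1) by (simp add: u_def)
    have fx: "f x = (f ^^ Suc i) d" using i(1) by simp
    have "u (f x) = eval_word G \<pi> (w (Suc i))"
    proof (cases "Suc i < ?n")
      case True
      then show ?thesis using ix[OF True] unfolding fx u_def by simp
    next
      case False
      then have n: "?n = Suc i" using i(2) by simp
      have fd: "f x = (f ^^ 0) d" using e(1) unfolding n fx by simp
      have "u (f x) = \<one>" using ix[of 0] n unfolding fd u_def by (simp add: w_def eval_word_def)
      then show ?thesis using assms(5) n by (simp add: w_def)
    qed
    then show ?thesis using wSuc[OF i(2)] eval_word_closed[OF assms(4) wS, of i] i ux by simp
  qed
  then show ?thesis by blast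
qed

end

lemma edges_of_card:
  assumes "spherical_map Dg" shows "2 * card (edges_of Dg) = card (darts Dg)"
proof -
  have p: "opp Dg permutes darts Dg" and fin: "finite (darts Dg)"
    and o: "\<And>d. d \<in> darts Dg \<Longrightarrow> opp Dg d \<noteq> d" "\<And>d. d \<in> darts Dg \<Longrightarrow> opp Dg (opp Dg d) = d"
    using assms unfolding spherical_map_def by blast+
  have orb: "orbit (opp Dg) x = {x, opp Dg x}" if x: "x \<in> darts Dg" for x
  proof
    show "orbit (opp Dg) x \<subseteq> {x, opp Dg x}"
    proof
      fix y assume "y \<in> orbit (opp Dg) x"
      then show "y \<in> {x, opp Dg x}" by (induction rule: orbit.induct) (use o(2)[OF x] in auto)
    qed
    show "{x, opp Dg x} \<subseteq> orbit (opp Dg) x"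
      using self_in_orbit[OF p fin, of x] orbit.base[of "opp Dg" x] by blast
  qed
  have "2 * card (edges_of Dg) = card (\<Union> (edges_of Dg))"
  proof (rule card_partition)
    have U: "\<Union> (edges_of Dg) \<subseteq> darts Dg"
      using permutes_orbit_subset[OF p] unfolding edges_of_def by blast
    show "finite (\<Union> (edges_of Dg))" by (rule finite_subset[OF U fin])
    show "finite (edges_of Dg)" unfolding edges_of_def using fin by (rule finite_imageI)
    fix c assume "c \<in> edges_of Dg"
    then obtain x where x: "c = orbit (opp Dg) x" "x \<in> darts Dg" unfolding edges_of_def by (rule imageE)
    show "card c = 2" unfolding x(1) orb[OF x(2)] using o(1)[OF x(2)] by simp
    fix c' assume c': "c' \<in> edges_of Dg" "c \<noteq> c'"
    then obtain y where y: "c' = orbit (opp Dg) y" unfolding edges_of_def by (elim imageE)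
    show "c \<inter> c' = {}"
    proof (rule ccontr)
      assume "c \<inter> c' \<noteq> {}"
      then obtain z where "z \<in> orbit (opp Dg) x" "z \<in> orbit (opp Dg) y" unfolding x(1) y by blast
      then have "orbit (opp Dg) x = orbit (opp Dg) y" using orbit_eq[OF p fin] by metis
      then show False using c'(2) x(1) y by simp
    qed
  qed
  also have "\<Union> (edges_of Dg) = darts Dg"
    using permutes_orbit_subset[OF p] self_in_orbit[OF p fin] unfolding edges_of_def by blast
  finally show ?thesis .
qed

text \<open>This is the map to the Cayley graph, sending a dart to the element at its initial
  vertex. With all edges glued the regions of \<open>labelled_map\<close> are those of the diagram,
  and sphericity gives the inequality needed in \<open>exists_potential\<close>.\<close>

lemma (in group) diagram_potential:
  assumes vk: "van_kampen_diagram S R Dg d0 w" and \<pi>: "\<pi> ` S \<subseteq> carrier G"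
    and R: "\<And>r. r \<in> R \<Longrightarrow> r \<in> words S \<and> eval_word G \<pi> r = \<one>"
  shows "\<exists>v. v d0 = \<one> \<and> (\<forall>x\<in>darts Dg. v x \<in> carrier G \<and> v (nxt Dg x) = v x \<otimes> eval_letter G \<pi> (lab Dg x) \<and>
      v (opp Dg x) = v x \<otimes> eval_letter G \<pi> (lab Dg x))"
proof -
  have sm: "spherical_map Dg" and d0: "d0 \<in> darts Dg"
    and lab: "\<And>d. d \<in> darts Dg \<Longrightarrow> lab Dg d \<in> S \<times> UNIV" "\<And>d. d \<in> darts Dg \<Longrightarrow> lab Dg (opp Dg d) = inv_letter (lab Dg d)"
    and reg: "\<And>f. f \<in> regions_of Dg - {orbit (nxt Dg) d0} \<Longrightarrow> \<exists>d\<in>f. boundary_label Dg d \<in> R \<or> inv_word (boundary_label Dg d) \<in> R"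
    using vk unfolding van_kampen_diagram_def by blast+
  have fin: "finite (darts Dg)" and ne: "darts Dg \<noteq> {}" and po: "opp Dg permutes darts Dg" and pn: "nxt Dg permutes darts Dg"
    and o: "\<And>d. d \<in> darts Dg \<Longrightarrow> opp Dg d \<noteq> d" "\<And>d. d \<in> darts Dg \<Longrightarrow> opp Dg (opp Dg d) = d"
    and cn: "\<And>d e. d \<in> darts Dg \<Longrightarrow> e \<in> darts Dg \<Longrightarrow>
      (d, e) \<in> ({(x, opp Dg x) | x. x \<in> darts Dg} \<union> {(x, nxt Dg x) | x. x \<in> darts Dg})\<^sup>*"
    and euler: "card (vertices_of Dg) + card (regions_of Dg) = card (edges_of Dg) + 2"
    using sm unfolding spherical_map_def by blast+
  define l where "l x = eval_letter G \<pi> (lab Dg x)" for x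
  interpret m: labelled_map G "darts Dg" "opp Dg" "nxt Dg \<circ> opp Dg" l
  proof
    show "nxt Dg \<circ> opp Dg permutes darts Dg" using po pn by (rule permutes_compose)
    show "l x \<in> carrier G" if "x \<in> darts Dg" for x unfolding l_def using eval_letter_closed[OF \<pi> lab(1)[OF that]] .
    show "l (opp Dg x) = inv (l x)" if "x \<in> darts Dg" for x
      unfolding l_def lab(2)[OF that] using eval_letter_inv[OF \<pi> lab(1)[OF that]] .
  qed (use fin po o in simp_all)
  have nx: "m.nx (darts Dg) = nxt Dg"
  proof
    fix x show "m.nx (darts Dg) x = nxt Dg x"
    proof (cases "x \<in> darts Dg")
      case True then show ?thesis using o(2) by (simp add: m.nx_def)
    next
      case False then show ?thesis using permutes_not_in[OF po False] by (simp add: m.nx_def)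
    qed
  qed
  have lA: "m.lA (darts Dg) x = l x" if "x \<in> darts Dg" for x using that by (simp add: m.lA_def)
  have es: "m.edge_set (darts Dg)" unfolding m.edge_set_def using m.op_in by (intro conjI image_subsetI) simp_all
  have conn: "m.conn (darts Dg)" unfolding m.conn_def nx
  proof (intro allI impI)
    fix S' assume S': "S' \<subseteq> darts Dg" "S' \<noteq> {}" "nxt Dg ` S' \<subseteq> S'" "opp Dg ` (S' \<inter> darts Dg) \<subseteq> S'"
    obtain x where x: "x \<in> S'" using S'(2) by blast
    have "e \<in> S'" if e: "e \<in> darts Dg" for e
    proof -
      have "(x, e) \<in> ({(x, opp Dg x) | x. x \<in> darts Dg} \<union> {(x, nxt Dg x) | x. x \<in> darts Dg})\<^sup>*"
        using cn[OF _ e] S'(1) x by blast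
      then show ?thesis
      proof (induction rule: rtrancl_induct)
        case base then show ?case using x .
      next
        case (step y z)
        then have "z = opp Dg y \<or> z = nxt Dg y" "y \<in> darts Dg" by auto
        then show ?case using step(3) S'(3,4) by blast
      qed
    qed
    then show "S' = darts Dg" using S'(1) by blast
  qed
  have ev1: "eval_word G \<pi> (boundary_label Dg d) = \<one>"
    if d: "d \<in> darts Dg" "boundary_label Dg d \<in> R \<or> inv_word (boundary_label Dg d) \<in> R" for d
    using d(2)
  proof
    assume "inv_word (boundary_label Dg d) \<in> R"
    then have r: "inv_word (boundary_label Dg d) \<in> words S" "eval_word G \<pi> (inv_word (boundary_label Dg d)) = \<one>" using R by blast+
    then have b: "boundary_label Dg d \<in> words S" by simp
    show ?thesis using eval_word_inv[OF \<pi> b] r(2) eval_word_closed[OF \<pi> b] by (metis inv_eq_1_iff)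
  qed (use R in blast)
  have "\<forall>f\<in>regions_of Dg - {orbit (nxt Dg) d0}. \<exists>u. \<forall>x\<in>f. u x \<in> carrier G \<and> u (nxt Dg x) = u x \<otimes> l x"
  proof
    fix f assume f: "f \<in> regions_of Dg - {orbit (nxt Dg) d0}"
    then obtain d where d: "d \<in> f" "boundary_label Dg d \<in> R \<or> inv_word (boundary_label Dg d) \<in> R" using reg by blast
    obtain x where x: "f = orbit (nxt Dg) x" "x \<in> darts Dg" using f unfolding regions_of_def by blast
    have fd: "f = orbit (nxt Dg) d" using orbit_eq[OF pn fin] d(1) unfolding x(1) by metis
    have sub: "f \<subseteq> darts Dg" unfolding x(1) using permutes_orbit_subset[OF pn x(2)] .
    then have dD: "d \<in> darts Dg" using d(1) by blast
    show "\<exists>u. \<forall>x\<in>f. u x \<in> carrier G \<and> u (nxt Dg x) = u x \<otimes> l x"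
      unfolding fd l_def
    proof (rule loop_potential[OF pn fin _ \<pi>])
      show "lab Dg x \<in> S \<times> UNIV" if "x \<in> orbit (nxt Dg) d" for x using that sub lab(1) unfolding fd by blast
      show "eval_word G \<pi> (map (\<lambda>i. lab Dg ((nxt Dg ^^ i) d)) [0..<card (orbit (nxt Dg) d)]) = \<one>"
        using ev1[OF dD d(2)] unfolding boundary_label_def .
    qed
  qed
  then obtain uf where uf: "\<And>f x. f \<in> regions_of Dg - {orbit (nxt Dg) d0} \<Longrightarrow> x \<in> f \<Longrightarrow>
      uf f x \<in> carrier G \<and> uf f (nxt Dg x) = uf f x \<otimes> l x"
    unfolding bchoice_iff by blast
  \<comment> \<open>Nothing is required along the outer region; the value 1 only keeps
    \<open>u\<close> inside the carrier.\<close>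
  define u where "u x = (if x \<in> orbit (nxt Dg) d0 then \<one> else uf (orbit (nxt Dg) x) x)" for x
  have inner: "orbit (nxt Dg) x \<in> regions_of Dg - {orbit (nxt Dg) d0}" "x \<in> orbit (nxt Dg) x"
    if "x \<in> darts Dg" "x \<notin> orbit (nxt Dg) d0" for x
    using that self_in_orbit[OF pn fin, of x] unfolding regions_of_def by auto
  have uc: "u x \<in> carrier G" if "x \<in> darts Dg" for x using uf inner that unfolding u_def by simp
  have ue: "u (m.nx (darts Dg) x) = u x \<otimes> m.lA (darts Dg) x" if x: "x \<in> darts Dg" "x \<notin> orbit (m.nx (darts Dg)) d0" for x
  proof -
    have n: "nxt Dg x \<notin> orbit (nxt Dg) d0"
      using x(2) orbit_apply[OF pn fin, of x] orbit_eq[OF pn fin, of _ d0] self_in_orbit[OF pn fin] unfolding nx by metis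
    show ?thesis unfolding nx lA[OF x(1)] u_def orbit_apply[OF pn fin]
      using n x(2)[unfolded nx] uf[OF inner[OF x(1) x(2)[unfolded nx]]] by simp
  qed
  have "card (darts Dg) + 4 \<le> 2 * card (orbit (m.nx {}) ` darts Dg) + 2 * card (orbit (m.nx (darts Dg)) ` darts Dg)"
    unfolding nx m.nx_empty using euler edges_of_card[OF sm] unfolding vertices_of_def regions_of_def by linarith
  then obtain v where v: "m.potential (darts Dg) v"
    using m.exists_potential[OF es ne conn _ d0 uc ue] by blast
  note vD = m.potentialD[OF v]
  define v' where "v' x = inv (v d0) \<otimes> v x" for x
  have "v' x \<in> carrier G \<and> v' (nxt Dg x) = v' x \<otimes> l x \<and> v' (opp Dg x) = v' x \<otimes> l x" if x: "x \<in> darts Dg" for x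
  proof -
    have c: "v x \<in> carrier G" "l x \<in> carrier G" "inv (v d0) \<in> carrier G" using vD(1) x d0 m.l(1) by simp_all
    have "v (nxt Dg x) = v (opp Dg x)" using vD(2)[OF m.op_in[OF x]] o(2)[OF x] by simp
    then show ?thesis using c vD(3)[OF x] by (simp add: v'_def m_assoc)
  qed
  moreover have "v' d0 = \<one>" using vD(1)[OF d0] by (simp add: v'_def)
  ultimately show ?thesis unfolding l_def by blast
qed

section \<open>Arbitrary finite presentations\<close>

definition subst_letter :: "(nat \<Rightarrow> nat) \<Rightarrow> letter \<Rightarrow> letter list" where
  "subst_letter \<pi> x = (if snd x then nf_word (dec (\<pi> (fst x))) else inv_word (nf_word (dec (\<pi> (fst x)))))"

definition subst_word :: "(nat \<Rightarrow> nat) \<Rightarrow> letter list \<Rightarrow> letter list" where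
  "subst_word \<pi> w = concat (map (subst_letter \<pi>) w)"

lemma subst_word_simps [simp]:
  "subst_word \<pi> [] = []" "subst_word \<pi> (x # w) = subst_letter \<pi> x @ subst_word \<pi> w"
  "subst_word \<pi> (u @ v) = subst_word \<pi> u @ subst_word \<pi> v"
  by (simp_all add: subst_word_def)

lemma subst_letter_inv: "subst_letter \<pi> (inv_letter x) = inv_word (subst_letter \<pi> x)"
  by (simp add: subst_letter_def inv_letter_def)

lemma subst_word_inv: "subst_word \<pi> (inv_word w) = inv_word (subst_word \<pi> w)"
  by (induction w) (simp_all add: subst_letter_inv)

lemma enc_inv_word: assumes "w \<in> words gens"
  shows "inv\<^bsub>BG\<^esub> (enc (acts w root)) = enc (acts (inv_word w) root)"
proof -
  interpret group BG by (rule group_BG)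
  have g: "is_elt (acts (inv_word w) root)" "is_elt (acts w root)" using assms by (intro is_elt_acts is_elt_root; simp)+
  have "enc (acts (inv_word w) root) \<otimes>\<^bsub>BG\<^esub> enc (acts w root) = \<one>\<^bsub>BG\<^esub>"
    using mult_acts[OF assms g(1)] acts_inv_word[OF assms is_elt_root] by simp
  then show ?thesis using g by (intro inv_equality) simp_all
qed

context
  fixes S :: "nat set" and \<pi> :: "nat \<Rightarrow> nat"
  assumes \<pi>: "\<pi> ` S \<subseteq> carrier BG"
begin

lemma subst_letter_words: "x \<in> S \<times> UNIV \<Longrightarrow> subst_letter \<pi> x \<in> words gens"
  and eval_letter_subst: "x \<in> S \<times> UNIV \<Longrightarrow> eval_letter BG \<pi> x = enc (acts (subst_letter \<pi> x) root)"
proof -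
  assume "x \<in> S \<times> UNIV"
  then obtain s b where x: "x = (s, b)" "s \<in> S" by (cases x) simp
  then have "\<pi> s \<in> enc ` {e. is_elt e}" using \<pi> by auto
  then obtain e where e: "\<pi> s = enc e" "is_elt e" by blast
  then have w: "nf_word (dec (\<pi> s)) \<in> words gens" using nf_word_words by simp
  then show "subst_letter \<pi> x \<in> words gens" by (simp add: subst_letter_def x(1))
  show "eval_letter BG \<pi> x = enc (acts (subst_letter \<pi> x) root)"
    using enc_inv_word[OF w] e acts_nf_word[OF e(2)] x(1)
    by (cases b) (simp_all add: eval_letter_def subst_letter_def)
qed

lemma subst_word_words: "w \<in> words S \<Longrightarrow> subst_word \<pi> w \<in> words gens"
  by (induction w) (simp_all add: subst_letter_words)

lemma mult_eval_letter:
  "x \<in> S \<times> UNIV \<Longrightarrow> is_elt e \<Longrightarrow> enc e \<otimes>\<^bsub>BG\<^esub> eval_letter BG \<pi> x = enc (acts (subst_letter \<pi> x) e)"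
  unfolding eval_letter_subst using mult_acts[OF subst_letter_words] .

lemma mult_eval_word:
  "w \<in> words S \<Longrightarrow> is_elt e \<Longrightarrow> enc e \<otimes>\<^bsub>BG\<^esub> eval_word BG \<pi> w = enc (acts (subst_word \<pi> w) e)"
proof (induction w arbitrary: e)
  case Nil
  interpret group BG by (rule group_BG)
  show ?case using Nil by (simp add: eval_word_def)
next
  case (Cons x w)
  interpret group BG by (rule group_BG)
  have x: "x \<in> S \<times> UNIV" "w \<in> words S" using Cons.prems(1) by (simp_all only: words_Cons)
  have g: "is_elt (acts (subst_letter \<pi> x) e)" using is_elt_acts[OF subst_letter_words[OF x(1)] Cons.prems(2)] .
  have c: "enc e \<in> carrier BG" using Cons.prems(2) by simp
  have "enc e \<otimes>\<^bsub>BG\<^esub> eval_word BG \<pi> (x # w) = enc e \<otimes>\<^bsub>BG\<^esub> eval_letter BG \<pi> x \<otimes>\<^bsub>BG\<^esub> eval_word BG \<pi> w"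
    unfolding eval_word_Cons
    using m_assoc[OF c eval_letter_closed[OF \<pi> x(1)] eval_word_closed[OF \<pi> x(2)]] by simp
  then show ?case unfolding mult_eval_letter[OF x(1) Cons.prems(2)] Cons.IH[OF x(2) g] by simp
qed

lemma eval_word_subst: assumes "w \<in> words S" shows "eval_word BG \<pi> w = enc (acts (subst_word \<pi> w) root)"
proof -
  interpret group BG by (rule group_BG)
  show ?thesis using mult_eval_word[OF assms is_elt_root] eval_word_closed[OF \<pi> assms] l_one
    by (metis BG_simps(2))
qed

lemma eval_one_iff: "w \<in> words S \<Longrightarrow> eval_word BG \<pi> w = \<one>\<^bsub>BG\<^esub> \<longleftrightarrow> subst_word \<pi> w \<approx> []"
  using eval_word_subst peq_iff[OF subst_word_words, of w "[]"] by simp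

text \<open>Summing the cochain over all darts gives 0, since opposite darts cancel; grouping the darts by regions
  bounds the value on the outer boundary by the number of inner regions.\<close>

lemma area_bound:
  assumes vk: "van_kampen_diagram S R Dg d0 w"
    and R: "\<And>r. r \<in> R \<Longrightarrow> r \<in> words S \<and> subst_word \<pi> r \<approx> []"
    and C: "\<And>r e. r \<in> R \<Longrightarrow> is_elt e \<Longrightarrow> \<bar>flux (subst_word \<pi> r) e\<bar> \<le> C"
  shows "\<bar>flux (subst_word \<pi> w) root\<bar> \<le> C * int (two_cells Dg d0)"
proof -
  interpret group BG by (rule group_BG)
  have "\<exists>v. v d0 = \<one>\<^bsub>BG\<^esub> \<and> (\<forall>x\<in>darts Dg. v x \<in> carrier BG \<and>
      v (nxt Dg x) = v x \<otimes>\<^bsub>BG\<^esub> eval_letter BG \<pi> (lab Dg x) \<and> v (opp Dg x) = v x \<otimes>\<^bsub>BG\<^esub> eval_letter BG \<pi> (lab Dg x))"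
    using diagram_potential[OF vk \<pi>] R eval_one_iff by blast
  then obtain v0 where v0: "v0 d0 = \<one>\<^bsub>BG\<^esub>" "\<And>x. x \<in> darts Dg \<Longrightarrow> v0 x \<in> carrier BG"
      "\<And>x. x \<in> darts Dg \<Longrightarrow> v0 (nxt Dg x) = v0 x \<otimes>\<^bsub>BG\<^esub> eval_letter BG \<pi> (lab Dg x)"
      "\<And>x. x \<in> darts Dg \<Longrightarrow> v0 (opp Dg x) = v0 x \<otimes>\<^bsub>BG\<^esub> eval_letter BG \<pi> (lab Dg x)" by blast
  have sm: "spherical_map Dg" and d0: "d0 \<in> darts Dg" and bl: "boundary_label Dg d0 = w"
    and lab: "\<And>d. d \<in> darts Dg \<Longrightarrow> lab Dg d \<in> S \<times> UNIV" "\<And>d. d \<in> darts Dg \<Longrightarrow> lab Dg (opp Dg d) = inv_letter (lab Dg d)"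
    and reg: "\<And>f. f \<in> regions_of Dg - {orbit (nxt Dg) d0} \<Longrightarrow> \<exists>d\<in>f. boundary_label Dg d \<in> R \<or> inv_word (boundary_label Dg d) \<in> R"
    using vk unfolding van_kampen_diagram_def by blast+
  have fin: "finite (darts Dg)" and po: "opp Dg permutes darts Dg" and pn: "nxt Dg permutes darts Dg"
    using sm unfolding spherical_map_def by blast+
  define v where "v x = dec (v0 x)" for x
  have v: "is_elt (v x)" "v (nxt Dg x) = acts (subst_letter \<pi> (lab Dg x)) (v x)" "v (opp Dg x) = acts (subst_letter \<pi> (lab Dg x)) (v x)"
    if x: "x \<in> darts Dg" for x
  proof -
    obtain e where e: "v0 x = enc e" "is_elt e" using v0(2)[OF x] by auto
    show "is_elt (v x)" using e by (simp add: v_def)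
    show "v (nxt Dg x) = acts (subst_letter \<pi> (lab Dg x)) (v x)" "v (opp Dg x) = acts (subst_letter \<pi> (lab Dg x)) (v x)"
      unfolding v_def v0(3)[OF x] v0(4)[OF x] e(1) mult_eval_letter[OF lab(1)[OF x] e(2)] by simp_all
  qed
  define h where "h x = flux (subst_letter \<pi> (lab Dg x)) (v x)" for x
  have "h (opp Dg x) = - h x" if x: "x \<in> darts Dg" for x
    unfolding h_def lab(2)[OF x] subst_letter_inv v(3)[OF x]
    using flux_inv[OF subst_letter_words[OF lab(1)[OF x]] v(1)[OF x]] .
  then have "(\<Sum>x\<in>darts Dg. h (opp Dg x)) = - (\<Sum>x\<in>darts Dg. h x)" by (simp add: sum_negf)
  moreover have "(\<Sum>x\<in>darts Dg. h (opp Dg x)) = (\<Sum>x\<in>darts Dg. h x)"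
    using sum.permute[OF po, of h] by (simp add: comp_def)
  ultimately have zero: "(\<Sum>x\<in>darts Dg. h x) = 0" by simp
  have oD: "orbit (nxt Dg) d \<subseteq> darts Dg" if "d \<in> darts Dg" for d using permutes_orbit_subset[OF pn that] .
  have loop: "sum h (orbit (nxt Dg) d) = flux (subst_word \<pi> (boundary_label Dg d)) (v d)" if d: "d \<in> darts Dg" for d
  proof -
    let ?n = "card (orbit (nxt Dg) d)"
    note e = orbit_enum[OF pn fin, of d]
    have iD: "(nxt Dg ^^ i) d \<in> darts Dg" for i
      using d permutes_in_image[OF pn] by (induction i) simp_all
    have "sum h (orbit (nxt Dg) d) = sum h ((\<lambda>i. (nxt Dg ^^ i) d) ` {..<?n})"
      using e(2) by (rule arg_cong)
    also have "\<dots> = (\<Sum>i<?n. h ((nxt Dg ^^ i) d))"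
      unfolding sum.reindex[OF e(3)] comp_def ..
    finally have 1: "sum h (orbit (nxt Dg) d) = (\<Sum>i<?n. h ((nxt Dg ^^ i) d))" .
    have "(\<Sum>i<k. h ((nxt Dg ^^ i) d)) = flux (subst_word \<pi> (map (\<lambda>i. lab Dg ((nxt Dg ^^ i) d)) [0..<k])) (v d) \<and>
        acts (subst_word \<pi> (map (\<lambda>i. lab Dg ((nxt Dg ^^ i) d)) [0..<k])) (v d) = v ((nxt Dg ^^ k) d)" for k
    proof (induction k)
      case (Suc k)
      then show ?case using v(2)[OF iD[of k]] by (simp add: h_def)
    qed simp
    then have 2: "(\<Sum>i<?n. h ((nxt Dg ^^ i) d)) = flux (subst_word \<pi> (boundary_label Dg d)) (v d)"
      unfolding boundary_label_def by blast
    show ?thesis by (rule HOL.trans[OF 1 2])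
  qed
  have inner: "\<bar>sum h f\<bar> \<le> C" if f: "f \<in> regions_of Dg - {orbit (nxt Dg) d0}" for f
  proof -
    obtain d where d: "d \<in> f" "boundary_label Dg d \<in> R \<or> inv_word (boundary_label Dg d) \<in> R" using reg[OF f] by blast
    obtain x where x: "f = orbit (nxt Dg) x" "x \<in> darts Dg" using f unfolding regions_of_def by blast
    have fd: "f = orbit (nxt Dg) d" using orbit_eq[OF pn fin] d(1) unfolding x(1) by metis
    have dD: "d \<in> darts Dg" using d(1) oD[OF x(2)] unfolding x(1) by blast
    let ?b = "boundary_label Dg d"
    show ?thesis unfolding fd loop[OF dD]
      using d(2)
    proof
      assume r: "inv_word ?b \<in> R"
      then have w: "inv_word ?b \<in> words S" using R by blast
      then have b: "subst_word \<pi> ?b \<in> words gens" using subst_word_words by simp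
      have g: "is_elt (acts (subst_word \<pi> ?b) (v d))" using is_elt_acts[OF b v(1)[OF dD]] .
      show "\<bar>flux (subst_word \<pi> ?b) (v d)\<bar> \<le> C"
        using C[OF r g] flux_inv[OF b v(1)[OF dD]] unfolding subst_word_inv by simp
    qed (use C v(1)[OF dD] in blast)
  qed
  have part: "(\<Sum>x\<in>darts Dg. h x) = (\<Sum>f\<in>regions_of Dg. sum h f)"
  proof -
    have U: "\<Union> (regions_of Dg) = darts Dg"
      using oD self_in_orbit[OF pn fin] unfolding regions_of_def by blast
    have "sum h (\<Union> (regions_of Dg)) = (sum \<circ> sum) h (regions_of Dg)"
    proof (rule sum.Union_disjoint)
      show "\<forall>A\<in>regions_of Dg. finite A" using oD fin finite_subset unfolding regions_of_def by blast
      show "\<forall>A\<in>regions_of Dg. \<forall>B'\<in>regions_of Dg. A \<noteq> B' \<longrightarrow> A \<inter> B' = {}"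
      proof (intro ballI impI)
        fix A B' assume "A \<in> regions_of Dg" "B' \<in> regions_of Dg" and ne: "A \<noteq> B'"
        then obtain x y where xy: "A = orbit (nxt Dg) x" "B' = orbit (nxt Dg) y" unfolding regions_of_def by blast
        show "A \<inter> B' = {}"
        proof (rule ccontr)
          assume "A \<inter> B' \<noteq> {}"
          then obtain z where "z \<in> orbit (nxt Dg) x" "z \<in> orbit (nxt Dg) y" unfolding xy by blast
          then show False using ne xy orbit_eq[OF pn fin] by metis
        qed
      qed
    qed
    then show ?thesis unfolding U by simp
  qed
  have finR: "finite (regions_of Dg)" unfolding regions_of_def using fin by (rule finite_imageI)
  have o: "orbit (nxt Dg) d0 \<in> regions_of Dg" unfolding regions_of_def using d0 by (rule imageI)
  have "sum h (orbit (nxt Dg) d0) = - (\<Sum>f\<in>regions_of Dg - {orbit (nxt Dg) d0}. sum h f)"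
    using zero part sum.remove[OF finR o, of "sum h"] by simp
  then have "\<bar>sum h (orbit (nxt Dg) d0)\<bar> \<le> (\<Sum>f\<in>regions_of Dg - {orbit (nxt Dg) d0}. \<bar>sum h f\<bar>)"
    by (simp add: sum_abs)
  also have "\<dots> \<le> (\<Sum>f\<in>regions_of Dg - {orbit (nxt Dg) d0}. C)" using inner by (rule sum_mono)
  also have "\<dots> = C * int (two_cells Dg d0)" by (simp add: two_cells_def)
  finally have "\<bar>flux (subst_word \<pi> w) (v d0)\<bar> \<le> C * int (two_cells Dg d0)" unfolding loop[OF d0] bl .
  moreover have "v d0 = root" using v0(1) by (simp add: v_def)
  ultimately show ?thesis by simp
qed

end

section \<open>Towers against iterated exponentials\<close>

lemma iterated_exp_Suc: "iterated_exp (Suc k) n = 2 ^ iterated_exp k n"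
  by (simp add: iterated_exp_def)

lemma iterated_exp_mono: "m \<le> n \<Longrightarrow> iterated_exp k m \<le> iterated_exp k n"
  by (induction k) (simp_all add: iterated_exp_Suc, simp add: iterated_exp_def)

lemma iterated_exp_ge: "n \<le> iterated_exp k n"
proof (induction k)
  case (Suc k)
  have "iterated_exp k n \<le> iterated_exp (Suc k) n" unfolding iterated_exp_Suc using less_exp[of "iterated_exp k n"] by simp
  then show ?case using Suc by simp
qed (simp add: iterated_exp_def)

lemma tower_add: "tower (k + m) = iterated_exp k (tower m)"
  by (induction k) (simp_all add: iterated_exp_Suc iterated_exp_def)

lemma tower_ge: "2 ^ m \<le> tower m"
proof (induction m)
  case (Suc m)
  have "Suc m \<le> 2 ^ m" by (rule Suc_leI[OF less_exp])
  then have "Suc m \<le> tower m" using Suc by simp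
  then have "2 ^ Suc m \<le> (2::nat) ^ tower m" by (intro power_increasing) simp_all
  then show ?case by (simp only: tower_simps)
qed simp

lemma square_less_exp: "5 \<le> X \<Longrightarrow> X * X < (2::nat) ^ X"
proof (induction X rule: dec_induct)
  case (step X)
  have "Suc X * Suc X = X * X + 2 * X + 1" by simp
  also have "\<dots> < X * X + X * X"
  proof -
    have "5 * X \<le> X * X" using step(1) by (intro mult_right_mono) simp_all
    then show ?thesis using step(1) by linarith
  qed
  finally show ?case using step(3) by simp
qed simp

text \<open>Of the levels of \<open>tower n\<close>, K match the iterated exponential and the other
  m + 1 already exceed 2^(2^m), hence any fixed multiple of 2^(n+1) for large m. The constant
  \<open>q\<close> collects all requirements: the factor 4 from 2^X = 4 * 2^(X-2), the summand 5 for
  X^2 < 2^X.\<close>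

lemma tower_wins:
  fixes K c B' C' :: nat
  shows "\<exists>n. 2 \<le> tower n \<and> C' * iterated_exp K (c * 2 ^ Suc n) + B' * 2 ^ Suc n < 2 ^ (tower n - 2)"
proof -
  define q where "q = c + B' + 4 * (C' + 1) + 5"
  define m where "m = q + K + 3"
  define n where "n = K + Suc m"
  define Y where "Y = tower (Suc m)"
  define X where "X = iterated_exp K Y"
  have twn: "tower n = X" unfolding n_def X_def Y_def by (rule tower_add)
  have "m + m \<le> 2 ^ m"
  proof -
    have "1 \<le> m" by (simp add: m_def)
    then show ?thesis by (induction m rule: dec_induct) auto
  qed
  then have e: "q + Suc n \<le> 2 ^ m" unfolding n_def m_def by simp
  have "q * 2 ^ Suc n \<le> 2 ^ q * 2 ^ Suc n" using less_exp[of q] by (intro mult_right_mono) simp_all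
  also have "\<dots> = 2 ^ (q + Suc n)" by (simp add: power_add)
  also have "\<dots> \<le> 2 ^ (2 ^ m)" using e by (intro power_increasing) simp_all
  also have "\<dots> \<le> Y" unfolding Y_def using tower_ge[of m] by (simp add: power_increasing)
  finally have Y: "q * 2 ^ Suc n \<le> Y" .
  have XY: "Y \<le> X" unfolding X_def by (rule iterated_exp_ge)
  have "c * 2 ^ Suc n \<le> q * 2 ^ Suc n" "B' * 2 ^ Suc n \<le> q * 2 ^ Suc n"
    by (intro mult_right_mono; simp add: q_def)+
  then have 1: "iterated_exp K (c * 2 ^ Suc n) \<le> X" and 2: "B' * 2 ^ Suc n \<le> X"
    using Y XY iterated_exp_mono[of "c * 2 ^ Suc n" Y K] unfolding X_def by linarith+
  have "q * 1 \<le> q * 2 ^ Suc n" by (intro mult_left_mono) simp_all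
  then have q: "q \<le> X" using Y XY by linarith
  then have X5: "5 \<le> X" and CX: "4 * (C' + 1) \<le> X" by (simp_all add: q_def)
  have "4 * (C' * iterated_exp K (c * 2 ^ Suc n) + B' * 2 ^ Suc n) \<le> 4 * (C' * X + X)"
    by (intro mult_left_mono add_mono 1 2) simp_all
  also have "\<dots> = 4 * (C' + 1) * X" by (simp add: algebra_simps)
  also have "\<dots> \<le> X * X" using CX by (intro mult_right_mono) simp_all
  also have "\<dots> < 2 ^ X" using square_less_exp[OF X5] .
  also have "(2::nat) ^ X = 4 * 2 ^ (X - 2)"
  proof -
    have "X = (X - 2) + 2" using X5 by simp
    then have "(2::nat) ^ X = 2 ^ (X - 2) * 2 ^ 2" by (metis power_add)
    then show ?thesis by simp
  qed
  finally have "C' * iterated_exp K (c * 2 ^ Suc n) + B' * 2 ^ Suc n < 2 ^ (X - 2)" by simp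
  then show ?thesis using X5 unfolding twn[symmetric] by (intro exI[of _ n]) simp
qed

text \<open>The commutator is rewritten over \<open>S\<close> by \<open>\<delta>\<close> and read
  back by \<open>subst_word\<close>. A relator of the given presentation has value at most
  \<open>C\<close> and the round trip changes the value by at most \<open>B'\<close> per letter, so
  2^(\<open>tower n\<close> - 2) is at most \<open>C\<close> times the area plus \<open>B'\<close>
  times the length.\<close>

lemma not_elementary:
  fixes S :: "nat set"
  assumes fp: "finite_presentation_of BG S R"
  shows "\<not> elementary_bounded (dehn_function S R)"
proof
  interpret group BG by (rule group_BG)
  assume "elementary_bounded (dehn_function S R)"
  then obtain K where K: "\<And>n. dehn_function S R n \<le> enat (iterated_exp K n)" unfolding elementary_bounded_def by blast
  obtain \<pi> where finR: "finite R" and RS: "R \<subseteq> words S" and \<pi>: "\<pi> ` S \<subseteq> carrier BG"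
    and gen: "generate BG (\<pi> ` S) = carrier BG"
    and pe: "\<And>w. w \<in> words S \<Longrightarrow> eval_word BG \<pi> w = \<one>\<^bsub>BG\<^esub> \<longleftrightarrow> pres_eq S R w []"
    using fp unfolding finite_presentation_of_def by blast
  have R: "r \<in> words S \<and> subst_word \<pi> r \<approx> []" if r: "r \<in> R" for r
  proof -
    have "r \<in> words S" using r RS by blast
    moreover have "pres_eq S R r []" using pres_eq.relator[of "[]" S "[]" r R] r by simp
    ultimately show ?thesis using pe eval_one_iff[OF \<pi>] by blast
  qed
  have "\<forall>r\<in>R. \<exists>b. \<forall>e. is_elt e \<longrightarrow> \<bar>flux (subst_word \<pi> r) e\<bar> \<le> b"
  proof
    fix r assume "r \<in> R"
    then show "\<exists>b. \<forall>e. is_elt e \<longrightarrow> \<bar>flux (subst_word \<pi> r) e\<bar> \<le> b" using flux_peq[of "subst_word \<pi> r" "[]"] R by simp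
  qed
  then obtain b where b: "\<And>r e. r \<in> R \<Longrightarrow> is_elt e \<Longrightarrow> \<bar>flux (subst_word \<pi> r) e\<bar> \<le> b r" unfolding bchoice_iff by blast
  define C where "C = (\<Sum>r\<in>R. nat \<bar>b r\<bar>)"
  have C: "\<bar>flux (subst_word \<pi> r) e\<bar> \<le> int C" if "r \<in> R" "is_elt e" for r e
  proof -
    have "nat \<bar>b r\<bar> \<le> C" unfolding C_def using finR that(1) by (intro member_le_sum) simp_all
    then have "b r \<le> int C" by simp
    then show ?thesis using b[OF that] by (rule order.trans[rotated])
  qed
  have "\<forall>x\<in>letters. \<exists>w. w \<in> words S \<and> eval_word BG \<pi> w = gen_of x"
  proof
    fix x assume "x \<in> letters"
    then have "gen_of x \<in> generate BG (\<pi> ` S)" unfolding gen by (rule gen_of_carrier)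
    then show "\<exists>w. w \<in> words S \<and> eval_word BG \<pi> w = gen_of x"
      using generate_eval_word[OF \<pi>] unfolding Bex_def by simp
  qed
  from bchoice[OF this] obtain \<delta> where d: "\<forall>x\<in>letters. \<delta> x \<in> words S \<and> eval_word BG \<pi> (\<delta> x) = gen_of x" by (rule exE)
  have \<delta>: "\<delta> x \<in> words S" "eval_word BG \<pi> (\<delta> x) = gen_of x" if "x \<in> letters" for x
    using bspec[OF d that] by (rule conjunct1, rule conjunct2)
  have \<delta>x: "subst_word \<pi> (\<delta> x) \<approx> [x]" if x: "x \<in> letters" for x
    using \<delta>(2)[OF x] unfolding eval_word_subst[OF \<pi> \<delta>(1)[OF x]] gen_of_def
    using peq_iff[OF subst_word_words[OF \<pi> \<delta>(1)[OF x]], of "[x]"] x by simp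
  \<comment> \<open>The round trip returns a word equal to the letter only modulo the relators, so
    its value differs by a bounded error.\<close>
  have "\<forall>x\<in>letters. \<exists>b. \<forall>e. is_elt e \<longrightarrow> \<bar>flux (subst_word \<pi> (\<delta> x)) e - flux [x] e\<bar> \<le> b"
    by (intro ballI flux_peq \<delta>x)
  from bchoice[OF this] obtain b' where bb: "\<forall>x\<in>letters. \<forall>e. is_elt e \<longrightarrow> \<bar>flux (subst_word \<pi> (\<delta> x)) e - flux [x] e\<bar> \<le> b' x"
    by (rule exE)
  have b': "\<bar>flux (subst_word \<pi> (\<delta> x)) e - flux [x] e\<bar> \<le> b' x" if "x \<in> letters" "is_elt e" for x e
    using bspec[OF bb that(1)] that(2) by (elim allE impE)
  have finL: "finite letters" unfolding letters_eq by simp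
  define B' where "B' = (\<Sum>x\<in>letters. nat \<bar>b' x\<bar>)"
  define \<Lambda> where "\<Lambda> = (\<Sum>x\<in>letters. length (\<delta> x))"
  have B': "\<bar>flux (subst_word \<pi> (\<delta> x)) e - flux_letter x e\<bar> \<le> int B'" if "x \<in> letters" "is_elt e" for x e
  proof -
    have "nat \<bar>b' x\<bar> \<le> B'" unfolding B'_def using finL that(1) by (intro member_le_sum) simp_all
    then show ?thesis using b'[OF that] by simp
  qed
  have \<Lambda>: "length (\<delta> x) \<le> \<Lambda>" if "x \<in> letters" for x
    unfolding \<Lambda>_def using finL that by (intro member_le_sum) simp_all
  define \<Delta> where "\<Delta> w = concat (map \<delta> w)" for w
  have \<Delta>: "\<Delta> w \<in> words S \<and> length (\<Delta> w) \<le> \<Lambda> * length w \<and>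
      (\<forall>e. is_elt e \<longrightarrow> acts (subst_word \<pi> (\<Delta> w)) e = acts w e \<and> \<bar>flux (subst_word \<pi> (\<Delta> w)) e - flux w e\<bar> \<le> int B' * int (length w))"
    if "w \<in> words gens" for w
    using that
  proof (induction w)
    case Nil
    then show ?case by (simp add: \<Delta>_def)
  next
    case (Cons x w)
    have x: "x \<in> letters" "w \<in> words gens" using Cons.prems by (simp_all only: words_Cons)
    have D: "\<Delta> (x # w) = \<delta> x @ \<Delta> w" by (simp add: \<Delta>_def)
    note IH = Cons.IH[OF x(2)]
    have "\<Delta> (x # w) \<in> words S" using IH \<delta>(1)[OF x(1)] by (simp add: D)
    moreover have "length (\<Delta> (x # w)) \<le> \<Lambda> * length (x # w)" using IH \<Lambda>[OF x(1)] by (simp add: D)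
    moreover have "acts (subst_word \<pi> (\<Delta> (x # w))) e = acts (x # w) e \<and>
        \<bar>flux (subst_word \<pi> (\<Delta> (x # w))) e - flux (x # w) e\<bar> \<le> int B' * int (length (x # w))" if e: "is_elt e" for e
    proof -
      have a: "acts (subst_word \<pi> (\<delta> x)) e = act x e" using pres_eq_acts[OF \<delta>x[OF x(1)] e] by simp
      have g: "is_elt (act x e)" using is_elt_act[OF x(1) e] .
      have "\<bar>flux (subst_word \<pi> (\<Delta> w)) (act x e) - flux w (act x e)\<bar> \<le> int B' * int (length w)" using IH g by blast
      then have "\<bar>flux (subst_word \<pi> (\<Delta> (x # w))) e - flux (x # w) e\<bar> \<le> int B' + int B' * int (length w)"
        using B'[OF x(1) e] unfolding D subst_word_simps flux_append flux.simps a by linarith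
      moreover have "acts (subst_word \<pi> (\<Delta> w)) (act x e) = acts w (act x e)" using IH g by blast
      ultimately show ?thesis by (simp add: D a algebra_simps)
    qed
    ultimately show ?case by blast
  qed
  \<comment> \<open>The factors 12 come from \<open>length_commutator_word\<close>.\<close>
  obtain n where n: "2 \<le> tower n" "C * iterated_exp K (\<Lambda> * 12 * 2 ^ Suc n) + B' * 12 * 2 ^ Suc n < 2 ^ (tower n - 2)"
    using tower_wins by blast
  define w where "w = \<Delta> (commutator_word (Suc n))"
  note Dw' = \<Delta>[OF commutator_word_words, of "Suc n", folded w_def]
  have Dw: "w \<in> words S" "length w \<le> \<Lambda> * length (commutator_word (Suc n))"
    "acts (subst_word \<pi> w) root = acts (commutator_word (Suc n)) root"
    "\<bar>flux (subst_word \<pi> w) root - flux (commutator_word (Suc n)) root\<bar> \<le> int B' * int (length (commutator_word (Suc n)))"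
    using Dw' is_elt_root by blast+
  have one: "pres_eq S R w []"
  proof -
    have "eval_word BG \<pi> w = \<one>\<^bsub>BG\<^esub>"
      unfolding eval_word_subst[OF \<pi> Dw(1)] Dw(3) acts_commutator_word by simp
    then show ?thesis using pe[OF Dw(1)] by simp
  qed
  have len: "length w \<le> \<Lambda> * 12 * 2 ^ Suc n"
  proof -
    note Dw(2)
    also have "\<Lambda> * length (commutator_word (Suc n)) \<le> \<Lambda> * (12 * 2 ^ Suc n)" by (rule mult_left_mono[OF length_commutator_word]) simp
    finally show ?thesis by (simp only: mult.assoc)
  qed
  have "area S R w \<le> dehn_function S R (\<Lambda> * 12 * 2 ^ Suc n)"
    unfolding dehn_function_def using Dw(1) one len by (intro SUP_upper) simp
  also have "\<dots> \<le> enat (iterated_exp K (\<Lambda> * 12 * 2 ^ Suc n))" by (rule K)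
  finally have "area S R w < enat (iterated_exp K (\<Lambda> * 12 * 2 ^ Suc n) + 1)"
    by (rule order.strict_trans1) simp
  then obtain k where k: "k \<in> diagram_areas S R w" "enat k < enat (iterated_exp K (\<Lambda> * 12 * 2 ^ Suc n) + 1)"
    unfolding area_def INF_less_iff by (elim bexE)
  then have k': "k \<le> iterated_exp K (\<Lambda> * 12 * 2 ^ Suc n)" unfolding enat_ord_simps by linarith
  have "\<bar>flux (subst_word \<pi> w) root\<bar> \<le> int C * int k"
    using k(1) unfolding diagram_areas_def
  proof (elim UnE)
    assume "k \<in> {two_cells Dg d0 | (Dg :: (nat, nat) diagram) d0. van_kampen_diagram S R Dg d0 w}"
    then obtain Dg :: "(nat, nat) diagram" and d0 where d: "k = two_cells Dg d0" "van_kampen_diagram S R Dg d0 w" by blast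
    show ?thesis unfolding d(1) by (rule area_bound[OF \<pi> d(2) R C])
  qed simp
  also have "int C * int k \<le> int (C * iterated_exp K (\<Lambda> * 12 * 2 ^ Suc n))"
    using mult_left_mono[OF k', of C] by (simp only: of_nat_mult[symmetric] of_nat_le_iff)
  finally have 1: "\<bar>flux (subst_word \<pi> w) root\<bar> \<le> int (C * iterated_exp K (\<Lambda> * 12 * 2 ^ Suc n))" .
  have "\<bar>flux (subst_word \<pi> w) root - 2 ^ (tower n - 2)\<bar> \<le> int B' * int (length (commutator_word (Suc n)))"
    using Dw(4) unfolding flux_commutator_word[OF n(1)] .
  also have "\<dots> \<le> int (B' * 12 * 2 ^ Suc n)"
    using mult_left_mono[OF length_commutator_word[of "Suc n"], of B'] by (simp only: of_nat_mult[symmetric] of_nat_le_iff mult.assoc)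
  finally have "2 ^ (tower n - 2) \<le> int (C * iterated_exp K (\<Lambda> * 12 * 2 ^ Suc n)) + int (B' * 12 * 2 ^ Suc n)"
    using 1 by linarith
  then have "int (2 ^ (tower n - 2)) \<le> int (C * iterated_exp K (\<Lambda> * 12 * 2 ^ Suc n) + B' * 12 * 2 ^ Suc n)"
    by simp
  then show False using n(2) unfolding of_nat_le_iff by (rule leD[THEN notE])
qed

theorem corollary5p4:
  shows "\<exists>G :: nat monoid. autostackable G \<and> nonelementary_dehn_function G"
proof (intro exI conjI)
  show "autostackable BG" by (rule autostackable_BG)
  show "nonelementary_dehn_function BG"
    unfolding nonelementary_dehn_function_def using finite_presentation_BG not_elementary by blast
qed

end
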